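(* Let $f$ be a continuous map and let $X$ be an isolated invariant set for $f$ with finitely many connected components. Then there are only finitely many essential quasicomponents $F_1,\ldots,F_m$ of $W^u_\infty\setminus(\tilde X\cup\{\infty\})$, and there is a $\mathbb K$-linear isomorphism between $\check H^1(W^u_\infty,\tilde X\cup\{\infty\};\mathbb K)$ and the $\mathbb K$-vector space with basis $\{F_1,\ldots,F_m\}$ which conjugates the induced map $\tilde f^*$ on $\check H^1(W^u_\infty,\tilde X\cup\{\infty\};\mathbb K)$ with the linear map given on the basis by the permutation $F_j\mapsto \tilde f^{-1}(F_j)$.
   Context: Setting. $M$ is a locally compact, paracompact Hausdorff space, $f\colon D\to M$ is a continuous map defined on an open set $D\subseteq M$. $\check H^*$ denotes Čech cohomology with coefficients in the field $\mathbb K$, where $\mathbb K=\mathbb Q$ or $\mathbb C$. For $A\subseteq D$, $\mathrm{Inv}(A)$ is the set of $p\in A$ for which there is a sequence $(p_i)_{i\in\mathbb Z}$ in $A$ with $p_0=p$ and $f(p_i)=p_{i+1}$ for all $i$. A compact set $X\subseteq D$ with $f(X)=X$ is an isolated invariant set if it has a compact neighbourhood $A\subseteq D$ with $X=\mathrm{Inv}(A)$ (such $A$ is an isolating neighbourhood of $X$). Index pairs. An index pair for $f$ and $X$ is a pair of compact sets $L\subseteq N\subseteq D$ such that (i) $\overline{N\setminus L}$ is an isolating neighbourhood of $X$ and $X\cap L=\emptyset$; (ii) $f(N\setminus L)\subseteq N$; (iii) $f(L)\cap N\subseteq L$. The index map is the continuous map $f_\#\colon (N/L,[L])\to(N/L,[L])$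 of the pointed quotient space given by $f_\#(p)=f(p)$ if $p,f(p)\in N\setminus L$ and $f_\#(p)=[L]$ otherwise (if $L=\emptyset$, $N/L$ is $N$ with a disjoint base point added). Compactified unstable manifold. $W^u_\infty$ is the inverse limit of $N/L\xleftarrow{f_\#}N/L\xleftarrow{f_\#}\cdots$, i.e. the compact Hausdorff space of sequences $\xi=(\xi_i)_{i\ge0}$ in $N/L$ with $f_\#(\xi_{i+1})=\xi_i$; the point $\infty$ is the constant sequence $([L],[L],\ldots)$. The map $\tilde f(\xi_0,\xi_1,\ldots)=(f_\#(\xi_0),\xi_0,\xi_1,\ldots)$ is a homeomorphism of $W^u_\infty$ fixing $\infty$, and $\tilde X=\{\xi\in W^u_\infty:\xi_i\in X\text{ for all }i\}$ is a compact $\tilde f$-invariant subset. (Up to homeomorphism and conjugation these objects do not depend on the index pair.) Quasicomponents. The quasicomponent of a point $z$ in a space $Z$ is the intersection of all clopen subsets of $Z$ containing $z$. A quasicomponent $F$ of $W^u_\infty\setminus(\tilde X\cup\{\infty\})$ is essential if its closure in $W^u_\infty$ contains $\infty$ and meets $\tilde X$. The homeomorphism $\tilde f$ permutes the essential quasicomponents. Standing assumption. $X$ has an index pair $(N,L)$ such that $\check H^q(N/L;\mathbb K)$ is finite dimensional in every degree (automatic if $M$ is a locally compact metrizable absolute neighbourhood retract, e.g. a topological manifold); consequently $\check H^q(W^u_\infty;\mathbb K)$ is finite dimensional in every degree $q$. *)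

theory Defs
  imports
    "HOL-Analysis.Analysis"
    "HOL-Algebra.QuotRing"
    "Jordan_Normal_Form.VS_Connect"
begin

section \<open>Paracompactness\<close>

definition paracompact_space :: "'a topology \<Rightarrow> bool" where
  "paracompact_space M \<longleftrightarrow>
     (\<forall>\<U>. (\<forall>U\<in>\<U>. openin M U) \<and> \<Union>\<U> = topspace M \<longrightarrow>
        (\<exists>\<V>. (\<forall>V\<in>\<V>. openin M V) \<and> \<Union>\<V> = topspace M \<and>
             (\<forall>V\<in>\<V>. \<exists>U\<in>\<U>. V \<subseteq> U) \<and> locally_finite_in M \<V>))"


section \<open>Cech cohomology of a pair\<close>

text \<open>An open cover of the pair \<open>(X, A)\<close> consists of an open cover of \<open>X\<close> together with a
  subfamily that covers \<open>A\<close>. Its cochain complex is the ordered cochain complex of the nerve of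
  the cover relative to the nerve of the traces on \<open>A\<close> of the subfamily, and Cech cohomology is
  the direct limit, over all covers directed by refinement, of the cohomology of these complexes.
  Covers are sets, not indexed families, of open sets; this gives a cofinal class of covers.\<close>

type_synonym 'b cover_pair = "'b set set \<times> 'b set set"
type_synonym ('b, 'k) cochain = "'b set list \<Rightarrow> 'k"

definition cover_pair :: "'b topology \<Rightarrow> 'b set \<Rightarrow> 'b cover_pair \<Rightarrow> bool" where
  "cover_pair X A c \<longleftrightarrow>
     (\<forall>U\<in>fst c. openin X U) \<and> \<Union>(fst c) = topspace X \<and> snd c \<subseteq> fst c \<and> A \<subseteq> \<Union>(snd c)"

text \<open>Ordered \<open>q\<close>-simplices, repeated vertices allowed, of the nerve of the traces on \<open>S\<close>.\<close>

definition nerve :: "'b set \<Rightarrow> 'b set set \<Rightarrow> nat \<Rightarrow> 'b set list set" where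
  "nerve S \<U> q = {\<sigma>. length \<sigma> = Suc q \<and> set \<sigma> \<subseteq> \<U> \<and> S \<inter> \<Inter>(set \<sigma>) \<noteq> {}}"

text \<open>Cochains are total functions on lists, set to \<open>0\<close> on all lists that are not simplices.\<close>

definition cochains ::
  "nat \<Rightarrow> 'b topology \<Rightarrow> 'b set \<Rightarrow> 'b cover_pair \<Rightarrow> ('b, 'k::field) cochain set" where
  "cochains q X A c =
     {\<phi>. \<forall>\<sigma>. \<phi> \<sigma> \<noteq> 0 \<longrightarrow> \<sigma> \<in> nerve (topspace X) (fst c) q - nerve A (snd c) q}"

definition coboundary ::
  "nat \<Rightarrow> 'b topology \<Rightarrow> 'b cover_pair \<Rightarrow> ('b, 'k::field) cochain \<Rightarrow> ('b, 'k) cochain" where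
  "coboundary q X c \<phi> =
     (\<lambda>\<sigma>. if \<sigma> \<in> nerve (topspace X) (fst c) (Suc q)
          then \<Sum>i\<le>Suc q. (-1) ^ i * \<phi> (take i \<sigma> @ drop (Suc i) \<sigma>) else 0)"

definition cocycles ::
  "nat \<Rightarrow> 'b topology \<Rightarrow> 'b set \<Rightarrow> 'b cover_pair \<Rightarrow> ('b, 'k::field) cochain set" where
  "cocycles q X A c = {\<phi> \<in> cochains q X A c. coboundary q X c \<phi> = (\<lambda>_. 0)}"

definition coboundaries ::
  "nat \<Rightarrow> 'b topology \<Rightarrow> 'b set \<Rightarrow> 'b cover_pair \<Rightarrow> ('b, 'k::field) cochain set" where
  "coboundaries q X A c =
     (case q of 0 \<Rightarrow> {\<lambda>_. 0} | Suc p \<Rightarrow> coboundary p X c ` cochains p X A c)"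

text \<open>\<open>projection g d c p\<close>: \<open>p\<close> is a vertex map from the nerves of \<open>d\<close> to those of \<open>c\<close> that
  covers the map of spaces \<open>g\<close>. For \<open>g = id\<close> this says that \<open>d\<close> refines \<open>c\<close> via \<open>p\<close>.\<close>

definition projection ::
  "('b \<Rightarrow> 'c) \<Rightarrow> 'b cover_pair \<Rightarrow> 'c cover_pair \<Rightarrow> ('b set \<Rightarrow> 'c set) \<Rightarrow> bool" where
  "projection g d c p \<longleftrightarrow> (\<forall>V\<in>fst d. p V \<in> fst c \<and> g ` V \<subseteq> p V) \<and> p ` snd d \<subseteq> snd c"

definition cochain_pullback ::
  "nat \<Rightarrow> 'b topology \<Rightarrow> 'b cover_pair \<Rightarrow> ('b set \<Rightarrow> 'c set) \<Rightarrow>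
     ('c, 'k::field) cochain \<Rightarrow> ('b, 'k) cochain" where
  "cochain_pullback q X d p \<phi> =
     (\<lambda>\<sigma>. if \<sigma> \<in> nerve (topspace X) (fst d) q then \<phi> (map p \<sigma>) else 0)"

text \<open>Elements of the direct limit are represented by cocycles on some cover; two cocycles
  represent the same element iff they become cohomologous on a common refinement.\<close>

definition cech_cocycles ::
  "nat \<Rightarrow> 'b topology \<Rightarrow> 'b set \<Rightarrow> ('b cover_pair \<times> ('b, 'k::field) cochain) set" where
  "cech_cocycles q X A = {(c, \<phi>). cover_pair X A c \<and> \<phi> \<in> cocycles q X A c}"

definition cech_rel ::
  "nat \<Rightarrow> 'b topology \<Rightarrow> 'b set \<Rightarrow> ('b cover_pair \<times> ('b, 'k::field) cochain) rel" where
  "cech_rel q X A =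
     {((c, \<phi>), (d, \<psi>)). (c, \<phi>) \<in> cech_cocycles q X A \<and> (d, \<psi>) \<in> cech_cocycles q X A \<and>
        (\<exists>e p r. cover_pair X A e \<and> projection id e c p \<and> projection id e d r \<and>
           (\<lambda>\<sigma>. cochain_pullback q X e p \<phi> \<sigma> - cochain_pullback q X e r \<psi> \<sigma>)
             \<in> coboundaries q X A e)}"

type_synonym ('b, 'k) cech_class = "('b cover_pair \<times> ('b, 'k) cochain) set"

text \<open>The ring structure fields of the record \<open>module\<close> play no role in a vector space.
  Absolute cohomology is the case \<open>A = {}\<close>.\<close>

definition cech_cohomology ::
  "nat \<Rightarrow> 'b topology \<Rightarrow> 'b set \<Rightarrow> ('k::field, ('b, 'k) cech_class) module" where
  "cech_cohomology q X A =
     \<lparr>carrier = cech_cocycles q X A // cech_rel q X A,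
      mult = undefined, one = undefined,
      zero = cech_rel q X A `` {(c, \<lambda>_. 0) |c. cover_pair X A c},
      add = (\<lambda>a b. cech_rel q X A `` {(c, \<lambda>\<sigma>. \<phi> \<sigma> + \<psi> \<sigma>) |c \<phi> \<psi>. (c, \<phi>) \<in> a \<and> (c, \<psi>) \<in> b}),
      smult = (\<lambda>k a. cech_rel q X A `` {(c, \<lambda>\<sigma>. k * \<phi> \<sigma>) |c \<phi>. (c, \<phi>) \<in> a})\<rparr>"

text \<open>The map \<open>g\<^sup>*\<close> induced by a continuous map \<open>g\<close> from \<open>(X, A)\<close> to a pair of spaces.\<close>

definition cech_induced ::
  "nat \<Rightarrow> 'b topology \<Rightarrow> 'b set \<Rightarrow> ('b \<Rightarrow> 'c) \<Rightarrow> ('c, 'k::field) cech_class \<Rightarrow>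
     ('b, 'k) cech_class" where
  "cech_induced q X A g a =
     cech_rel q X A ``
       {(d, cochain_pullback q X d p \<phi>) |d p c \<phi>.
          (c, \<phi>) \<in> a \<and> cover_pair X A d \<and> projection g d c p}"


section \<open>Free vector spaces\<close>

definition free_vector_space :: "'e set \<Rightarrow> ('k::field, 'e \<Rightarrow> 'k) module" where
  "free_vector_space E =
     \<lparr>carrier = {v. finite {F. v F \<noteq> 0} \<and> {F. v F \<noteq> 0} \<subseteq> E},
      mult = undefined, one = undefined,
      zero = (\<lambda>_. 0), add = (\<lambda>v w F. v F + w F), smult = (\<lambda>k v F. k * v F)\<rparr>"

definition basis_vector :: "'e \<Rightarrow> 'e \<Rightarrow> 'k::field" where
  "basis_vector F = (\<lambda>G. if G = F then 1 else 0)"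


section \<open>Isolated invariant sets and index pairs\<close>

definition Inv :: "('a \<Rightarrow> 'a) \<Rightarrow> 'a set \<Rightarrow> 'a set" where
  "Inv f A = {p \<in> A. \<exists>s::int \<Rightarrow> 'a. (\<forall>i. s i \<in> A) \<and> s 0 = p \<and> (\<forall>i. f (s i) = s (i + 1))}"

definition isolating_neighbourhood ::
  "'a topology \<Rightarrow> 'a set \<Rightarrow> ('a \<Rightarrow> 'a) \<Rightarrow> 'a set \<Rightarrow> 'a set \<Rightarrow> bool" where
  "isolating_neighbourhood M D f X A \<longleftrightarrow>
     compactin M A \<and> A \<subseteq> D \<and> X \<subseteq> M interior_of A \<and> X = Inv f A"

definition isolated_invariant_set ::
  "'a topology \<Rightarrow> 'a set \<Rightarrow> ('a \<Rightarrow> 'a) \<Rightarrow> 'a set \<Rightarrow> bool" where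
  "isolated_invariant_set M D f X \<longleftrightarrow>
     compactin M X \<and> X \<subseteq> D \<and> f ` X = X \<and> (\<exists>A. isolating_neighbourhood M D f X A)"

definition index_pair ::
  "'a topology \<Rightarrow> 'a set \<Rightarrow> ('a \<Rightarrow> 'a) \<Rightarrow> 'a set \<Rightarrow> 'a set \<Rightarrow> 'a set \<Rightarrow> bool" where
  "index_pair M D f X N L \<longleftrightarrow>
     compactin M L \<and> compactin M N \<and> L \<subseteq> N \<and> N \<subseteq> D \<and>
     isolating_neighbourhood M D f X (M closure_of (N - L)) \<and> X \<inter> L = {} \<and>
     f ` (N - L) \<subseteq> N \<and>
     f ` L \<inter> N \<subseteq> L"


section \<open>The pointed space \<open>N/L\<close> and the index map\<close>

text \<open>\<open>None\<close> is the base point \<open>[L]\<close>, and \<open>Some x\<close> is the class of \<open>x \<in> N - L\<close>. The base point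
  is always present; for \<open>L = {}\<close> the topology below makes it isolated.\<close>

definition quotient_proj :: "'a set \<Rightarrow> 'a \<Rightarrow> 'a option" where
  "quotient_proj L x = (if x \<in> L then None else Some x)"

definition index_space :: "'a topology \<Rightarrow> 'a set \<Rightarrow> 'a set \<Rightarrow> 'a option topology" where
  "index_space M N L =
     topology (\<lambda>U. U \<subseteq> insert None (Some ` (N - L)) \<and>
                   openin (subtopology M N) {x \<in> topspace (subtopology M N). quotient_proj L x \<in> U})"

lemma openin_index_space:
  "openin (index_space M N L) U \<longleftrightarrow>
     U \<subseteq> insert None (Some ` (N - L)) \<and>
     openin (subtopology M N) {x \<in> topspace (subtopology M N). quotient_proj L x \<in> U}"
proof -
  let ?T = "subtopology M N"
  let ?q = "\<lambda>U. {x \<in> topspace ?T. quotient_proj L x \<in> U}"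
  have Int: "?q (U \<inter> V) = ?q U \<inter> ?q V" for U V
    by blast
  have Union: "?q (\<Union>\<K>) = \<Union>(?q ` \<K>)" for \<K>
    by blast
  have "istopology (\<lambda>U. U \<subseteq> insert None (Some ` (N - L)) \<and> openin ?T (?q U))"
    unfolding istopology_def Int Union
    by (intro conjI allI impI openin_Int openin_Union) blast+
  then show ?thesis
    unfolding index_space_def by (simp only: topology_inverse')
qed

lemma topspace_index_space:
  assumes "L \<subseteq> N" "N \<subseteq> topspace M"
  shows "topspace (index_space M N L) = insert None (Some ` (N - L))"
proof -
  have "{x \<in> topspace (subtopology M N). quotient_proj L x \<in> insert None (Some ` (N - L))}
      = topspace (subtopology M N)"
    by (auto simp: quotient_proj_def)
  then have "openin (index_space M N L) (insert None (Some ` (N - L)))"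
    by (simp only: openin_index_space openin_topspace subset_refl simp_thms)
  then show ?thesis
    by (meson openin_index_space openin_subset openin_topspace subset_antisym)
qed

lemma quotient_map_index_space:
  assumes "L \<subseteq> N" "N \<subseteq> topspace M" "L \<noteq> {}"
  shows "quotient_map (subtopology M N) (index_space M N L) (quotient_proj L)"
proof -
  have top: "topspace (subtopology M N) = N"
    using assms by auto
  show ?thesis
    unfolding quotient_map_def topspace_index_space[OF assms(1,2)] openin_index_space top
  proof (intro conjI allI impI)
    show "quotient_proj L ` N = insert None (Some ` (N - L))"
      using assms by (force simp: quotient_proj_def image_iff)
  qed blast
qed

definition index_map :: "'a set \<Rightarrow> 'a set \<Rightarrow> ('a \<Rightarrow> 'a) \<Rightarrow> 'a option \<Rightarrow> 'a option" where
  "index_map N L f z =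
     (case z of None \<Rightarrow> None
      | Some p \<Rightarrow> if p \<in> N - L \<and> f p \<in> N - L then Some (f p) else None)"


section \<open>The compactified unstable manifold\<close>

definition Wu :: "'a topology \<Rightarrow> ('a \<Rightarrow> 'a) \<Rightarrow> 'a set \<Rightarrow> 'a set \<Rightarrow> (nat \<Rightarrow> 'a option) topology" where
  "Wu M f N L =
     subtopology (product_topology (\<lambda>_. index_space M N L) UNIV)
       {\<xi>. \<forall>i. index_map N L f (\<xi> (Suc i)) = \<xi> i}"

definition Wu_infty :: "nat \<Rightarrow> 'a option" where
  "Wu_infty = (\<lambda>_. None)"

definition shift_map ::
  "('a \<Rightarrow> 'a) \<Rightarrow> 'a set \<Rightarrow> 'a set \<Rightarrow> (nat \<Rightarrow> 'a option) \<Rightarrow> nat \<Rightarrow> 'a option" where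
  "shift_map f N L \<xi> = (\<lambda>i. case i of 0 \<Rightarrow> index_map N L f (\<xi> 0) | Suc j \<Rightarrow> \<xi> j)"

definition Xtilde ::
  "'a topology \<Rightarrow> ('a \<Rightarrow> 'a) \<Rightarrow> 'a set \<Rightarrow> 'a set \<Rightarrow> 'a set \<Rightarrow> (nat \<Rightarrow> 'a option) set" where
  "Xtilde M f N L X = {\<xi> \<in> topspace (Wu M f N L). \<forall>i. \<xi> i \<in> Some ` X}"

definition essential_quasicomponents ::
  "'a topology \<Rightarrow> ('a \<Rightarrow> 'a) \<Rightarrow> 'a set \<Rightarrow> 'a set \<Rightarrow> 'a set \<Rightarrow> (nat \<Rightarrow> 'a option) set set" where
  "essential_quasicomponents M f N L X =
     (let W = Wu M f N L; Z = Xtilde M f N L X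
      in {F \<in> quasi_components_of (subtopology W (topspace W - (Z \<union> {Wu_infty}))).
            Wu_infty \<in> W closure_of F \<and> (W closure_of F) \<inter> Z \<noteq> {}})"

end

theory Submission
  imports Defs
begin

text \<open>Write \<open>W\<close> for the compactified unstable manifold, \<open>P\<close> for the invariant part, \<open>Q = {\<infinity>}\<close> and
  \<open>T\<close> for the shift. Points outside \<open>Q\<close> are attracted by \<open>P\<close> in the past and points outside \<open>P\<close> by
  \<open>Q\<close> in the future. The space \<open>H\<^sup>1(W, P \<union> Q)\<close> has finite dimension, so a class satisfies a linear
  recurrence along \<open>T\<close>; unrolling it forwards and backwards moves the class into arbitrarily small
  neighbourhoods of \<open>Q\<close> and of \<open>P\<close>. Hence a cocycle has a primitive \<open>v\<close> off \<open>P\<close> that vanishes on \<open>Q\<close>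
  and a primitive \<open>w\<close> off \<open>Q\<close> that vanishes on \<open>P\<close>. The jump \<open>v - w\<close> is locally constant on
  \<open>W - (P \<union> Q)\<close>, and its values on the essential quasicomponents are well defined because these
  accumulate at both \<open>P\<close> and \<open>Q\<close>. If all these values vanish, then the set where the jump is
  nonzero splits into a part away from \<open>P\<close> and a part away from \<open>Q\<close>, and the class is zero.
  Arbitrary values occur, since finitely many quasicomponents are separated by clopen sets.

  Finite dimensionality comes from \<open>N/L\<close>: every class on \<open>W\<close> is pulled back from \<open>N/L\<close> along some
  coordinate projection, and locally constant functions on \<open>P\<close> factor through the components of
  \<open>X\<close>.\<close>

section \<open>Local primitives of two-point functions\<close>

text \<open>Two-point functions replace nerve cochains because a primitive may then be any function
  at all: the discontinuous retraction, the section and the sums with a pointwise cut-off become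
  legitimate, and comparisons need no common refinement. Finite dimension is used in the form
  \<open>dep_bound\<close>: any \<open>d\<close> cocycles are dependent modulo coboundaries. A
  recurrence asks for no more than that, being a dependence among the pullbacks of one cocycle along
  the iterates of the shift, and the property passes to retracts, inverse limits and relative groups
  without a choice of bases. Only invertibility of the shift allows the lowest nonzero coefficient
  of the dependence to be moved to the front and divided out; it also gives a recurrence in each
  direction of time. If any \<open>d\<close> absolute classes are dependent, then so are any
  \<open>(c + 2) * d\<close> relative ones, where \<open>c\<close> counts the components of
  \<open>X\<close>. The finiteness assumption may concern an index pair other than the one that
  defines \<open>W\<close>. The two pairs are compared on their inverse limits, through tails of
  backward orbits.\<close>

definition near :: "'b topology \<Rightarrow> 'b \<Rightarrow> ('b \<Rightarrow> 'b \<Rightarrow> bool) \<Rightarrow> bool" where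
  "near X x Q \<longleftrightarrow> (\<exists>U. openin X U \<and> x \<in> U \<and> (\<forall>a\<in>U. \<forall>b\<in>U. Q a b))"

lemma nearI: "openin X U \<Longrightarrow> x \<in> U \<Longrightarrow> (\<And>a b. a \<in> U \<Longrightarrow> b \<in> U \<Longrightarrow> Q a b) \<Longrightarrow> near X x Q"
  unfolding near_def by blast

lemma near_mono:
  assumes "near X x Q" "\<And>a b. a \<in> topspace X \<Longrightarrow> b \<in> topspace X \<Longrightarrow> Q a b \<Longrightarrow> R a b"
  shows "near X x R"
  using assms unfolding near_def by (metis openin_subset subsetD)

lemma near_conj:
  assumes "near X x Q" "near X x R"
    and "\<And>a b. a \<in> topspace X \<Longrightarrow> b \<in> topspace X \<Longrightarrow> Q a b \<Longrightarrow> R a b \<Longrightarrow> S a b"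
  shows "near X x S"
proof -
  obtain U V where "openin X U" "x \<in> U" "\<forall>a\<in>U. \<forall>b\<in>U. Q a b"
    "openin X V" "x \<in> V" "\<forall>a\<in>V. \<forall>b\<in>V. R a b"
    using assms(1,2) unfolding near_def by auto
  then show ?thesis
    using assms(3) openin_subset[of X U] by (intro nearI[of X "U \<inter> V"]) blast+
qed

lemma near_always: "x \<in> topspace X \<Longrightarrow> (\<And>a b. a \<in> topspace X \<Longrightarrow> b \<in> topspace X \<Longrightarrow> Q a b) \<Longrightarrow> near X x Q"
  by (rule nearI[of X "topspace X"]) auto

lemma near_ball:
  assumes "finite I" "x \<in> topspace X" "\<And>i. i \<in> I \<Longrightarrow> near X x (Q i)"
  shows "near X x (\<lambda>a b. \<forall>i\<in>I. Q i a b)"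
  using assms
proof (induction I rule: finite_induct)
  case empty
  then show ?case by (simp add: near_always)
next
  case (insert i I)
  have 1: "near X x (Q i)" and 2: "near X x (\<lambda>a b. \<forall>i\<in>I. Q i a b)"
    using insert by auto
  show ?case by (rule near_conj[OF 1 2]) auto
qed

lemma near_pullback:
  assumes "continuous_map X Y g" "x \<in> topspace X" "near Y (g x) Q"
  shows "near X x (\<lambda>a b. Q (g a) (g b))"
proof -
  obtain U where "openin Y U" "g x \<in> U" "\<forall>a\<in>U. \<forall>b\<in>U. Q a b"
    using assms(3) unfolding near_def by auto
  then show ?thesis
    using assms(2) openin_continuous_map_preimage[OF assms(1)]
    by (intro nearI[of X "{x \<in> topspace X. g x \<in> U}"]) auto
qed

lemma near_open: "openin X U \<Longrightarrow> x \<in> U \<Longrightarrow> near X x (\<lambda>a b. a \<in> U \<and> b \<in> U)"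
  by (rule nearI) auto

lemma near_refl: "near X x Q \<Longrightarrow> Q x x"
  unfolding near_def by auto

text \<open>Alexander-Spanier cochains in degree one: two-point functions, with no continuity required,
  that near each point are differences \<open>w b - w a\<close>.\<close>

definition as_cocycles :: "'b topology \<Rightarrow> 'b set \<Rightarrow> ('b \<Rightarrow> 'b \<Rightarrow> 'k::field) set" where
  "as_cocycles X A = {\<phi>. (\<forall>x\<in>topspace X. \<exists>w. near X x (\<lambda>a b. \<phi> a b = w b - w a)) \<and>
     (\<forall>x\<in>A. near X x (\<lambda>a b. a \<in> A \<and> b \<in> A \<longrightarrow> \<phi> a b = 0))}"

text \<open>The primitive is one global function, while the equality is required only near the
  diagonal: cocycles modulo these form Alexander-Spanier cohomology in degree one, and values of
  \<open>\<phi>\<close> at distant pairs never matter.\<close>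

definition as_coboundaries :: "'b topology \<Rightarrow> 'b set \<Rightarrow> ('b \<Rightarrow> 'b \<Rightarrow> 'k::field) set" where
  "as_coboundaries X A = {\<phi>. \<exists>u. (\<forall>x\<in>A. u x = 0) \<and>
     (\<forall>x\<in>topspace X. near X x (\<lambda>a b. \<phi> a b = u b - u a))}"

lemma as_cocycles_rel:
  assumes "\<phi> \<in> as_cocycles X A" "x \<in> A"
  shows "near X x (\<lambda>a b. a \<in> A \<and> b \<in> A \<longrightarrow> \<phi> a b = 0)"
  using assms by (simp add: as_cocycles_def)

lemma as_cocycles_zero: "A \<subseteq> topspace X \<Longrightarrow> (\<lambda>_ _. 0) \<in> as_cocycles X A"
  unfolding as_cocycles_def by (auto intro!: near_always exI[of _ "\<lambda>_. 0"])

lemma as_cocycles_add: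
  assumes "\<phi> \<in> as_cocycles X A" "\<psi> \<in> as_cocycles X A"
  shows "(\<lambda>a b. \<phi> a b + \<psi> a b) \<in> as_cocycles X A"
  unfolding as_cocycles_def
proof (intro CollectI conjI ballI)
  fix x assume "x \<in> topspace X"
  then obtain w v where 1: "near X x (\<lambda>a b. \<phi> a b = w b - w a)" and 2: "near X x (\<lambda>a b. \<psi> a b = v b - v a)"
    using assms unfolding as_cocycles_def by blast
  show "\<exists>w. near X x (\<lambda>a b. \<phi> a b + \<psi> a b = w b - w a)"
    by (rule exI[of _ "\<lambda>a. w a + v a"], rule near_conj[OF 1 2]) simp
next
  fix x assume "x \<in> A"
  then have 1: "near X x (\<lambda>a b. a \<in> A \<and> b \<in> A \<longrightarrow> \<phi> a b = 0)"
    and 2: "near X x (\<lambda>a b. a \<in> A \<and> b \<in> A \<longrightarrow> \<psi> a b = 0)"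
    using assms unfolding as_cocycles_def by auto
  show "near X x (\<lambda>a b. a \<in> A \<and> b \<in> A \<longrightarrow> \<phi> a b + \<psi> a b = 0)"
    by (rule near_conj[OF 1 2]) simp
qed

lemma as_cocycles_scale:
  assumes "\<phi> \<in> as_cocycles X A"
  shows "(\<lambda>a b. k * \<phi> a b) \<in> as_cocycles X A"
  unfolding as_cocycles_def
proof (intro CollectI conjI ballI)
  fix x assume "x \<in> topspace X"
  then obtain w where 1: "near X x (\<lambda>a b. \<phi> a b = w b - w a)"
    using assms unfolding as_cocycles_def by blast
  show "\<exists>w. near X x (\<lambda>a b. k * \<phi> a b = w b - w a)"
    by (rule exI[of _ "\<lambda>a. k * w a"], rule near_mono[OF 1]) (simp add: right_diff_distrib)
next
  fix x assume "x \<in> A"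
  then have 1: "near X x (\<lambda>a b. a \<in> A \<and> b \<in> A \<longrightarrow> \<phi> a b = 0)"
    using assms unfolding as_cocycles_def by auto
  show "near X x (\<lambda>a b. a \<in> A \<and> b \<in> A \<longrightarrow> k * \<phi> a b = 0)"
    by (rule near_mono[OF 1]) simp
qed

lemma as_cocycles_sum:
  assumes "finite I" "A \<subseteq> topspace X" "\<And>i. i \<in> I \<Longrightarrow> \<phi> i \<in> as_cocycles X A"
  shows "(\<lambda>a b. \<Sum>i\<in>I. c i * \<phi> i a b) \<in> as_cocycles X A"
  using assms
proof (induction I rule: finite_induct)
  case empty
  then show ?case by (simp add: as_cocycles_zero)
next
  case (insert i I)
  have "(\<lambda>a b. c i * \<phi> i a b) \<in> as_cocycles X A"
    by (rule as_cocycles_scale) (use insert in auto)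
  from as_cocycles_add[OF this, of "\<lambda>a b. \<Sum>i\<in>I. c i * \<phi> i a b"] insert
  show ?case by simp
qed

lemma as_coboundaries_zero: "(\<lambda>_ _. 0) \<in> as_coboundaries X A"
  unfolding as_coboundaries_def by (auto intro!: near_always exI[of _ "\<lambda>_. 0"])

lemma as_coboundaries_add:
  assumes "\<phi> \<in> as_coboundaries X A" "\<psi> \<in> as_coboundaries X A"
  shows "(\<lambda>a b. \<phi> a b + \<psi> a b) \<in> as_coboundaries X A"
proof -
  obtain w v where 1: "\<And>x. x \<in> topspace X \<Longrightarrow> near X x (\<lambda>a b. \<phi> a b = w b - w a)"
     and 2: "\<And>x. x \<in> topspace X \<Longrightarrow> near X x (\<lambda>a b. \<psi> a b = v b - v a)"
     and 3: "\<forall>x\<in>A. w x = 0" "\<forall>x\<in>A. v x = 0"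
    using assms unfolding as_coboundaries_def by blast
  have "near X x (\<lambda>a b. \<phi> a b + \<psi> a b = (w b + v b) - (w a + v a))" if "x \<in> topspace X" for x
    by (rule near_conj[OF 1 2]) (use that in auto)
  then show ?thesis
    using 3 unfolding as_coboundaries_def by (intro CollectI exI[of _ "\<lambda>x. w x + v x"]) simp
qed

lemma as_coboundaries_scale:
  assumes "\<phi> \<in> as_coboundaries X A"
  shows "(\<lambda>a b. k * \<phi> a b) \<in> as_coboundaries X A"
proof -
  obtain w where 1: "\<And>x. x \<in> topspace X \<Longrightarrow> near X x (\<lambda>a b. \<phi> a b = w b - w a)"
     and 3: "\<forall>x\<in>A. w x = 0"
    using assms unfolding as_coboundaries_def by blast
  have "near X x (\<lambda>a b. k * \<phi> a b = (k * w b) - (k * w a))" if "x \<in> topspace X" for x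
    by (rule near_mono[OF 1]) (use that in \<open>auto simp: right_diff_distrib\<close>)
  then show ?thesis
    using 3 unfolding as_coboundaries_def by (intro CollectI exI[of _ "\<lambda>x. k * w x"]) simp
qed

lemma as_coboundaries_sum:
  assumes "finite I" "\<And>i. i \<in> I \<Longrightarrow> \<phi> i \<in> as_coboundaries X A"
  shows "(\<lambda>a b. \<Sum>i\<in>I. c i * \<phi> i a b) \<in> as_coboundaries X A"
  using assms
proof (induction I rule: finite_induct)
  case empty
  then show ?case by (simp add: as_coboundaries_zero)
next
  case (insert i I)
  have "(\<lambda>a b. c i * \<phi> i a b) \<in> as_coboundaries X A"
    by (rule as_coboundaries_scale) (use insert in auto)
  from as_coboundaries_add[OF this, of "\<lambda>a b. \<Sum>i\<in>I. c i * \<phi> i a b"] insert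
  show ?case by simp
qed

lemma as_cocycles_pullback:
  assumes g: "continuous_map X Y g" and AB: "g ` A \<subseteq> B" "A \<subseteq> topspace X" and "\<phi> \<in> as_cocycles Y B"
  shows "(\<lambda>a b. \<phi> (g a) (g b)) \<in> as_cocycles X A"
  unfolding as_cocycles_def
proof (intro CollectI conjI ballI)
  fix x assume x: "x \<in> topspace X"
  then have "g x \<in> topspace Y"
    using g by (auto simp: continuous_map_def)
  then obtain w where 1: "near Y (g x) (\<lambda>a b. \<phi> a b = w b - w a)"
    using assms unfolding as_cocycles_def by blast
  show "\<exists>w. near X x (\<lambda>a b. \<phi> (g a) (g b) = w b - w a)"
    by (rule exI[of _ "\<lambda>a. w (g a)"]) (rule near_pullback[OF g x 1])
next
  fix x assume x: "x \<in> A"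
  then have 1: "near Y (g x) (\<lambda>a b. a \<in> B \<and> b \<in> B \<longrightarrow> \<phi> a b = 0)"
    using assms unfolding as_cocycles_def by auto
  show "near X x (\<lambda>a b. a \<in> A \<and> b \<in> A \<longrightarrow> \<phi> (g a) (g b) = 0)"
    by (rule near_mono[OF near_pullback[OF g _ 1]]) (use x AB in auto)
qed

lemma as_coboundaries_pullback:
  assumes g: "continuous_map X Y g" and AB: "g ` A \<subseteq> B" and "\<phi> \<in> as_coboundaries Y B"
  shows "(\<lambda>a b. \<phi> (g a) (g b)) \<in> as_coboundaries X A"
proof -
  obtain w where 1: "\<And>x. x \<in> topspace Y \<Longrightarrow> near Y x (\<lambda>a b. \<phi> a b = w b - w a)"
     and 3: "\<forall>x\<in>B. w x = 0"
    using assms unfolding as_coboundaries_def by blast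
  have "near X x (\<lambda>a b. \<phi> (g a) (g b) = w (g b) - w (g a))" if "x \<in> topspace X" for x
    by (rule near_pullback[OF g that 1]) (use that g in \<open>auto simp: continuous_map_def\<close>)
  then show ?thesis
    using 3 AB unfolding as_coboundaries_def by (intro CollectI exI[of _ "\<lambda>x. w (g x)"]) auto
qed

section \<open>Degree one Cech cocycles as two-point functions\<close>

text \<open>One step of the zigzag between Cech and Alexander-Spanier cochains: the family
  \<open>w\<close> has \<open>\<kappa>\<close> as its difference in the direction of the cover and
  \<open>\<phi>\<close> as its difference in the direction of points.\<close>

definition primitives ::
  "'b topology \<Rightarrow> 'b set \<Rightarrow> 'b cover_pair \<Rightarrow> ('b, 'k::field) cochain \<Rightarrow> ('b \<Rightarrow> 'b \<Rightarrow> 'k) \<Rightarrow>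
     ('b set \<Rightarrow> 'b \<Rightarrow> 'k) \<Rightarrow> bool" where
  "primitives X A c \<kappa> \<phi> w \<longleftrightarrow>
     (\<forall>U\<in>fst c. \<forall>V\<in>fst c. \<forall>x\<in>U \<inter> V. \<kappa> [U, V] = w V x - w U x) \<and>
     (\<forall>U\<in>snd c. \<forall>x\<in>U \<inter> A. w U x = 0) \<and>
     (\<forall>U\<in>fst c. \<forall>x\<in>U. near X x (\<lambda>a b. \<phi> a b = w U b - w U a))"

definition represents ::
  "'b topology \<Rightarrow> 'b set \<Rightarrow> 'b cover_pair \<Rightarrow> ('b, 'k::field) cochain \<Rightarrow> ('b \<Rightarrow> 'b \<Rightarrow> 'k) \<Rightarrow> bool" where
  "represents X A c \<kappa> \<phi> \<longleftrightarrow> (\<exists>w. primitives X A c \<kappa> \<phi> w)"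

lemma primitivesD:
  assumes "primitives X A c \<kappa> \<phi> w"
  shows "U \<in> fst c \<Longrightarrow> V \<in> fst c \<Longrightarrow> x \<in> U \<inter> V \<Longrightarrow> \<kappa> [U, V] = w V x - w U x"
    and "U \<in> snd c \<Longrightarrow> x \<in> U \<inter> A \<Longrightarrow> w U x = 0"
    and "U \<in> fst c \<Longrightarrow> x \<in> U \<Longrightarrow> near X x (\<lambda>a b. \<phi> a b = w U b - w U a)"
  using assms unfolding primitives_def by blast+

lemma nerve_1_iff:
  "\<sigma> \<in> nerve S \<U> (Suc 0) \<longleftrightarrow> (\<exists>U V. \<sigma> = [U, V] \<and> U \<in> \<U> \<and> V \<in> \<U> \<and> S \<inter> (U \<inter> V) \<noteq> {})"
  by (auto simp: nerve_def length_Suc_conv)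

lemma nerve_2_iff:
  "\<sigma> \<in> nerve S \<U> (Suc (Suc 0)) \<longleftrightarrow>
     (\<exists>U V W. \<sigma> = [U, V, W] \<and> U \<in> \<U> \<and> V \<in> \<U> \<and> W \<in> \<U> \<and> S \<inter> (U \<inter> V \<inter> W) \<noteq> {})"
proof
  assume "\<sigma> \<in> nerve S \<U> (Suc (Suc 0))"
  then show "\<exists>U V W. \<sigma> = [U, V, W] \<and> U \<in> \<U> \<and> V \<in> \<U> \<and> W \<in> \<U> \<and> S \<inter> (U \<inter> V \<inter> W) \<noteq> {}"
    by (fastforce simp: nerve_def length_Suc_conv Int_assoc)
next
  assume "\<exists>U V W. \<sigma> = [U, V, W] \<and> U \<in> \<U> \<and> V \<in> \<U> \<and> W \<in> \<U> \<and> S \<inter> (U \<inter> V \<inter> W) \<noteq> {}"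
  then show "\<sigma> \<in> nerve S \<U> (Suc (Suc 0))"
    by (fastforce simp: nerve_def Int_assoc)
qed

lemma nerve_0_iff:
  "\<sigma> \<in> nerve S \<U> 0 \<longleftrightarrow> (\<exists>U. \<sigma> = [U] \<and> U \<in> \<U> \<and> S \<inter> U \<noteq> {})"
  by (auto simp: nerve_def length_Suc_conv)

lemma coboundary_1:
  assumes "U \<in> fst c" "V \<in> fst c" "W \<in> fst c" "topspace X \<inter> (U \<inter> V \<inter> W) \<noteq> {}"
  shows "coboundary (Suc 0) X c \<kappa> [U, V, W] = \<kappa> [V, W] - \<kappa> [U, W] + \<kappa> [U, V]"
proof -
  have "[U, V, W] \<in> nerve (topspace X) (fst c) (Suc (Suc 0))"
    using assms by (auto simp: nerve_2_iff)
  then show ?thesis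
    by (simp add: coboundary_def numeral_2_eq_2)
qed

lemma coboundary_0:
  assumes "U \<in> fst c" "V \<in> fst c" "topspace X \<inter> (U \<inter> V) \<noteq> {}"
  shows "coboundary 0 X c g [U, V] = g [V] - g [U]"
proof -
  have "[U, V] \<in> nerve (topspace X) (fst c) (Suc 0)"
    using assms by (auto simp: nerve_1_iff)
  then show ?thesis
    by (simp add: coboundary_def)
qed

text \<open>Differences of \<open>w\<close> at one common point telescope around a triple overlap,
  which is the cocycle identity; on the nerve of \<open>A\<close> both values vanish, which is the
  relative condition.\<close>

lemma cocycles_1I:
  assumes supp: "\<And>\<sigma>. \<kappa> \<sigma> \<noteq> 0 \<Longrightarrow> \<exists>U\<in>fst c. \<exists>V\<in>fst c. \<sigma> = [U, V] \<and> topspace X \<inter> (U \<inter> V) \<noteq> {}"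
    and w: "\<And>U V x. U \<in> fst c \<Longrightarrow> V \<in> fst c \<Longrightarrow> x \<in> U \<inter> V \<Longrightarrow> \<kappa> [U, V] = w V x - w U x"
    and wA: "\<And>U x. U \<in> snd c \<Longrightarrow> x \<in> U \<inter> A \<Longrightarrow> w U x = 0"
    and "snd c \<subseteq> fst c"
  shows "\<kappa> \<in> cocycles 1 X A c"
  unfolding cocycles_def
proof (intro CollectI conjI)
  show "\<kappa> \<in> cochains 1 X A c"
    unfolding cochains_def
  proof (intro CollectI allI impI DiffI)
    fix \<sigma> assume nz: "\<kappa> \<sigma> \<noteq> 0"
    from supp[OF this] show "\<sigma> \<in> nerve (topspace X) (fst c) 1"
      by (auto simp: nerve_1_iff)
    show "\<sigma> \<notin> nerve A (snd c) 1"
    proof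
      assume "\<sigma> \<in> nerve A (snd c) 1"
      then obtain U V x where "\<sigma> = [U, V]" "U \<in> snd c" "V \<in> snd c" "x \<in> A" "x \<in> U" "x \<in> V"
        by (auto simp: nerve_1_iff)
      then show False
        using nz w[of U V x] wA[of U x] wA[of V x] assms(4) by auto
    qed
  qed
  show "coboundary 1 X c \<kappa> = (\<lambda>_. 0)"
  proof
    fix \<sigma> show "coboundary 1 X c \<kappa> \<sigma> = 0"
    proof (cases "\<sigma> \<in> nerve (topspace X) (fst c) (Suc (Suc 0))")
      case True
      then obtain U V W x where *: "\<sigma> = [U, V, W]" "U \<in> fst c" "V \<in> fst c" "W \<in> fst c"
          "x \<in> topspace X" "x \<in> U" "x \<in> V" "x \<in> W"
        by (auto simp: nerve_2_iff)
      then have "coboundary (Suc 0) X c \<kappa> \<sigma> = \<kappa> [V, W] - \<kappa> [U, W] + \<kappa> [U, V]"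
        using coboundary_1[of U c V W X] by blast
      with * show ?thesis
        using w[of V W x] w[of U W x] w[of U V x] by simp
    next
      case False
      then show ?thesis by (simp add: coboundary_def)
    qed
  qed
qed

lemma cocycles_1D:
  assumes "\<kappa> \<in> cocycles 1 X A c" "U \<in> fst c" "V \<in> fst c" "W \<in> fst c" "x \<in> topspace X" "x \<in> U" "x \<in> V" "x \<in> W"
  shows "\<kappa> [V, W] - \<kappa> [U, W] + \<kappa> [U, V] = 0"
  using assms coboundary_1[of U c V W X \<kappa>] unfolding cocycles_def by auto

lemma cocycles_1_rel:
  assumes "\<kappa> \<in> cocycles 1 X A c" "U \<in> snd c" "V \<in> snd c" "x \<in> A" "x \<in> U" "x \<in> V"
  shows "\<kappa> [U, V] = 0"
proof -
  have "[U, V] \<in> nerve A (snd c) 1"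
    using assms by (auto simp: nerve_1_iff)
  with assms(1) show ?thesis unfolding cocycles_def cochains_def by blast
qed

lemma cocycles_1_supp:
  assumes "\<kappa> \<in> cocycles 1 X A c" "\<kappa> \<sigma> \<noteq> 0"
  shows "\<exists>U\<in>fst c. \<exists>V\<in>fst c. \<sigma> = [U, V] \<and> topspace X \<inter> (U \<inter> V) \<noteq> {}"
proof -
  have "\<sigma> \<in> nerve (topspace X) (fst c) (Suc 0)"
    using assms unfolding cocycles_def cochains_def by auto
  then show ?thesis by (auto simp: nerve_1_iff)
qed

lemma cover_pair_point:
  assumes "cover_pair X A c"
  obtains s where "\<And>x. x \<in> topspace X \<Longrightarrow> s x \<in> fst c \<and> x \<in> s x"
    "\<And>x. x \<in> A \<Longrightarrow> s x \<in> snd c \<and> x \<in> s x"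
proof -
  have "\<exists>U. (x \<in> topspace X \<longrightarrow> U \<in> fst c \<and> x \<in> U) \<and> (x \<in> A \<longrightarrow> U \<in> snd c \<and> x \<in> U)" for x
    using assms unfolding cover_pair_def by (metis Union_iff subsetD)
  then show ?thesis using that by metis
qed

lemma cover_pair_of_points:
  assumes "A \<subseteq> topspace X" "\<And>x. x \<in> topspace X \<Longrightarrow> openin X (U x) \<and> x \<in> U x"
  shows "cover_pair X A (U ` topspace X, U ` A)"
proof -
  have "U x \<subseteq> topspace X" if "x \<in> topspace X" for x
    using assms(2)[OF that] openin_subset by blast
  then show ?thesis
    using assms unfolding cover_pair_def by fastforce
qed

lemma cocycle_represents:
  assumes A: "A \<subseteq> topspace X" and "(c, \<kappa>) \<in> cech_cocycles 1 X A"
  obtains \<phi> where "\<phi> \<in> as_cocycles X A" "represents X A c \<kappa> \<phi>"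
proof -
  have c: "cover_pair X A c" and k: "\<kappa> \<in> cocycles 1 X A c"
    using assms by (auto simp: cech_cocycles_def)
  obtain s where s: "\<And>x. x \<in> topspace X \<Longrightarrow> s x \<in> fst c \<and> x \<in> s x"
    "\<And>x. x \<in> A \<Longrightarrow> s x \<in> snd c \<and> x \<in> s x"
    using cover_pair_point[OF c] by blast
  have op: "openin X U" if "U \<in> fst c" for U
    using c that by (auto simp: cover_pair_def)
  have sub: "U \<subseteq> topspace X" if "U \<in> fst c" for U
    using op[OF that] openin_subset by blast
  have sf: "snd c \<subseteq> fst c"
    using c by (auto simp: cover_pair_def)
  \<comment> \<open>The cocycle identity on \<open>s x\<close>, \<open>U\<close>, \<open>V\<close>
    makes \<open>\<kappa>\<close> the difference of these functions. For \<open>x\<close> in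
    \<open>A\<close> the member \<open>s x\<close> belongs to \<open>snd c\<close>, so
    \<open>w U x\<close> is 0 for \<open>U\<close> in \<open>snd c\<close>.\<close>
  define w where "w U x = \<kappa> [s x, U]" for U x
  have w: "\<kappa> [U, V] = w V x - w U x" if "U \<in> fst c" "V \<in> fst c" "x \<in> U" "x \<in> V" for U V x
  proof -
    have x: "x \<in> topspace X" using sub that by blast
    from cocycles_1D[OF k, of "s x" U V x] show ?thesis
      using s(1)[OF x] that x by (simp add: w_def algebra_simps)
  qed
  have wA: "w U x = 0" if "U \<in> snd c" "x \<in> U" "x \<in> A" for U x
    using cocycles_1_rel[OF k, of "s x" U x] s that by (auto simp: w_def)
  \<comment> \<open>Any common member gives the same value, because \<open>w V\<close> and
    \<open>w U\<close> differ by the constant \<open>\<kappa> [U, V]\<close> on the overlap; pairs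
    without a common member get an arbitrary, harmless value.\<close>
  define \<phi> where "\<phi> a b = (let U = (SOME U. U \<in> fst c \<and> a \<in> U \<and> b \<in> U) in w U b - w U a)" for a b
  have phi: "\<phi> a b = w U b - w U a" if "U \<in> fst c" "a \<in> U" "b \<in> U" for U a b
  proof -
    define V where "V = (SOME U. U \<in> fst c \<and> a \<in> U \<and> b \<in> U)"
    have V: "V \<in> fst c \<and> a \<in> V \<and> b \<in> V"
      unfolding V_def by (rule someI[of _ U]) (use that in auto)
    have "\<phi> a b = w V b - w V a"
      by (simp add: \<phi>_def V_def Let_def)
    moreover have "w V a - w U a = w V b - w U b"
      using w[of U V a] w[of U V b] V that by simp
    then have "w V a = w U a + w V b - w U b"
      by (simp add: algebra_simps)
    ultimately show ?thesis by simp
  qed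
  have nr: "near X x (\<lambda>a b. \<phi> a b = w U b - w U a)" if "U \<in> fst c" "x \<in> U" for x U
    by (rule nearI[OF op[OF that(1)] that(2)]) (rule phi[OF that(1)])
  show ?thesis
  proof
    show "\<phi> \<in> as_cocycles X A"
      unfolding as_cocycles_def
    proof (intro CollectI conjI ballI)
      fix x assume "x \<in> topspace X"
      then show "\<exists>w. near X x (\<lambda>a b. \<phi> a b = w b - w a)"
        using nr[of "s x" x] s(1) by blast
    next
      fix x assume "x \<in> A"
      with s(2) sf have "s x \<in> snd c" "x \<in> s x" "s x \<in> fst c" by auto
      then show "near X x (\<lambda>a b. a \<in> A \<and> b \<in> A \<longrightarrow> \<phi> a b = 0)"
        by (intro nearI[of X "s x"]) (auto intro: op simp: phi[of "s x"] wA)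
    qed
    show "represents X A c \<kappa> \<phi>"
      unfolding represents_def primitives_def
      by (rule exI[of _ w]) (use w wA nr in auto)
  qed
qed

text \<open>The identities hold for all pairs in a member, not just near each point; this is what
  turns \<open>\<phi>\<close> into a cochain on this very cover.\<close>

definition good_cover :: "'b topology \<Rightarrow> 'b set \<Rightarrow> 'b cover_pair \<Rightarrow> ('b \<Rightarrow> 'b \<Rightarrow> 'k::field) \<Rightarrow> bool" where
  "good_cover X A c \<phi> \<longleftrightarrow>
     (\<forall>U\<in>fst c. \<exists>w. \<forall>a\<in>U. \<forall>b\<in>U. \<phi> a b = w b - w a) \<and>
     (\<forall>U\<in>snd c. \<forall>a\<in>U \<inter> A. \<forall>b\<in>U \<inter> A. \<phi> a b = 0)"

text \<open>Two functions share one cover because Cech classes are added through cochains on the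
  same cover. Members of the subfamily are neighbourhoods of points of \<open>A\<close>, so base
  points can be taken in \<open>A\<close>.\<close>

lemma good_cover_exists:
  assumes A: "A \<subseteq> topspace X" and "\<phi> \<in> as_cocycles X A" "\<psi> \<in> as_cocycles X A"
  obtains c where "cover_pair X A c" "good_cover X A c \<phi>" "good_cover X A c \<psi>" "\<And>U. U \<in> snd c \<Longrightarrow> U \<inter> A \<noteq> {}"
proof -
  define G where "G x U \<longleftrightarrow> openin X U \<and> x \<in> U \<and>
      (\<exists>w. \<forall>a\<in>U. \<forall>b\<in>U. \<phi> a b = w b - w a) \<and> (\<exists>w. \<forall>a\<in>U. \<forall>b\<in>U. \<psi> a b = w b - w a) \<and>
      (x \<in> A \<longrightarrow> (\<forall>a\<in>U \<inter> A. \<forall>b\<in>U \<inter> A. \<phi> a b = 0 \<and> \<psi> a b = 0))" for x U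
  have "\<exists>U. G x U" if x: "x \<in> topspace X" for x
  proof -
    obtain w v where 1: "near X x (\<lambda>a b. \<phi> a b = w b - w a)" and 2: "near X x (\<lambda>a b. \<psi> a b = v b - v a)"
      using assms x unfolding as_cocycles_def by blast
    have 3: "near X x (\<lambda>a b. x \<in> A \<longrightarrow> a \<in> A \<and> b \<in> A \<longrightarrow> \<phi> a b = 0)"
      using assms(2) x by (cases "x \<in> A") (auto simp: as_cocycles_def intro: near_always)
    have 4: "near X x (\<lambda>a b. x \<in> A \<longrightarrow> a \<in> A \<and> b \<in> A \<longrightarrow> \<psi> a b = 0)"
      using assms(3) x by (cases "x \<in> A") (auto simp: as_cocycles_def intro: near_always)
    have 5: "near X x (\<lambda>a b. \<phi> a b = w b - w a \<and> (x \<in> A \<longrightarrow> a \<in> A \<and> b \<in> A \<longrightarrow> \<phi> a b = 0))"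
      by (rule near_conj[OF 1 3]) simp
    have 6: "near X x (\<lambda>a b. \<psi> a b = v b - v a \<and> (x \<in> A \<longrightarrow> a \<in> A \<and> b \<in> A \<longrightarrow> \<psi> a b = 0))"
      by (rule near_conj[OF 2 4]) simp
    have "near X x (\<lambda>a b. (\<phi> a b = w b - w a \<and> (x \<in> A \<longrightarrow> a \<in> A \<and> b \<in> A \<longrightarrow> \<phi> a b = 0)) \<and>
        (\<psi> a b = v b - v a \<and> (x \<in> A \<longrightarrow> a \<in> A \<and> b \<in> A \<longrightarrow> \<psi> a b = 0)))"
      by (rule near_conj[OF 5 6]) (rule conjI)
    then obtain U where "openin X U" "x \<in> U" and U: "\<forall>a\<in>U. \<forall>b\<in>U.
        (\<phi> a b = w b - w a \<and> (x \<in> A \<longrightarrow> a \<in> A \<and> b \<in> A \<longrightarrow> \<phi> a b = 0)) \<and>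
        (\<psi> a b = v b - v a \<and> (x \<in> A \<longrightarrow> a \<in> A \<and> b \<in> A \<longrightarrow> \<psi> a b = 0))"
      unfolding near_def by (elim exE conjE) (rule that)
    have U': "\<phi> a b = w b - w a" "\<psi> a b = v b - v a" "x \<in> A \<longrightarrow> a \<in> A \<and> b \<in> A \<longrightarrow> \<phi> a b = 0"
         "x \<in> A \<longrightarrow> a \<in> A \<and> b \<in> A \<longrightarrow> \<psi> a b = 0" if "a \<in> U" "b \<in> U" for a b
      using U[rule_format, OF that] by argo+
    show ?thesis
      unfolding G_def
    proof (intro exI[of _ U] conjI)
      show "\<exists>w. \<forall>a\<in>U. \<forall>b\<in>U. \<phi> a b = w b - w a"
        by (rule exI[of _ w]) (use U'(1) in auto)
      show "\<exists>v. \<forall>a\<in>U. \<forall>b\<in>U. \<psi> a b = v b - v a"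
        by (rule exI[of _ v]) (use U'(2) in auto)
    qed (use \<open>openin X U\<close> \<open>x \<in> U\<close> U'(3,4) in auto)
  qed
  then obtain U where U: "\<And>x. x \<in> topspace X \<Longrightarrow> G x (U x)" by metis
  show ?thesis
  proof
    show "cover_pair X A (U ` topspace X, U ` A)"
      by (rule cover_pair_of_points) (use U A in \<open>auto simp: G_def\<close>)
    show "good_cover X A (U ` topspace X, U ` A) \<phi>" "good_cover X A (U ` topspace X, U ` A) \<psi>"
      using U A unfolding good_cover_def G_def by (auto simp: subset_iff)
    show "V \<inter> A \<noteq> {}" if "V \<in> snd (U ` topspace X, U ` A)" for V
      using that U A unfolding G_def by fastforce
  qed
qed

lemma good_cover_represents:
  assumes A: "A \<subseteq> topspace X" and c: "cover_pair X A c" and g: "good_cover X A c \<phi>"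
    and ne: "\<And>U. U \<in> snd c \<Longrightarrow> U \<inter> A \<noteq> {}"
  obtains \<kappa> where "(c, \<kappa>) \<in> cech_cocycles 1 X A" "represents X A c \<kappa> \<phi>"
proof -
  have op: "openin X U" if "U \<in> fst c" for U
    using c that by (auto simp: cover_pair_def)
  have sub: "U \<subseteq> topspace X" if "U \<in> fst c" for U
    using op[OF that] openin_subset by blast
  have sf: "snd c \<subseteq> fst c"
    using c by (auto simp: cover_pair_def)
  \<comment> \<open>Base points of members of the subfamily lie in \<open>A\<close>, so that the
    primitive \<open>\<phi> (b U)\<close> vanishes on the trace of \<open>A\<close>.\<close>
  define b where "b U = (if U \<in> snd c then SOME x. x \<in> U \<inter> A else SOME x. x \<in> U)" for U
  have b1: "b U \<in> U \<inter> A" if "U \<in> snd c" for U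
    using ne[OF that] some_in_eq[of "U \<inter> A"] that by (simp add: b_def)
  have b2: "b U \<in> U" if "x \<in> U" for x U
    using b1[of U] that by (cases "U \<in> snd c") (auto simp: b_def intro: someI)
  define w where "w U x = \<phi> (b U) x" for U x
  have w: "\<phi> x y = w U y - w U x" if U: "U \<in> fst c" and "x \<in> U" "y \<in> U" for U x y
  proof -
    have "\<exists>v. \<forall>a\<in>U. \<forall>b\<in>U. \<phi> a b = v b - v a"
      using g U by (simp add: good_cover_def)
    then obtain v where "\<forall>a\<in>U. \<forall>b\<in>U. \<phi> a b = v b - v a" ..
    then have v: "\<And>a b. a \<in> U \<Longrightarrow> b \<in> U \<Longrightarrow> \<phi> a b = v b - v a" by simp
    have "b U \<in> U" by (rule b2[OF that(2)])
    then have "w U y = v y - v (b U)" "w U x = v x - v (b U)"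
      unfolding w_def using v that(2,3) by auto
    then show ?thesis
      using v[OF that(2,3)] by simp
  qed
  \<comment> \<open>The point of the overlap is arbitrary: \<open>w U\<close> and \<open>w V\<close>
    both have \<open>\<phi>\<close> as their differences there, so \<open>w V - w U\<close> is
    constant.\<close>
  define \<kappa> where "\<kappa> \<sigma> = (if \<exists>U\<in>fst c. \<exists>V\<in>fst c. \<sigma> = [U, V] \<and> topspace X \<inter> (U \<inter> V) \<noteq> {}
     then let x = (SOME x. x \<in> \<sigma> ! 0 \<inter> \<sigma> ! 1) in w (\<sigma> ! 1) x - w (\<sigma> ! 0) x else 0)" for \<sigma>
  have kw: "\<kappa> [U, V] = w V x - w U x" if UV: "U \<in> fst c" "V \<in> fst c" and x: "x \<in> U \<inter> V" for U V x
  proof -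
    define y where "y = (SOME x. x \<in> U \<inter> V)"
    have y: "y \<in> U \<inter> V" unfolding y_def by (rule someI[of "\<lambda>x. x \<in> U \<inter> V", OF x])
    have "\<kappa> [U, V] = w V y - w U y"
      using UV x sub by (auto simp: \<kappa>_def y_def Let_def)
    moreover have "w U y = w U x + \<phi> x y" "w V y = w V x + \<phi> x y"
      using w[of U x y] w[of V x y] x y UV by (auto simp: eq_diff_eq add.commute)
    ultimately show ?thesis
      by simp
  qed
  have wA: "w U x = 0" if "U \<in> snd c" "x \<in> U \<inter> A" for U x
    using g that b1 unfolding good_cover_def w_def by auto
  have "\<kappa> \<in> cocycles 1 X A c"
  proof (rule cocycles_1I[where w = w])
    fix \<sigma> assume "\<kappa> \<sigma> \<noteq> 0"
    then show "\<exists>U\<in>fst c. \<exists>V\<in>fst c. \<sigma> = [U, V] \<and> topspace X \<inter> (U \<inter> V) \<noteq> {}"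
      by (auto simp: \<kappa>_def split: if_splits)
  qed (use kw wA sf in auto)
  moreover have "represents X A c \<kappa> \<phi>"
    unfolding represents_def primitives_def
  proof (intro exI[of _ w] conjI ballI)
    fix U x assume "U \<in> fst c" "x \<in> U"
    then show "near X x (\<lambda>a b. \<phi> a b = w U b - w U a)"
      using w by (intro nearI[OF op]) auto
  qed (use kw wA in auto)
  ultimately show ?thesis
    using that c by (auto simp: cech_cocycles_def)
qed

text \<open>Adding one global function \<open>u\<close> to every \<open>w U\<close> leaves the Cech
  differences alone and changes the pointwise differences by the coboundary of
  \<open>u\<close>.\<close>

lemma represents_cohomologous:
  assumes "represents X A c \<kappa> \<phi>" "cover_pair X A c" "(\<lambda>a b. \<psi> a b - \<phi> a b) \<in> as_coboundaries X A"
  shows "represents X A c \<kappa> \<psi>"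
proof -
  obtain w where w0: "primitives X A c \<kappa> \<phi> w"
    using assms(1) unfolding represents_def by blast
  note w = primitivesD[OF w0]
  obtain u where u: "\<And>x. x \<in> A \<Longrightarrow> u x = 0" "\<And>x. x \<in> topspace X \<Longrightarrow> near X x (\<lambda>a b. \<psi> a b - \<phi> a b = u b - u a)"
    using assms(3) unfolding as_coboundaries_def by blast
  show ?thesis
    unfolding represents_def primitives_def
  proof (intro exI[of _ "\<lambda>U x. w U x + u x"] conjI ballI)
    fix U V x assume "U\<in>fst c" "V\<in>fst c" "x\<in>U \<inter> V"
    then show "\<kappa> [U, V] = w V x + u x - (w U x + u x)" using w(1) by simp
  next
    fix U x assume "U\<in>snd c" "x\<in>U \<inter> A"
    then show "w U x + u x = 0" using w(2) u by auto
  next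
    fix U x assume *: "U\<in>fst c" "x\<in>U"
    then have "x \<in> topspace X" using assms(2) openin_subset unfolding cover_pair_def by blast
    have "\<psi> a b = w U b + u b - (w U a + u a)"
      if "\<phi> a b = w U b - w U a" "\<psi> a b - \<phi> a b = u b - u a" for a b
    proof -
      have "\<psi> a b = \<phi> a b + (u b - u a)" using that(2) by (simp add: diff_eq_eq)
      with that(1) show ?thesis by simp
    qed
    then show "near X x (\<lambda>a b. \<psi> a b = w U b + u b - (w U a + u a))"
      by (intro near_conj[OF w(3)[OF *] u(2)]) (use \<open>x \<in> topspace X\<close> in auto)
  qed
qed

text \<open>On a small member of a common refinement the two primitives of \<open>\<phi>\<close>
  differ by a constant. These constants form a 0-cochain whose coboundary is the difference of the
  two pulled-back cocycles.\<close>

lemma cech_rel_if_represents: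
  assumes A: "A \<subseteq> topspace X"
    and c: "(c, \<kappa>) \<in> cech_cocycles 1 X A" "represents X A c \<kappa> \<phi>"
    and d: "(d, \<mu>) \<in> cech_cocycles 1 X A" "represents X A d \<mu> \<phi>"
  shows "((c, \<kappa>), (d, \<mu>)) \<in> cech_rel 1 X A"
proof -
  have cc: "cover_pair X A c" and dd: "cover_pair X A d"
    using c d by (auto simp: cech_cocycles_def)
  obtain s where s: "\<And>x. x \<in> topspace X \<Longrightarrow> s x \<in> fst c \<and> x \<in> s x"
    "\<And>x. x \<in> A \<Longrightarrow> s x \<in> snd c \<and> x \<in> s x"
    using cover_pair_point[OF cc] by blast
  obtain t where t: "\<And>x. x \<in> topspace X \<Longrightarrow> t x \<in> fst d \<and> x \<in> t x"
    "\<And>x. x \<in> A \<Longrightarrow> t x \<in> snd d \<and> x \<in> t x"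
    using cover_pair_point[OF dd] by blast
  have opc: "openin X U" if "U \<in> fst c" for U using cc that by (auto simp: cover_pair_def)
  have opd: "openin X U" if "U \<in> fst d" for U using dd that by (auto simp: cover_pair_def)
  obtain w where w0: "primitives X A c \<kappa> \<phi> w"
    using c(2) unfolding represents_def by blast
  note w = primitivesD[OF w0]
  obtain v where v0: "primitives X A d \<mu> \<phi> v"
    using d(2) unfolding represents_def by blast
  note v = primitivesD[OF v0]
  have "\<exists>E. openin X E \<and> x \<in> E \<and> E \<subseteq> s x \<and> E \<subseteq> t x \<and>
      (\<forall>a\<in>E. \<forall>b\<in>E. w (s x) b - w (s x) a = v (t x) b - v (t x) a)" if x: "x \<in> topspace X" for x
  proof -
    have "near X x (\<lambda>a b. w (s x) b - w (s x) a = v (t x) b - v (t x) a)"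
      by (rule near_conj[OF w(3)[of "s x" x] v(3)[of "t x" x]]) (use s t x in auto)
    then obtain E where "openin X E" "x \<in> E" "\<forall>a\<in>E. \<forall>b\<in>E. w (s x) b - w (s x) a = v (t x) b - v (t x) a"
      unfolding near_def by blast
    then show ?thesis
      using s(1)[OF x] t(1)[OF x] opc opd
      by (intro exI[of _ "E \<inter> s x \<inter> t x"]) (auto intro!: openin_Int)
  qed
  then obtain E where E: "\<And>x. x \<in> topspace X \<Longrightarrow> openin X (E x) \<and> x \<in> E x \<and> E x \<subseteq> s x \<and> E x \<subseteq> t x \<and>
      (\<forall>a\<in>E x. \<forall>b\<in>E x. w (s x) b - w (s x) a = v (t x) b - v (t x) a)" by metis
  define e where "e = (E ` topspace X, E ` A)"
  have e: "cover_pair X A e"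
    unfolding e_def by (rule cover_pair_of_points) (use E A in auto)
  have "\<exists>x\<in>topspace X. U = E x \<and> (U \<in> snd e \<longrightarrow> x \<in> A)" if "U \<in> fst e" for U
    using that A unfolding e_def by auto
  \<comment> \<open>Members of \<open>e\<close> are sets without an index, so a generating point is
    chosen back for each, in \<open>A\<close> for members of the subfamily; there both primitives
    vanish and the constant is 0.\<close>
  then obtain b where b: "\<And>U. U \<in> fst e \<Longrightarrow> b U \<in> topspace X \<and> U = E (b U) \<and> (U \<in> snd e \<longrightarrow> b U \<in> A)"
    by metis
  define p where "p U = s (b U)" for U
  define r where "r U = t (b U)" for U
  have p: "p U \<in> fst c" "U \<subseteq> p U" "r U \<in> fst d" "U \<subseteq> r U" "b U \<in> U"
      "U \<in> snd e \<Longrightarrow> p U \<in> snd c" "U \<in> snd e \<Longrightarrow> r U \<in> snd d" "U \<in> snd e \<Longrightarrow> b U \<in> A" if "U \<in> fst e" for U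
    using b[OF that] E[of "b U"] s[of "b U"] t[of "b U"] unfolding p_def r_def by blast+
  have cst: "w (p U) x - v (r U) x = w (p U) y - v (r U) y" if "U \<in> fst e" "x \<in> U" "y \<in> U" for U x y
    using b[OF that(1)] E[of "b U"] that(2,3) by (auto simp: p_def r_def algebra_simps)
  have se: "snd e \<subseteq> fst e" using e by (auto simp: cover_pair_def)
  have sub: "U \<subseteq> topspace X" if "U \<in> fst e" for U
    using e that openin_subset unfolding cover_pair_def by blast
  define g where "g \<sigma> = (if \<exists>U\<in>fst e. \<sigma> = [U] then w (p (hd \<sigma>)) (b (hd \<sigma>)) - v (r (hd \<sigma>)) (b (hd \<sigma>)) else 0)" for \<sigma>
  have g: "g [U] = w (p U) x - v (r U) x" if "U \<in> fst e" "x \<in> U" for U x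
    using cst[OF that(1) p(5)[OF that(1)] that(2)] that by (auto simp: g_def)
  have gc: "g \<in> cochains 0 X A e"
    unfolding cochains_def
  proof (intro CollectI allI impI DiffI)
    fix \<sigma> assume nz: "g \<sigma> \<noteq> 0"
    then obtain U where U: "U \<in> fst e" "\<sigma> = [U]" by (auto simp: g_def split: if_splits)
    then show "\<sigma> \<in> nerve (topspace X) (fst e) 0"
      using p(5) sub by (auto simp: nerve_0_iff)
    show "\<sigma> \<notin> nerve A (snd e) 0"
    proof
      assume "\<sigma> \<in> nerve A (snd e) 0"
      then have "U \<in> snd e" using U by (auto simp: nerve_0_iff)
      then have "w (p U) (b U) = 0" "v (r U) (b U) = 0"
        using w(2)[of "p U" "b U"] v(2)[of "r U" "b U"] p[OF U(1)] by blast+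
      then show False using nz g[OF U(1) p(5)[OF U(1)]] U by simp
    qed
  qed
  have "(\<lambda>\<sigma>. cochain_pullback 1 X e p \<kappa> \<sigma> - cochain_pullback 1 X e r \<mu> \<sigma>) = coboundary 0 X e g"
  proof
    fix \<sigma>
    show "cochain_pullback 1 X e p \<kappa> \<sigma> - cochain_pullback 1 X e r \<mu> \<sigma> = coboundary 0 X e g \<sigma>"
    proof (cases "\<sigma> \<in> nerve (topspace X) (fst e) 1")
      case True
      then obtain U V x where *: "\<sigma> = [U, V]" "U \<in> fst e" "V \<in> fst e" "x \<in> topspace X" "x \<in> U" "x \<in> V"
        by (auto simp: nerve_1_iff)
      have "coboundary 0 X e g \<sigma> = g [V] - g [U]"
        using coboundary_0[of U e V X] * by blast
      also have "\<dots> = \<kappa> [p U, p V] - \<mu> [r U, r V]"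
        using g[of U x] g[of V x] w(1)[of "p U" "p V" x] v(1)[of "r U" "r V" x] p(1-4) * by (auto simp: subset_iff)
      finally show ?thesis
        using True * by (simp add: cochain_pullback_def)
    next
      case False
      then show ?thesis by (simp add: cochain_pullback_def coboundary_def)
    qed
  qed
  then have "(\<lambda>\<sigma>. cochain_pullback 1 X e p \<kappa> \<sigma> - cochain_pullback 1 X e r \<mu> \<sigma>) \<in> coboundaries 1 X A e"
    using gc by (auto simp: coboundaries_def)
  moreover have "projection id e c p" "projection id e d r"
    using p se by (auto simp: projection_def)
  ultimately show ?thesis
    using c(1) d(1) e unfolding cech_rel_def by blast
qed

text \<open>Subtracting the bounding 0-cochain \<open>g\<close> from the difference of the two
  families of primitives makes it independent of the member, so it glues to a global primitive of
  \<open>\<phi> - \<psi>\<close>.\<close>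

lemma represents_if_cech_rel:
  assumes A: "A \<subseteq> topspace X" and rel: "((c, \<kappa>), (d, \<mu>)) \<in> cech_rel 1 X A"
    and c: "represents X A c \<kappa> \<phi>" and d: "represents X A d \<mu> \<psi>"
  shows "(\<lambda>a b. \<phi> a b - \<psi> a b) \<in> as_coboundaries X A"
proof -
  obtain e p r where "(c, \<kappa>) \<in> cech_cocycles 1 X A" "(d, \<mu>) \<in> cech_cocycles 1 X A" and
      e: "cover_pair X A e" and pr: "projection id e c p" "projection id e d r" and
      cb: "(\<lambda>\<sigma>. cochain_pullback 1 X e p \<kappa> \<sigma> - cochain_pullback 1 X e r \<mu> \<sigma>) \<in> coboundaries 1 X A e"
    using rel unfolding cech_rel_def by auto
  obtain g where gc: "g \<in> cochains 0 X A e" and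
      g: "\<And>\<sigma>. cochain_pullback 1 X e p \<kappa> \<sigma> - cochain_pullback 1 X e r \<mu> \<sigma> = coboundary 0 X e g \<sigma>"
    using cb by (auto simp: coboundaries_def fun_eq_iff)
  obtain w where w0: "primitives X A c \<kappa> \<phi> w"
    using c unfolding represents_def by blast
  note w = primitivesD[OF w0]
  obtain v where v0: "primitives X A d \<mu> \<psi> v"
    using d unfolding represents_def by blast
  note v = primitivesD[OF v0]
  obtain s where s: "\<And>x. x \<in> topspace X \<Longrightarrow> s x \<in> fst e \<and> x \<in> s x"
    "\<And>x. x \<in> A \<Longrightarrow> s x \<in> snd e \<and> x \<in> s x"
    using cover_pair_point[OF e] by blast
  have p: "p U \<in> fst c" "U \<subseteq> p U" "r U \<in> fst d" "U \<subseteq> r U" if "U \<in> fst e" for U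
    using pr that by (auto simp: projection_def)
  have p': "p U \<in> snd c" "r U \<in> snd d" if "U \<in> snd e" for U
    using pr that by (auto simp: projection_def)
  have ope: "openin X U" if "U \<in> fst e" for U using e that by (auto simp: cover_pair_def)
  have se: "snd e \<subseteq> fst e" using e by (auto simp: cover_pair_def)
  have gg: "w (p V) x - v (r V) x - g [V] = w (p U) x - v (r U) x - g [U]"
    if "U \<in> fst e" "V \<in> fst e" "x \<in> U" "x \<in> V" for U V x
  proof -
    have x: "x \<in> topspace X" using ope openin_subset that by blast
    have "[U, V] \<in> nerve (topspace X) (fst e) 1"
      using that x by (auto simp: nerve_1_iff)
    then have "\<kappa> [p U, p V] - \<mu> [r U, r V] = coboundary 0 X e g [U, V]"
      using g[of "[U, V]"] by (simp add: cochain_pullback_def)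
    also have "\<dots> = g [V] - g [U]"
      using that x by (intro coboundary_0) auto
    finally have 1: "\<kappa> [p U, p V] - \<mu> [r U, r V] = g [V] - g [U]" .
    have "\<kappa> [p U, p V] = w (p V) x - w (p U) x" "\<mu> [r U, r V] = v (r V) x - v (r U) x"
      using w(1)[of "p U" "p V" x] v(1)[of "r U" "r V" x] p[OF that(1)] p[OF that(2)] that
      by (auto simp: subset_iff)
    moreover have "g [V] = \<kappa> [p U, p V] - \<mu> [r U, r V] + g [U]"
      using 1 by (simp add: algebra_simps)
    ultimately show ?thesis by simp
  qed
  define u where "u x = w (p (s x)) x - v (r (s x)) x - g [s x]" for x
  have u: "u x = w (p U) x - v (r U) x - g [U]" if "U \<in> fst e" "x \<in> U" for x U
    unfolding u_def
    by (rule gg) (use that s ope openin_subset in \<open>blast+\<close>)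
  have "u x = 0" if "x \<in> A" for x
  proof -
    have "[s x] \<in> nerve A (snd e) 0"
      using s(2)[OF that] that by (auto simp: nerve_0_iff)
    then have "g [s x] = 0" using gc unfolding cochains_def by blast
    moreover have "s x \<in> fst e" using s(2)[OF that] se by auto
    ultimately show ?thesis
      using w(2)[of "p (s x)" x] v(2)[of "r (s x)" x] p p' s(2)[OF that] that by (auto simp: u_def subset_iff)
  qed
  moreover have "near X x (\<lambda>a b. \<phi> a b - \<psi> a b = u b - u a)" if x: "x \<in> topspace X" for x
  proof -
    have sx: "s x \<in> fst e" "x \<in> s x" using s(1)[OF x] by auto
    have 1: "near X x (\<lambda>a b. \<phi> a b = w (p (s x)) b - w (p (s x)) a)"
      by (rule w(3)) (use p[OF sx(1)] sx in auto)
    have 2: "near X x (\<lambda>a b. \<psi> a b = v (r (s x)) b - v (r (s x)) a)"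
      by (rule v(3)) (use p[OF sx(1)] sx in auto)
    have 3: "near X x (\<lambda>a b. \<phi> a b - \<psi> a b = w (p (s x)) b - w (p (s x)) a - (v (r (s x)) b - v (r (s x)) a))"
      by (rule near_conj[OF 1 2]) auto
    show ?thesis
      by (rule near_conj[OF 3 near_open[OF ope[OF sx(1)] sx(2)]]) (auto simp: u[OF sx(1)])
  qed
  ultimately show ?thesis
    unfolding as_coboundaries_def by (intro CollectI exI[of _ u]) auto
qed

section \<open>Cech classes of two-point functions and the vector space they form\<close>

definition cech_class :: "'b topology \<Rightarrow> 'b set \<Rightarrow> ('b \<Rightarrow> 'b \<Rightarrow> 'k::field) \<Rightarrow> ('b, 'k) cech_class" where
  "cech_class X A \<phi> = {(c, \<kappa>) \<in> cech_cocycles 1 X A. represents X A c \<kappa> \<phi>}"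

lemma cech_class_rel:
  assumes "A \<subseteq> topspace X" "(c, \<kappa>) \<in> cech_class X A \<phi>" "(d, \<mu>) \<in> cech_class X A \<phi>"
  shows "((c, \<kappa>), (d, \<mu>)) \<in> cech_rel 1 X A"
  by (rule cech_rel_if_represents[OF assms(1)]) (use assms in \<open>auto simp: cech_class_def\<close>)

text \<open>Every operation of \<open>cech_cohomology\<close> is the saturation under
  \<open>cech_rel\<close> of explicit representatives; it is evaluated by checking that these all
  represent one two-point function.\<close>

lemma cech_class_Image:
  assumes A: "A \<subseteq> topspace X" and S: "S \<subseteq> cech_class X A \<phi>" "S \<noteq> {}"
  shows "cech_rel 1 X A `` S = cech_class X A \<phi>"
proof
  show "cech_rel 1 X A `` S \<subseteq> cech_class X A \<phi>"
  proof
    fix z assume "z \<in> cech_rel 1 X A `` S"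
    then obtain c \<kappa> d \<mu> where rel: "((c, \<kappa>), (d, \<mu>)) \<in> cech_rel 1 X A" and "(c, \<kappa>) \<in> S" and z: "z = (d, \<mu>)"
      by (metis ImageE surj_pair)
    then have c: "represents X A c \<kappa> \<phi>"
      using S by (auto simp: cech_class_def)
    have d: "(d, \<mu>) \<in> cech_cocycles 1 X A"
      using rel by (auto simp: cech_rel_def)
    then obtain \<psi> where "\<psi> \<in> as_cocycles X A" and psi: "represents X A d \<mu> \<psi>"
      using cocycle_represents[OF A] by blast
    have "represents X A d \<mu> \<phi>"
    proof (rule represents_cohomologous[OF psi])
      show "cover_pair X A d" using d by (auto simp: cech_cocycles_def)
      show "(\<lambda>a b. \<phi> a b - \<psi> a b) \<in> as_coboundaries X A"
        by (rule represents_if_cech_rel[OF A rel c psi])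
    qed
    then show "z \<in> cech_class X A \<phi>"
      using d z by (simp add: cech_class_def)
  qed
  obtain c \<kappa> where ck: "(c, \<kappa>) \<in> S" using S(2) by fastforce
  with S(1) have "(c, \<kappa>) \<in> cech_class X A \<phi>" by blast
  then show "cech_class X A \<phi> \<subseteq> cech_rel 1 X A `` S"
    using cech_class_rel[OF A] ck by (fastforce simp del: One_nat_def)
qed

lemma cech_class_nonempty:
  assumes A: "A \<subseteq> topspace X" and "\<phi> \<in> as_cocycles X A"
  shows "cech_class X A \<phi> \<noteq> {}"
proof -
  obtain c where "cover_pair X A c" "good_cover X A c \<phi>" "\<And>U. U \<in> snd c \<Longrightarrow> U \<inter> A \<noteq> {}"
    using good_cover_exists[OF A assms(2,2)] by blast
  then show ?thesis
    using good_cover_represents[OF A] unfolding cech_class_def by blast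
qed

lemma cech_class_eq_iff:
  assumes A: "A \<subseteq> topspace X" and "\<phi> \<in> as_cocycles X A" "\<psi> \<in> as_cocycles X A"
  shows "cech_class X A \<phi> = cech_class X A \<psi> \<longleftrightarrow> (\<lambda>a b. \<phi> a b - \<psi> a b) \<in> as_coboundaries X A"
proof
  assume eq: "cech_class X A \<phi> = cech_class X A \<psi>"
  obtain c \<kappa> where c: "(c, \<kappa>) \<in> cech_class X A \<phi>"
    using cech_class_nonempty[OF assms(1,2)] by fastforce
  then have "((c, \<kappa>), (c, \<kappa>)) \<in> cech_rel 1 X A"
    using cech_class_rel[OF A] by blast
  then show "(\<lambda>a b. \<phi> a b - \<psi> a b) \<in> as_coboundaries X A"
    by (rule represents_if_cech_rel[OF A]) (use c eq in \<open>auto simp: cech_class_def\<close>)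
next
  assume 1: "(\<lambda>a b. \<phi> a b - \<psi> a b) \<in> as_coboundaries X A"
  then have 2: "(\<lambda>a b. \<psi> a b - \<phi> a b) \<in> as_coboundaries X A"
    using as_coboundaries_scale[OF 1, of "-1"] by simp
  show "cech_class X A \<phi> = cech_class X A \<psi>"
    using represents_cohomologous[OF _ _ 1] represents_cohomologous[OF _ _ 2]
    unfolding cech_class_def cech_cocycles_def by auto
qed

lemma carrier_cech_cohomology_1:
  assumes A: "A \<subseteq> topspace X"
  shows "carrier (cech_cohomology 1 X A) = cech_class X A ` as_cocycles X A"
proof -
  have 1: "\<exists>\<phi>\<in>as_cocycles X A. cech_rel 1 X A `` {z} = cech_class X A \<phi>" if z: "z \<in> cech_cocycles 1 X A" for z
  proof -
    obtain c \<kappa> where "z = (c, \<kappa>)" by (cases z)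
    then obtain \<phi> where "\<phi> \<in> as_cocycles X A" "represents X A c \<kappa> \<phi>"
      using z cocycle_represents[OF A] by metis
    then show ?thesis
      using z \<open>z = _\<close> cech_class_Image[OF A, of "{z}" \<phi>] by (auto simp: cech_class_def)
  qed
  have 2: "\<exists>z\<in>cech_cocycles 1 X A. cech_class X A \<phi> = cech_rel 1 X A `` {z}" if phi: "\<phi> \<in> as_cocycles X A" for \<phi>
  proof -
    obtain z where "z \<in> cech_class X A \<phi>" using cech_class_nonempty[OF A phi] by blast
    then show ?thesis
      using cech_class_Image[OF A, of "{z}" \<phi>] by (auto simp: cech_class_def)
  qed
  have "cech_cocycles 1 X A // cech_rel 1 X A = cech_class X A ` as_cocycles X A" (is "?L = ?R")
  proof (rule Set.set_eqI)
    fix h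
    have "h \<in> ?L \<longleftrightarrow> (\<exists>z\<in>cech_cocycles 1 X A. h = cech_rel 1 X A `` {z})"
      by (auto simp: quotient_def simp del: One_nat_def)
    also have "\<dots> \<longleftrightarrow> (\<exists>\<phi>\<in>as_cocycles X A. h = cech_class X A \<phi>)"
      using 1 2 by metis
    finally show "h \<in> ?L \<longleftrightarrow> h \<in> ?R" by blast
  qed
  then show ?thesis
    by (simp add: cech_cohomology_def)
qed

lemma represents_zero: "cover_pair X A c \<Longrightarrow> represents X A c (\<lambda>_. 0) (\<lambda>_ _. 0)"
  unfolding represents_def primitives_def cover_pair_def
  by (intro exI[of _ "\<lambda>_ _. 0"]) (auto intro!: near_always dest: openin_subset)

lemma represents_add:
  assumes "represents X A c \<kappa> \<phi>" "represents X A c \<mu> \<psi>"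
  shows "represents X A c (\<lambda>\<sigma>. \<kappa> \<sigma> + \<mu> \<sigma>) (\<lambda>a b. \<phi> a b + \<psi> a b)"
proof -
  obtain w v where "primitives X A c \<kappa> \<phi> w" "primitives X A c \<mu> \<psi> v"
    using assms by (auto simp: represents_def)
  note w = primitivesD[OF this(1)] and v = primitivesD[OF this(2)]
  have "primitives X A c (\<lambda>\<sigma>. \<kappa> \<sigma> + \<mu> \<sigma>) (\<lambda>a b. \<phi> a b + \<psi> a b) (\<lambda>U x. w U x + v U x)"
    unfolding primitives_def
  proof (intro conjI ballI)
    fix U x assume "U \<in> fst c" "x \<in> U"
    then show "near X x (\<lambda>a b. \<phi> a b + \<psi> a b = w U b + v U b - (w U a + v U a))"
      by (intro near_conj[OF w(3) v(3)]) auto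
  qed (use w v in auto)
  then show ?thesis by (auto simp: represents_def)
qed

lemma represents_scale:
  assumes "represents X A c \<kappa> \<phi>"
  shows "represents X A c (\<lambda>\<sigma>. k * \<kappa> \<sigma>) (\<lambda>a b. k * \<phi> a b)"
proof -
  obtain w where "primitives X A c \<kappa> \<phi> w"
    using assms by (auto simp: represents_def)
  note w = primitivesD[OF this(1)]
  have "primitives X A c (\<lambda>\<sigma>. k * \<kappa> \<sigma>) (\<lambda>a b. k * \<phi> a b) (\<lambda>U x. k * w U x)"
    unfolding primitives_def
  proof (intro conjI ballI)
    fix U x assume "U \<in> fst c" "x \<in> U"
    then show "near X x (\<lambda>a b. k * \<phi> a b = k * w U b - k * w U a)"
      by (intro near_mono[OF w(3)]) (auto simp: right_diff_distrib)
  qed (use w in \<open>auto simp: right_diff_distrib\<close>)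
  then show ?thesis by (auto simp: represents_def)
qed

lemma cocycle_of_represents:
  assumes "cover_pair X A c" "represents X A c \<kappa> \<phi>"
    and "\<And>\<sigma>. \<kappa> \<sigma> \<noteq> 0 \<Longrightarrow> \<exists>U\<in>fst c. \<exists>V\<in>fst c. \<sigma> = [U, V] \<and> topspace X \<inter> (U \<inter> V) \<noteq> {}"
  shows "(c, \<kappa>) \<in> cech_class X A \<phi>"
proof -
  obtain w where "primitives X A c \<kappa> \<phi> w"
    using assms by (auto simp: represents_def)
  note w = primitivesD[OF this(1)]
  have "\<kappa> \<in> cocycles 1 X A c"
    by (rule cocycles_1I[where w = w]) (use assms(3) w assms(1) in \<open>auto simp: cover_pair_def\<close>)
  then show ?thesis
    using assms by (simp add: cech_class_def cech_cocycles_def)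
qed

lemma cech_class_supp:
  assumes "(c, \<kappa>) \<in> cech_class X A \<phi>" "\<kappa> \<sigma> \<noteq> 0"
  shows "\<exists>U\<in>fst c. \<exists>V\<in>fst c. \<sigma> = [U, V] \<and> topspace X \<inter> (U \<inter> V) \<noteq> {}"
  using assms cocycles_1_supp[of \<kappa> X A c \<sigma>] by (auto simp: cech_class_def cech_cocycles_def)

lemma cech_classD:
  assumes "(c, \<kappa>) \<in> cech_class X A \<phi>"
  shows "cover_pair X A c" "represents X A c \<kappa> \<phi>"
  using assms by (auto simp: cech_class_def cech_cocycles_def)

lemma zero_cech_cohomology_1:
  assumes A: "A \<subseteq> topspace X"
  shows "zero (cech_cohomology 1 X A) = cech_class X A (\<lambda>_ _. 0)"
proof -
  have "cover_pair X A ({topspace X}, {topspace X})"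
    using A by (auto simp: cover_pair_def)
  then have "cech_rel 1 X A `` {(c, \<lambda>_. 0) |c. cover_pair X A c} = cech_class X A (\<lambda>_ _. 0)"
    by (intro cech_class_Image[OF A]) (auto intro!: cocycle_of_represents represents_zero)
  then show ?thesis by (simp add: cech_cohomology_def)
qed

lemma add_cech_cohomology_1:
  assumes A: "A \<subseteq> topspace X" and phi: "\<phi> \<in> as_cocycles X A" "\<psi> \<in> as_cocycles X A"
  shows "add (cech_cohomology 1 X A) (cech_class X A \<phi>) (cech_class X A \<psi>) = cech_class X A (\<lambda>a b. \<phi> a b + \<psi> a b)"
proof -
  let ?S = "{(c, \<lambda>\<sigma>. \<kappa> \<sigma> + \<mu> \<sigma>) |c \<kappa> \<mu>. (c, \<kappa>) \<in> cech_class X A \<phi> \<and> (c, \<mu>) \<in> cech_class X A \<psi>}"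
  have "cech_rel 1 X A `` ?S = cech_class X A (\<lambda>a b. \<phi> a b + \<psi> a b)"
  proof (rule cech_class_Image[OF A])
    obtain c where c: "cover_pair X A c" "good_cover X A c \<phi>" "good_cover X A c \<psi>" "\<And>U. U \<in> snd c \<Longrightarrow> U \<inter> A \<noteq> {}"
      using good_cover_exists[OF A phi] by blast
    obtain \<kappa> where "(c, \<kappa>) \<in> cech_class X A \<phi>"
      using good_cover_represents[OF A c(1,2,4)] unfolding cech_class_def by blast
    moreover obtain \<mu> where "(c, \<mu>) \<in> cech_class X A \<psi>"
      using good_cover_represents[OF A c(1,3,4)] unfolding cech_class_def by blast
    ultimately show "?S \<noteq> {}" by blast
    show "?S \<subseteq> cech_class X A (\<lambda>a b. \<phi> a b + \<psi> a b)"
    proof safe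
      fix c \<kappa> \<mu> assume *: "(c, \<kappa>) \<in> cech_class X A \<phi>" "(c, \<mu>) \<in> cech_class X A \<psi>"
      show "(c, \<lambda>\<sigma>. \<kappa> \<sigma> + \<mu> \<sigma>) \<in> cech_class X A (\<lambda>a b. \<phi> a b + \<psi> a b)"
      proof (rule cocycle_of_represents)
        show "represents X A c (\<lambda>\<sigma>. \<kappa> \<sigma> + \<mu> \<sigma>) (\<lambda>a b. \<phi> a b + \<psi> a b)"
          using represents_add cech_classD * by blast
        fix \<sigma> assume "\<kappa> \<sigma> + \<mu> \<sigma> \<noteq> 0"
        then have "\<kappa> \<sigma> \<noteq> 0 \<or> \<mu> \<sigma> \<noteq> 0" by auto
        then show "\<exists>U\<in>fst c. \<exists>V\<in>fst c. \<sigma> = [U, V] \<and> topspace X \<inter> (U \<inter> V) \<noteq> {}"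
          using cech_class_supp[OF *(1)] cech_class_supp[OF *(2)] by metis
      qed (use cech_classD * in blast)
    qed
  qed
  then show ?thesis by (simp add: cech_cohomology_def)
qed

lemma smult_cech_cohomology_1:
  assumes A: "A \<subseteq> topspace X" and phi: "\<phi> \<in> as_cocycles X A"
  shows "smult (cech_cohomology 1 X A) k (cech_class X A \<phi>) = cech_class X A (\<lambda>a b. k * \<phi> a b)"
proof -
  let ?S = "{(c, \<lambda>\<sigma>. k * \<kappa> \<sigma>) |c \<kappa>. (c, \<kappa>) \<in> cech_class X A \<phi>}"
  have "cech_rel 1 X A `` ?S = cech_class X A (\<lambda>a b. k * \<phi> a b)"
  proof (rule cech_class_Image[OF A])
    show "?S \<noteq> {}" using cech_class_nonempty[OF A phi] by fastforce
    show "?S \<subseteq> cech_class X A (\<lambda>a b. k * \<phi> a b)"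
    proof safe
      fix c \<kappa> assume *: "(c, \<kappa>) \<in> cech_class X A \<phi>"
      show "(c, \<lambda>\<sigma>. k * \<kappa> \<sigma>) \<in> cech_class X A (\<lambda>a b. k * \<phi> a b)"
      proof (rule cocycle_of_represents)
        show "represents X A c (\<lambda>\<sigma>. k * \<kappa> \<sigma>) (\<lambda>a b. k * \<phi> a b)"
          using represents_scale cech_classD * by blast
        fix \<sigma> assume "k * \<kappa> \<sigma> \<noteq> 0"
        then have "\<kappa> \<sigma> \<noteq> 0" by auto
        then show "\<exists>U\<in>fst c. \<exists>V\<in>fst c. \<sigma> = [U, V] \<and> topspace X \<inter> (U \<inter> V) \<noteq> {}"
          using cech_class_supp[OF *] by metis
      qed (use cech_classD * in blast)
    qed
  qed
  then show ?thesis by (simp add: cech_cohomology_def)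
qed

text \<open>Preimages of a cover of \<open>Y\<close> supply a representative, so the saturated set
  is nonempty; primitives pull back by composition with \<open>g\<close> and the vertex map.\<close>

lemma cech_induced_1:
  assumes A: "A \<subseteq> topspace X" and B: "B \<subseteq> topspace Y" and g: "continuous_map X Y g" and gA: "g ` A \<subseteq> B"
    and phi: "\<phi> \<in> as_cocycles Y B"
  shows "cech_induced 1 X A g (cech_class Y B \<phi>) = cech_class X A (\<lambda>a b. \<phi> (g a) (g b))"
proof -
  let ?S = "{(d, cochain_pullback 1 X d p \<kappa>) |d p c \<kappa>.
          (c, \<kappa>) \<in> cech_class Y B \<phi> \<and> cover_pair X A d \<and> projection g d c p}"
  have "cech_rel 1 X A `` ?S = cech_class X A (\<lambda>a b. \<phi> (g a) (g b))"
  proof (rule cech_class_Image[OF A])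
    obtain c \<kappa> where ck: "(c, \<kappa>) \<in> cech_class Y B \<phi>"
      using cech_class_nonempty[OF B phi] by fastforce
    then have c: "cover_pair Y B c" by (rule cech_classD)
    define pre where "pre U = {x \<in> topspace X. g x \<in> U}" for U
    define d where "d = (pre ` fst c, pre ` snd c)"
    have sc: "snd c \<subseteq> fst c" using c by (simp add: cover_pair_def)
    have d: "cover_pair X A d"
      unfolding cover_pair_def
    proof (intro conjI ballI)
      fix U assume "U \<in> fst d"
      then show "openin X U"
        using c openin_continuous_map_preimage[OF g] by (auto simp: d_def pre_def cover_pair_def)
    next
      show "\<Union> (fst d) = topspace X"
      proof
        show "topspace X \<subseteq> \<Union> (fst d)"
        proof
          fix x assume x: "x \<in> topspace X"
          then have "g x \<in> \<Union>(fst c)"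
            using c g by (auto simp: cover_pair_def continuous_map_def)
          then show "x \<in> \<Union> (fst d)" using x by (auto simp: d_def pre_def)
        qed
      qed (auto simp: d_def pre_def)
      show "snd d \<subseteq> fst d" using sc by (auto simp: d_def)
      show "A \<subseteq> \<Union> (snd d)"
      proof
        fix x assume x: "x \<in> A"
        then have "g x \<in> \<Union>(snd c)"
          using c gA by (auto simp: cover_pair_def subset_iff image_subset_iff)
        then show "x \<in> \<Union> (snd d)" using x A by (auto simp: d_def pre_def)
      qed
    qed
    \<comment> \<open>Distinct members of \<open>c\<close> may have equal preimages, so the vertex
      map is a choice; it must prefer members of the subfamily where there are any.\<close>
    have "\<exists>U. (V \<in> fst d \<longrightarrow> U \<in> fst c \<and> V = pre U) \<and> (V \<in> snd d \<longrightarrow> U \<in> snd c)" for V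
      using sc by (cases "V \<in> snd d") (auto simp: d_def)
    then obtain p where p: "\<And>V. (V \<in> fst d \<longrightarrow> p V \<in> fst c \<and> V = pre (p V)) \<and> (V \<in> snd d \<longrightarrow> p V \<in> snd c)"
      by metis
    have "projection g d c p"
      unfolding projection_def
    proof (intro conjI ballI)
      fix V assume "V \<in> fst d"
      then have "V = pre (p V)" using p by blast
      then show "g ` V \<subseteq> p V" by (auto simp: pre_def)
    qed (use p in auto)
    with ck d show "?S \<noteq> {}" by blast
    show "?S \<subseteq> cech_class X A (\<lambda>a b. \<phi> (g a) (g b))"
    proof safe
      fix d p c and \<kappa> :: "('b, 'c) cochain" assume ck: "(c, \<kappa>) \<in> cech_class Y B \<phi>" and d: "cover_pair X A d" and p: "projection g d c p"
      show "(d, cochain_pullback 1 X d p \<kappa>) \<in> cech_class X A (\<lambda>a b. \<phi> (g a) (g b))"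
      proof (rule cocycle_of_represents[OF d])
        fix \<sigma> assume "cochain_pullback 1 X d p \<kappa> \<sigma> \<noteq> 0"
        then have "\<sigma> \<in> nerve (topspace X) (fst d) (Suc 0)"
          by (auto simp: cochain_pullback_def split: if_splits)
        then show "\<exists>U\<in>fst d. \<exists>V\<in>fst d. \<sigma> = [U, V] \<and> topspace X \<inter> (U \<inter> V) \<noteq> {}"
          by (auto simp: nerve_1_iff)
      next
        obtain w where "primitives Y B c \<kappa> \<phi> w"
          using cech_classD(2)[OF ck] by (auto simp: represents_def)
        note w = primitivesD[OF this]
        have pV: "p V \<in> fst c" "x \<in> V \<Longrightarrow> g x \<in> p V" if "V \<in> fst d" for V x
          using p that by (auto simp: projection_def)
        have dX: "x \<in> topspace X" if "V \<in> fst d" "x \<in> V" for V x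
          using d that openin_subset unfolding cover_pair_def by blast
        have sd: "snd d \<subseteq> fst d" using d by (simp add: cover_pair_def)
        have "primitives X A d (cochain_pullback 1 X d p \<kappa>) (\<lambda>a b. \<phi> (g a) (g b)) (\<lambda>V x. w (p V) (g x))"
          unfolding primitives_def
        proof (intro conjI ballI)
          fix U V x assume *: "U \<in> fst d" "V \<in> fst d" "x \<in> U \<inter> V"
          then have "[U, V] \<in> nerve (topspace X) (fst d) 1"
            using dX by (auto simp: nerve_1_iff)
          then show "cochain_pullback 1 X d p \<kappa> [U, V] = w (p V) (g x) - w (p U) (g x)"
            using w(1)[of "p U" "p V" "g x"] * pV by (auto simp: cochain_pullback_def)
        next
          fix U x assume *: "U \<in> snd d" "x \<in> U \<inter> A"
          then have "p U \<in> snd c" "g x \<in> p U" "g x \<in> B"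
            using p sd gA unfolding projection_def by blast+
          then show "w (p U) (g x) = 0" using w(2) by auto
        next
          fix U x assume *: "U \<in> fst d" "x \<in> U"
          show "near X x (\<lambda>a b. \<phi> (g a) (g b) = w (p U) (g b) - w (p U) (g a))"
            by (rule near_pullback[OF g dX[OF *] w(3)]) (use * pV in auto)
        qed
        then show "represents X A d (cochain_pullback 1 X d p \<kappa>) (\<lambda>a b. \<phi> (g a) (g b))"
          by (auto simp: represents_def)
      qed
    qed
  qed
  then show ?thesis by (simp add: cech_induced_def)
qed

lemma field_class_ring: "field (class_ring :: 'k::field ring)"
  by unfold_locales

lemma vectorspace_cech_cohomology_1:
  assumes A: "A \<subseteq> topspace X"
  shows "vectorspace (class_ring :: 'k::field ring) (cech_cohomology 1 X A :: ('k, ('b, 'k) cech_class) module)"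
proof -
  let ?H = "cech_cohomology 1 X A :: ('k, ('b, 'k) cech_class) module"
  note simps = add_cech_cohomology_1[OF A] smult_cech_cohomology_1[OF A] zero_cech_cohomology_1[OF A]
    as_cocycles_add as_cocycles_scale as_cocycles_zero[OF A]
  have car: "x \<in> carrier ?H \<Longrightarrow> \<exists>\<phi>\<in>as_cocycles X A. x = cech_class X A \<phi>" for x
    using carrier_cech_cohomology_1[OF A] by blast
  have car': "\<phi> \<in> as_cocycles X A \<Longrightarrow> cech_class X A \<phi> \<in> carrier ?H" for \<phi>
    using carrier_cech_cohomology_1[OF A] by blast
  note [simp del] = One_nat_def
  have ag: "abelian_group ?H"
  proof (rule abelian_groupI)
    fix x y assume "x \<in> carrier ?H" "y \<in> carrier ?H"
    then show "add ?H x y \<in> carrier ?H"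
      by (auto dest!: car simp: simps intro!: car')
  next
    show "zero ?H \<in> carrier ?H" by (simp add: simps car')
  next
    fix x y z assume "x \<in> carrier ?H" "y \<in> carrier ?H" "z \<in> carrier ?H"
    then show "add ?H (add ?H x y) z = add ?H x (add ?H y z)"
      by (auto dest!: car simp: simps add.assoc)
  next
    fix x y assume "x \<in> carrier ?H" "y \<in> carrier ?H"
    then show "add ?H x y = add ?H y x"
      by (auto dest!: car simp: simps add.commute)
  next
    fix x assume "x \<in> carrier ?H"
    then show "add ?H (zero ?H) x = x"
      by (auto dest!: car simp: simps)
  next
    fix x assume "x \<in> carrier ?H"
    then obtain \<phi> where phi: "\<phi> \<in> as_cocycles X A" "x = cech_class X A \<phi>" using car by blast
    then have "add ?H (cech_class X A (\<lambda>a b. (-1) * \<phi> a b)) x = zero ?H"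
      using as_cocycles_scale[OF phi(1), of "-1"] by (simp add: simps)
    moreover have "cech_class X A (\<lambda>a b. (-1) * \<phi> a b) \<in> carrier ?H"
      by (intro car' as_cocycles_scale phi)
    ultimately show "\<exists>y\<in>carrier ?H. add ?H y x = zero ?H" by blast
  qed
  have "Module.module (class_ring :: 'k ring) ?H"
  proof (rule moduleI[OF _ ag])
    show "cring (class_ring :: 'k ring)" by unfold_locales
  qed (auto dest!: car simp: simps car' distrib_left distrib_right mult.assoc)
  then show ?thesis
    by (simp add: vectorspace_def field_class_ring)
qed

section \<open>Bounds on the dimension\<close>

text \<open>Gaussian elimination by induction on the equations: a pivot \<open>p\<close> for
  equation \<open>j\<close> removes one equation and one unknown.\<close>

lemma homogeneous_system:
  fixes a :: "'i \<Rightarrow> 'j \<Rightarrow> 'k::field"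
  assumes "finite J" "finite I" "card J < card I"
  shows "\<exists>c. (\<exists>i\<in>I. c i \<noteq> 0) \<and> (\<forall>j\<in>J. (\<Sum>i\<in>I. c i * a i j) = 0)"
  using assms
proof (induction J arbitrary: I a rule: finite_induct)
  case empty
  then have "I \<noteq> {}" by auto
  then show ?case by (intro exI[of _ "\<lambda>_. 1"]) auto
next
  case (insert j J)
  show ?case
  proof (cases "\<forall>i\<in>I. a i j = 0")
    case True
    obtain c where "\<exists>i\<in>I. c i \<noteq> 0" "\<forall>j\<in>J. (\<Sum>i\<in>I. c i * a i j) = 0"
      using insert.IH[of I a] insert.prems insert.hyps by auto
    with True show ?thesis by (intro exI[of _ c]) auto
  next
    case False
    then obtain p where p: "p \<in> I" "a p j \<noteq> 0" by auto
    let ?I = "I - {p}"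
    define b where "b i l = a i l - a i j / a p j * a p l" for i l
    obtain c where c: "\<exists>i\<in>?I. c i \<noteq> 0" "\<forall>l\<in>J. (\<Sum>i\<in>?I. c i * b i l) = 0"
      using insert.IH[of ?I b] insert.prems insert.hyps p by (fastforce simp: card_Diff_singleton)
    \<comment> \<open>The pivot unknown is solved from equation \<open>j\<close>; with it the
      original sum equals the reduced one for every \<open>l\<close>.\<close>
    define t where "t = - (\<Sum>i\<in>?I. c i * (a i j / a p j))"
    define c' where "c' = c(p := t)"
    have split: "(\<Sum>i\<in>I. c' i * a i l) = t * a p l + (\<Sum>i\<in>?I. c i * a i l)" for l
    proof -
      have "(\<Sum>i\<in>?I. c' i * a i l) = (\<Sum>i\<in>?I. c i * a i l)"
        by (rule sum.cong) (auto simp: c'_def)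
      then show ?thesis
        using p insert.prems by (simp add: sum.remove[of I p] c'_def)
    qed
    have eq: "t * a p l + (\<Sum>i\<in>?I. c i * a i l) = (\<Sum>i\<in>?I. c i * b i l)" for l
      by (simp add: t_def b_def sum_distrib_right right_diff_distrib sum_subtractf mult.assoc)
    have "(\<Sum>i\<in>I. c' i * a i l) = 0" if "l \<in> insert j J" for l
    proof (cases "l = j")
      case True
      have "b i j = 0" for i using p by (simp add: b_def)
      then show ?thesis unfolding split eq True by simp
    next
      case False
      then show ?thesis unfolding split eq using c that by auto
    qed
    moreover have "\<exists>i\<in>I. c' i \<noteq> 0" using c by (auto simp: c'_def)
    ultimately show ?thesis by blast
  qed
qed

text \<open>For a subspace \<open>B\<close> of a space \<open>S\<close> this says that the quotient
  has dimension less than \<open>d\<close>. Families may repeat, and \<open>d = 0\<close> is never a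
  bound.\<close>

definition dep_bound :: "('b \<Rightarrow> 'b \<Rightarrow> 'k::field) set \<Rightarrow> ('b \<Rightarrow> 'b \<Rightarrow> 'k) set \<Rightarrow> nat \<Rightarrow> bool" where
  "dep_bound S B d \<longleftrightarrow> (\<forall>v. (\<forall>i<d. v i \<in> S) \<longrightarrow>
     (\<exists>c. (\<exists>i<d. c i \<noteq> 0) \<and> (\<lambda>a b. \<Sum>i<d. c i * v i a b) \<in> B))"

lemma dep_boundD:
  assumes "dep_bound S B d" "\<And>i. i < d \<Longrightarrow> v i \<in> S"
  obtains c where "\<exists>i<d. c i \<noteq> 0" "(\<lambda>a b. \<Sum>i<d. c i * v i a b) \<in> B"
  using assms unfolding dep_bound_def by blast

lemma sum_div_mod:
  fixes f :: "nat \<Rightarrow> nat \<Rightarrow> 'k::comm_monoid_add"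
  shows "(\<Sum>t<n * m. f (t div m) (t mod m)) = (\<Sum>j<n. \<Sum>i<m. f j i)"
proof -
  have "(\<Sum>t<n * m. f (t div m) (t mod m)) = (\<Sum>j<n. \<Sum>t\<in>{j * m..<j * m + m}. f (t div m) (t mod m))"
    by (simp add: sum.nat_group)
  also have "\<dots> = (\<Sum>j<n. \<Sum>i<m. f j i)"
  proof (rule sum.cong[OF refl])
    fix j assume "j \<in> {..<n}"
    have "(\<Sum>t\<in>{0 + j * m..<m + j * m}. f (t div m) (t mod m)) = (\<Sum>i\<in>{0..<m}. f ((i + j * m) div m) ((i + j * m) mod m))"
      by (rule sum.shift_bounds_nat_ivl)
    also have "\<dots> = (\<Sum>i<m. f j i)"
      by (rule sum.cong) auto
    finally show "(\<Sum>t\<in>{j * m..<j * m + m}. f (t div m) (t mod m)) = (\<Sum>i<m. f j i)"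
      by (simp add: add.commute)
  qed
  finally show ?thesis .
qed

text \<open>The exact sequence of the pair in degrees 0 and 1, read as a count: \<open>m\<close>
  bounds the absolute group and \<open>n\<close> the locally constant functions on \<open>A\<close>.
  In each of \<open>n\<close> blocks of \<open>m\<close> relative cocycles some combination bounds
  absolutely, with a primitive that is locally constant on \<open>A\<close>; a dependence among
  these \<open>n\<close> primitives yields one that vanishes on \<open>A\<close>.\<close>

lemma dep_bound_relative:
  fixes X :: "'b topology"
  assumes A: "A \<subseteq> topspace X"
    and m: "dep_bound (as_cocycles X {} :: ('b \<Rightarrow> 'b \<Rightarrow> 'k::field) set) (as_coboundaries X {}) m"
    and lc: "\<And>u :: nat \<Rightarrow> 'b \<Rightarrow> 'k. (\<And>i x. i < n \<Longrightarrow> x \<in> A \<Longrightarrow> near X x (\<lambda>a b. a \<in> A \<and> b \<in> A \<longrightarrow> u i a = u i b)) \<Longrightarrow>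
       \<exists>c. (\<exists>i<n. c i \<noteq> 0) \<and> (\<forall>x\<in>A. (\<Sum>i<n. c i * u i x) = 0)"
  shows "dep_bound (as_cocycles X A :: ('b \<Rightarrow> 'b \<Rightarrow> 'k) set) (as_coboundaries X A) (n * m)"
  unfolding dep_bound_def
proof (intro allI impI)
  fix v :: "nat \<Rightarrow> 'b \<Rightarrow> 'b \<Rightarrow> 'k" assume v: "\<forall>i<n * m. v i \<in> as_cocycles X A"
  have idx: "j * m + i < n * m" if "i < m" "j < n" for i j
  proof -
    have "j * m + i < Suc j * m" using that by simp
    also have "\<dots> \<le> n * m" using that by (intro mult_right_mono) auto
    finally show ?thesis .
  qed
  define R where "R j c u \<longleftrightarrow> (\<exists>i<m. c i \<noteq> 0) \<and>
    (\<forall>x\<in>topspace X. near X x (\<lambda>a b. (\<Sum>i<m. c i * v (j * m + i) a b) = u b - u a))" for j c u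
  have "\<exists>c u. R j c u" if j: "j < n" for j
  proof -
    have "v (j * m + i) \<in> as_cocycles X {}" if "i < m" for i
      using v idx[OF that j] by (auto simp: as_cocycles_def)
    then obtain c where "\<exists>i<m. c i \<noteq> 0" "(\<lambda>a b. \<Sum>i<m. c i * v (j * m + i) a b) \<in> as_coboundaries X {}"
      using dep_boundD[OF m, of "\<lambda>i. v (j * m + i)"] by blast
    then show ?thesis unfolding as_coboundaries_def R_def by blast
  qed
  then obtain c u where "\<And>j. j < n \<Longrightarrow> R j (c j) (u j)"
    by metis
  then have c: "\<And>j. j < n \<Longrightarrow> \<exists>i<m. c j i \<noteq> 0"
    and u: "\<And>j x. j < n \<Longrightarrow> x \<in> topspace X \<Longrightarrow> near X x (\<lambda>a b. (\<Sum>i<m. c j i * v (j * m + i) a b) = u j b - u j a)"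
    by (simp_all add: R_def)
  have const: "near X x (\<lambda>a b. a \<in> A \<and> b \<in> A \<longrightarrow> u j a = u j b)" if j: "j < n" and x: "x \<in> A" for j x
  proof -
    have "(\<lambda>a b. \<Sum>i\<in>{..<m}. c j i * v (j * m + i) a b) \<in> as_cocycles X A"
      by (rule as_cocycles_sum) (use A v idx j in auto)
    then have 1: "near X x (\<lambda>a b. a \<in> A \<and> b \<in> A \<longrightarrow> (\<Sum>i<m. c j i * v (j * m + i) a b) = 0)"
      using x by (rule as_cocycles_rel)
    show ?thesis
      by (rule near_conj[OF 1 u[OF j]]) (use x A in auto)
  qed
  have "\<exists>e. (\<exists>j<n. e j \<noteq> 0) \<and> (\<forall>x\<in>A. (\<Sum>j<n. e j * u j x) = 0)"
    by (rule lc[of u]) (rule const)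
  then obtain e where "(\<exists>j<n. e j \<noteq> 0) \<and> (\<forall>x\<in>A. (\<Sum>j<n. e j * u j x) = 0)" ..
  then have e: "\<exists>j<n. e j \<noteq> 0" "\<forall>x\<in>A. (\<Sum>j<n. e j * u j x) = 0" by auto
  \<comment> \<open>Position \<open>t = j * m + i\<close> is entry \<open>i\<close> of block
    \<open>j\<close>. A product of nonzero coefficients is nonzero, so the combined dependence is
    nontrivial.\<close>
  define C where "C t = e (t div m) * c (t div m) (t mod m)" for t
  have "(\<Sum>t<n * m. C t * v t a b) = (\<Sum>j<n. \<Sum>i<m. e j * c j i * v (j * m + i) a b)" for a b
    using sum_div_mod[of "\<lambda>j i. e j * c j i * v (j * m + i) a b" m n] by (simp add: C_def)
  then have C: "(\<Sum>t<n * m. C t * v t a b) = (\<Sum>j<n. e j * (\<Sum>i<m. c j i * v (j * m + i) a b))" for a b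
    by (simp add: sum_distrib_left mult.assoc)
  have "near X x (\<lambda>a b. (\<Sum>t<n * m. C t * v t a b) = (\<Sum>j<n. e j * u j b) - (\<Sum>j<n. e j * u j a))"
    if x: "x \<in> topspace X" for x
  proof -
    have 1: "near X x (\<lambda>a b. \<forall>j\<in>{..<n}. (\<Sum>i<m. c j i * v (j * m + i) a b) = u j b - u j a)"
      by (rule near_ball) (use x u in auto)
    show ?thesis
      by (rule near_mono[OF 1]) (simp add: C right_diff_distrib sum_subtractf)
  qed
  then have "(\<lambda>a b. \<Sum>t<n * m. C t * v t a b) \<in> as_coboundaries X A"
    unfolding as_coboundaries_def using e(2) by (intro CollectI exI[of _ "\<lambda>x. \<Sum>j<n. e j * u j x"]) auto
  moreover have "\<exists>t<n * m. C t \<noteq> 0"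
  proof -
    obtain j where j: "j < n" "e j \<noteq> 0" using e by auto
    obtain i where i: "i < m" "c j i \<noteq> 0" using c[OF j(1)] by auto
    have "C (j * m + i) \<noteq> 0" using i j by (simp add: C_def)
    then show ?thesis using idx[OF i(1) j(1)] by blast
  qed
  ultimately show "\<exists>c. (\<exists>i<n * m. c i \<noteq> 0) \<and> (\<lambda>a b. \<Sum>i<n * m. c i * v i a b) \<in> as_coboundaries X A"
    by blast
qed

text \<open>One vector more than there are spanning elements leaves more unknowns than equations for
  the coordinates, which \<open>homogeneous_system\<close> solves.\<close>

lemma dep_bound_of_spanning:
  fixes X :: "'b topology" and \<psi> :: "'v \<Rightarrow> 'b \<Rightarrow> 'b \<Rightarrow> 'k::field"
  assumes "finite J"
    and span: "\<And>\<phi>. \<phi> \<in> as_cocycles X A \<Longrightarrow> \<exists>a. (\<lambda>x y. \<phi> x y - (\<Sum>v\<in>J. a v * \<psi> v x y)) \<in> as_coboundaries X A"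
  shows "dep_bound (as_cocycles X A :: ('b \<Rightarrow> 'b \<Rightarrow> 'k) set) (as_coboundaries X A) (Suc (card J))"
  unfolding dep_bound_def
proof (intro allI impI)
  let ?d = "Suc (card J)"
  fix v :: "nat \<Rightarrow> 'b \<Rightarrow> 'b \<Rightarrow> 'k" assume v: "\<forall>i<?d. v i \<in> as_cocycles X A"
  have "\<exists>a. (\<lambda>x y. v i x y - (\<Sum>l\<in>J. a l * \<psi> l x y)) \<in> as_coboundaries X A" if "i < ?d" for i
    using v span that by blast
  then have "\<forall>i\<in>{..<?d}. \<exists>a. (\<lambda>x y. v i x y - (\<Sum>l\<in>J. a l * \<psi> l x y)) \<in> as_coboundaries X A"
    by blast
  from bchoice[OF this] obtain a where a: "\<And>i. i < ?d \<Longrightarrow> (\<lambda>x y. v i x y - (\<Sum>l\<in>J. a i l * \<psi> l x y)) \<in> as_coboundaries X A"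
    by auto
  obtain c where c: "\<exists>i\<in>{..<?d}. c i \<noteq> 0" "\<forall>l\<in>J. (\<Sum>i\<in>{..<?d}. c i * a i l) = 0"
    using homogeneous_system[of J "{..<?d}" a] assms(1) by auto
  have "(\<lambda>x y. \<Sum>i\<in>{..<?d}. c i * (v i x y - (\<Sum>l\<in>J. a i l * \<psi> l x y))) \<in> as_coboundaries X A"
    by (rule as_coboundaries_sum) (use a in auto)
  moreover have "(\<Sum>i\<in>{..<?d}. c i * (v i x y - (\<Sum>l\<in>J. a i l * \<psi> l x y))) = (\<Sum>i<?d. c i * v i x y)" for x y
  proof -
    have "(\<Sum>i<?d. c i * (\<Sum>l\<in>J. a i l * \<psi> l x y)) = (\<Sum>i<?d. \<Sum>l\<in>J. c i * a i l * \<psi> l x y)"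
      by (simp only: sum_distrib_left mult.assoc)
    also have "\<dots> = (\<Sum>l\<in>J. \<Sum>i<?d. c i * a i l * \<psi> l x y)"
      by (rule sum.swap)
    also have "\<dots> = (\<Sum>l\<in>J. (\<Sum>i<?d. c i * a i l) * \<psi> l x y)"
      by (simp only: sum_distrib_right)
    also have "\<dots> = 0" using c(2) by simp
    finally show ?thesis by (simp only: right_diff_distrib sum_subtractf diff_zero)
  qed
  ultimately show "\<exists>c. (\<exists>i<?d. c i \<noteq> 0) \<and> (\<lambda>a b. \<Sum>i<?d. c i * v i a b) \<in> as_coboundaries X A"
    using c(1) by (intro exI[of _ c]) auto
qed

text \<open>By \<open>cech_class_eq_iff\<close>, membership of a class in a finite span becomes
  congruence of two-point functions modulo coboundaries.\<close>

lemma dep_bound_cech_cohomology_1: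
  fixes X :: "'b topology"
  assumes A: "A \<subseteq> topspace X"
    and fin: "vectorspace.fin_dim (class_ring :: 'k::field ring) (cech_cohomology 1 X A :: ('k, ('b, 'k) cech_class) module)"
  obtains d where "dep_bound (as_cocycles X A :: ('b \<Rightarrow> 'b \<Rightarrow> 'k) set) (as_coboundaries X A) d"
proof -
  let ?H = "cech_cohomology 1 X A :: ('k, ('b, 'k) cech_class) module"
  interpret H: vectorspace "class_ring :: 'k ring" ?H
    by (rule vectorspace_cech_cohomology_1[OF A])
  obtain J where J: "finite J" "J \<subseteq> carrier ?H" "H.span J = carrier ?H"
    using fin unfolding H.fin_dim_def by blast
  have "\<exists>\<phi>\<in>as_cocycles X A. cech_class X A \<phi> = h" if "h \<in> J" for h
  proof -
    have "h \<in> cech_class X A ` as_cocycles X A"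
      using J(2) that unfolding carrier_cech_cohomology_1[OF A] by (rule subsetD)
    then show ?thesis by blast
  qed
  then obtain \<psi> where psi: "\<And>h. h \<in> J \<Longrightarrow> \<psi> h \<in> as_cocycles X A \<and> cech_class X A (\<psi> h) = h"
    by metis
  have lin: "(\<lambda>x y. \<Sum>h\<in>I. a h * \<psi> h x y) \<in> as_cocycles X A \<and>
      H.lincomb a I = cech_class X A (\<lambda>x y. \<Sum>h\<in>I. a h * \<psi> h x y)" if "finite I" "I \<subseteq> J" for a I
    using that
  proof (induction I rule: finite_induct)
    case empty
    then show ?case
      using zero_cech_cohomology_1[OF A] as_cocycles_zero[OF A] by (simp add: H.lincomb_def del: One_nat_def)
  next
    case (insert h I)
    have h: "\<psi> h \<in> as_cocycles X A" "cech_class X A (\<psi> h) = h" "h \<in> carrier ?H" "I \<subseteq> carrier ?H"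
      using psi[of h] insert.prems J(2) by auto
    have "H.lincomb a (insert h I) = smult ?H (a h) h \<oplus>\<^bsub>?H\<^esub> H.lincomb a I"
      unfolding H.lincomb_def
      by (rule H.finsum_insert) (use insert.hyps h in \<open>auto simp del: One_nat_def intro!: H.smult_closed\<close>)
    also have "smult ?H (a h) h = cech_class X A (\<lambda>x y. a h * \<psi> h x y)"
      using smult_cech_cohomology_1[OF A h(1), of "a h"] h(2) by simp
    finally show ?case
      using insert as_cocycles_scale[OF h(1), of "a h"] as_cocycles_add[OF as_cocycles_scale[OF h(1), of "a h"]]
        add_cech_cohomology_1[OF A as_cocycles_scale[OF h(1), of "a h"]]
      by simp
  qed
  have "\<exists>a. (\<lambda>x y. \<phi> x y - (\<Sum>h\<in>J. a h * \<psi> h x y)) \<in> as_coboundaries X A"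
    if phi: "\<phi> \<in> as_cocycles X A" for \<phi> :: "'b \<Rightarrow> 'b \<Rightarrow> 'k"
  proof -
    have "cech_class X A \<phi> \<in> H.span J"
      using J(3) carrier_cech_cohomology_1[OF A] phi by blast
    then obtain a I where I: "finite I" "I \<subseteq> J" "cech_class X A \<phi> = H.lincomb a I"
      unfolding H.span_def by blast
    define b where "b h = (if h \<in> I then a h else 0)" for h
    have "(\<Sum>h\<in>J. b h * \<psi> h x y) = (\<Sum>h\<in>I. a h * \<psi> h x y)" for x y
      using J(1) I(2) by (intro sum.mono_neutral_cong_right) (auto simp: b_def)
    moreover have "(\<lambda>x y. \<phi> x y - (\<Sum>h\<in>I. a h * \<psi> h x y)) \<in> as_coboundaries X A"
      using cech_class_eq_iff[OF A phi] lin[OF I(1,2), of a] I(3) by blast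
    ultimately show ?thesis by (intro exI[of _ b]) simp
  qed
  from dep_bound_of_spanning[OF J(1) this] show ?thesis by (rule that)
qed

text \<open>Since \<open>k\<close> undoes \<open>h\<close>, every cocycle on \<open>X\<close> is the
  pullback along \<open>h\<close> of one on \<open>Y\<close>, and a dependence on \<open>Y\<close>
  pulls back to \<open>X\<close>.\<close>

lemma dep_bound_pullback:
  assumes h: "continuous_map X Y h" and k: "continuous_map Y X k" and inv: "\<And>x. x \<in> topspace X \<Longrightarrow> k (h x) = x"
    and d: "dep_bound (as_cocycles Y {} :: ('c \<Rightarrow> 'c \<Rightarrow> 'k::field) set) (as_coboundaries Y {}) d"
  shows "dep_bound (as_cocycles X {} :: ('b \<Rightarrow> 'b \<Rightarrow> 'k::field) set) (as_coboundaries X {}) d"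
  unfolding dep_bound_def
proof (intro allI impI)
  fix v :: "nat \<Rightarrow> 'b \<Rightarrow> 'b \<Rightarrow> 'k" assume v: "\<forall>i<d. v i \<in> as_cocycles X {}"
  have "(\<lambda>a b. v i (k a) (k b)) \<in> as_cocycles Y {}" if "i < d" for i
    by (rule as_cocycles_pullback[OF k]) (use v that in auto)
  then obtain c where c: "\<exists>i<d. c i \<noteq> 0" "(\<lambda>a b. \<Sum>i<d. c i * v i (k a) (k b)) \<in> as_coboundaries Y {}"
    using dep_boundD[OF d, of "\<lambda>i a b. v i (k a) (k b)"] by blast
  from as_coboundaries_pullback[OF h, of "{}" "{}", OF _ c(2)]
  obtain u where u: "\<And>x. x \<in> topspace X \<Longrightarrow> near X x (\<lambda>a b. (\<Sum>i<d. c i * v i (k (h a)) (k (h b))) = u b - u a)"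
    unfolding as_coboundaries_def by auto
  have "near X x (\<lambda>a b. (\<Sum>i<d. c i * v i a b) = u b - u a)" if "x \<in> topspace X" for x
    by (rule near_mono[OF u[OF that]]) (use inv in simp)
  then have "(\<lambda>a b. \<Sum>i<d. c i * v i a b) \<in> as_coboundaries X {}"
    unfolding as_coboundaries_def by auto
  with c(1) show "\<exists>c. (\<exists>i<d. c i \<noteq> 0) \<and> (\<lambda>a b. \<Sum>i<d. c i * v i a b) \<in> as_coboundaries X {}" by blast
qed

section \<open>Compact Hausdorff spaces\<close>

lemma compactin_finite_point_cover:
  assumes "compactin X S" "\<And>x. x \<in> S \<Longrightarrow> openin X (U x) \<and> x \<in> U x"
  obtains F where "finite F" "F \<subseteq> S" "S \<subseteq> (\<Union>x\<in>F. U x)"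
proof -
  have "S \<subseteq> \<Union>(U ` S)" using assms(2) by blast
  then obtain \<F> where "finite \<F>" "\<F> \<subseteq> U ` S" "S \<subseteq> \<Union>\<F>"
    using compactinD[OF assms(1), of "U ` S"] assms(2) by blast
  then show ?thesis
    using that by (metis finite_subset_image)
qed

lemma closedin_separation:
  assumes "compact_space X" "Hausdorff_space X" "closedin X S" "closedin X T" "S \<inter> T = {}"
  obtains U V where "openin X U" "openin X V" "S \<subseteq> U" "T \<subseteq> V" "U \<inter> V = {}"
  using Hausdorff_space_compact_separation[of X S T] assms closedin_compact_space
  by (metis disjnt_def)

lemma closed_neighbourhood:
  assumes "compact_space X" "Hausdorff_space X" "openin X U" "x \<in> U"
  obtains V C where "openin X V" "closedin X C" "x \<in> V" "V \<subseteq> C" "C \<subseteq> U"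
proof -
  have "neighbourhood_base_of (closedin X) X"
    using assms compact_Hausdorff_imp_regular_space neighbourhood_base_of_closedin by blast
  then show ?thesis
    using that assms unfolding neighbourhood_base_of by metis
qed

text \<open>A neighbourhood of a closed set retracts onto it, discontinuously but respecting a given
  open cover: a point is sent to a point of \<open>K\<close> lying in every member of the cover whose
  shrinking contains it.\<close>

lemma cover_retraction:
  assumes Y: "compact_space Y" "Hausdorff_space Y" and K: "closedin Y K"
    and cover: "\<And>x. x \<in> K \<Longrightarrow> \<exists>O'\<in>\<O>. openin Y O' \<and> x \<in> O'"
  obtains G r where "openin Y G" "K \<subseteq> G" "r ` G \<subseteq> K" "\<And>x. x \<in> K \<Longrightarrow> r x = x"
    "\<And>y. y \<in> G \<Longrightarrow> \<exists>V. \<exists>O'\<in>\<O>. openin Y V \<and> y \<in> V \<and> V \<subseteq> G \<and> V \<subseteq> O' \<and> r ` V \<subseteq> O'"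
proof -
  define good where "good x O' V C \<longleftrightarrow> O' \<in> \<O> \<and> openin Y V \<and> closedin Y C \<and> x \<in> V \<and> V \<subseteq> C \<and> C \<subseteq> O'" for x O' V C
  have "\<exists>O' V C. good x O' V C" if "x \<in> K" for x
    using cover[OF that] closed_neighbourhood[OF Y] unfolding good_def by metis
  then obtain O' V C where good: "\<And>x. x \<in> K \<Longrightarrow> good x (O' x) (V x) (C x)"
    by metis
  have kc: "compactin Y K" using Y(1) K by (rule closedin_compact_space)
  obtain F where F: "finite F" "F \<subseteq> K" "K \<subseteq> (\<Union>x\<in>F. V x)"
    using compactin_finite_point_cover[OF kc, of V] good unfolding good_def by metis
  \<comment> \<open>If \<open>y\<close> lies in \<open>N z\<close> and in a shrinking
    \<open>C x\<close> with \<open>x\<close> in \<open>F\<close>, then \<open>z\<close> lies in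
    \<open>O' x\<close>, because every \<open>C x\<close> with \<open>z\<close> outside
    \<open>O' x\<close> has been removed. Finiteness of \<open>F\<close> keeps \<open>N z\<close>
    open.\<close>
  define N where "N z = topspace Y - \<Union>(C ` {x\<in>F. z \<notin> O' x})" for z
  have N: "openin Y (N z)" for z
    unfolding N_def
    by (intro openin_diff openin_topspace closedin_Union) (use F good in \<open>auto simp: good_def\<close>)
  have zN: "z \<in> N z" if "z \<in> K" for z
    using that good F closedin_subset[OF K] unfolding N_def good_def by blast
  define G where "G = (\<Union>z\<in>K. N z) \<inter> (\<Union>x\<in>F. V x)"
  define r where "r y = (if y \<in> K then y else SOME z. z \<in> K \<and> y \<in> N z)" for y
  have r: "r y \<in> K \<and> y \<in> N (r y)" if "y \<in> G" for y
  proof (cases "y \<in> K")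
    case False
    from that obtain z where "z \<in> K \<and> y \<in> N z" unfolding G_def by blast
    from someI[of "\<lambda>z. z \<in> K \<and> y \<in> N z", OF this] False show ?thesis
      by (simp add: r_def)
  qed (simp add: r_def zN)
  have oG: "openin Y G"
    unfolding G_def using N F good by (intro openin_Int openin_Union) (auto simp: good_def)
  show ?thesis
  proof
    show "openin Y G" by (rule oG)
    show "K \<subseteq> G" using zN F by (auto simp: G_def)
    show "r ` G \<subseteq> K" using r by auto
    show "r x = x" if "x \<in> K" for x using that by (simp add: r_def)
    show "\<exists>V. \<exists>O'\<in>\<O>. openin Y V \<and> y \<in> V \<and> V \<subseteq> G \<and> V \<subseteq> O' \<and> r ` V \<subseteq> O'" if y: "y \<in> G" for y
    proof -
      obtain x where x: "x \<in> F" "y \<in> V x" using y unfolding G_def by blast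
      have gx: "good x (O' x) (V x) (C x)" using good F(2) x(1) by blast
      have "r w \<in> O' x" if w: "w \<in> V x \<inter> G" for w
      proof (rule ccontr)
        assume "r w \<notin> O' x"
        then have "w \<notin> C x" using r[of w] w x(1) unfolding N_def by blast
        then show False using w gx unfolding good_def by blast
      qed
      then have "openin Y (V x \<inter> G) \<and> y \<in> V x \<inter> G \<and> V x \<inter> G \<subseteq> G \<and> V x \<inter> G \<subseteq> O' x \<and> r ` (V x \<inter> G) \<subseteq> O' x"
        using gx oG x y unfolding good_def by (auto intro: openin_Int)
      moreover have "O' x \<in> \<O>" using gx by (simp add: good_def)
      ultimately show ?thesis by blast
    qed
  qed
qed

section \<open>Separation and quasicomponents\<close>

text \<open>For closed \<open>C\<close>, the negation says that \<open>C\<close> is connected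
  between its traces on \<open>P\<close> and \<open>Q\<close>.\<close>

definition splits :: "'b topology \<Rightarrow> 'b set \<Rightarrow> 'b set \<Rightarrow> 'b set \<Rightarrow> bool" where
  "splits X P Q C \<longleftrightarrow> (\<exists>S T. closedin X S \<and> closedin X T \<and> S \<inter> T = {} \<and> C = S \<union> T \<and> C \<inter> P \<subseteq> S \<and> C \<inter> Q \<subseteq> T)"

lemma splitsI:
  "closedin X S \<Longrightarrow> closedin X T \<Longrightarrow> S \<inter> T = {} \<Longrightarrow> C = S \<union> T \<Longrightarrow> C \<inter> P \<subseteq> S \<Longrightarrow> C \<inter> Q \<subseteq> T \<Longrightarrow> splits X P Q C"
  unfolding splits_def by blast

text \<open>By compactness a splitting of the intersection of a chain of closed sets already splits
  some member of the chain, so failure to split survives such intersections and Zorn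
  applies.\<close>

lemma minimal_nonsplit:
  assumes X: "compact_space X" "Hausdorff_space X" and PQ: "closedin X P" "closedin X Q"
    and Y: "closedin X Y" "\<not> splits X P Q Y"
  obtains C where "closedin X C" "C \<subseteq> Y" "\<not> splits X P Q C"
    "\<And>D. closedin X D \<Longrightarrow> D \<subseteq> C \<Longrightarrow> D \<noteq> C \<Longrightarrow> splits X P Q D"
proof -
  let ?t = "topspace X"
  \<comment> \<open>Passing to complements turns minimal closed sets into maximal open ones, and
    chains have their unions as upper bounds.\<close>
  define \<A> where "\<A> = {D. openin X D \<and> \<not> splits X P Q (?t - D) \<and> ?t - Y \<subseteq> D}"
  have "?t - Y \<in> \<A>"
    using Y closedin_subset[OF Y(1)] by (auto simp: \<A>_def double_diff)
  then have ne: "\<A> \<noteq> {}" by blast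
  have "\<Union>\<C> \<in> \<A>" if C: "\<C> \<noteq> {}" "subset.chain \<A> \<C>" for \<C>
  proof -
    have sub: "\<C> \<subseteq> \<A>" using C(2) by (auto simp: subset_chain_def)
    have op: "openin X D" if "D \<in> \<C>" for D using sub that by (auto simp: \<A>_def)
    have "\<not> splits X P Q (?t - \<Union>\<C>)"
    proof
      assume "splits X P Q (?t - \<Union>\<C>)"
      then obtain S T where ST: "closedin X S" "closedin X T" "S \<inter> T = {}" "?t - \<Union>\<C> = S \<union> T"
          "(?t - \<Union>\<C>) \<inter> P \<subseteq> S" "(?t - \<Union>\<C>) \<inter> Q \<subseteq> T"
        unfolding splits_def by blast
      obtain U V where UV: "openin X U" "openin X V" "S \<subseteq> U" "T \<subseteq> V" "U \<inter> V = {}"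
        using closedin_separation[OF X ST(1-3)] by metis
      \<comment> \<open>\<open>R\<close> collects the points where \<open>U\<close> and
        \<open>V\<close> fail to separate as required. It is compact and covered by the chain, so
        one member of the chain contains it.\<close>
      define R where "R = (?t - (U \<union> V)) \<union> (P - U) \<union> (Q - V)"
      have "closedin X R" unfolding R_def
        using UV PQ by (intro closedin_Un closedin_diff openin_Un) auto
      then have Rc: "compactin X R" using X(1) closedin_compact_space by blast
      have "R \<subseteq> \<Union>\<C>"
      proof
        fix x assume x: "x \<in> R"
        have "R \<subseteq> ?t" using \<open>closedin X R\<close> by (rule closedin_subset)
        show "x \<in> \<Union>\<C>"
        proof (rule ccontr)
          assume "x \<notin> \<Union>\<C>"
          then have "x \<in> ?t - \<Union>\<C>" using x \<open>R \<subseteq> ?t\<close> by blast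
          then show False using x ST(4-6) UV(3,4) unfolding R_def by blast
        qed
      qed
      then obtain \<F> where F: "finite \<F>" "\<F> \<subseteq> \<C>" "R \<subseteq> \<Union>\<F>"
        using compactinD[OF Rc, of \<C>] op by blast
      have "\<exists>D\<in>\<C>. R \<subseteq> D"
      proof (cases "\<F> = {}")
        case True
        then show ?thesis using F(3) C(1) by auto
      next
        case False
        have "subset.chain \<A> \<F>"
          unfolding subset_chain_def
        proof (intro conjI ballI)
          show "\<F> \<subseteq> \<A>" using F(2) sub by (rule subset_trans)
          fix D E assume "D \<in> \<F>" "E \<in> \<F>"
          then have "D \<in> \<C>" "E \<in> \<C>" using F(2) by auto
          then show "D \<subseteq> E \<or> E \<subseteq> D" using C(2) unfolding subset_chain_def by simp
        qed
        from Union_in_chain[OF F(1) False this] F(2,3) show ?thesis by blast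
      qed
      then obtain D where D: "D \<in> \<C>" "R \<subseteq> D" by blast
      \<comment> \<open>Outside \<open>R\<close> every point lies in exactly one of \<open>U\<close>
        and \<open>V\<close>, so deleting one open set leaves a closed part contained in the
        other.\<close>
      have "splits X P Q (?t - D)"
      proof (rule splitsI)
        show "closedin X ((?t - D) - V)" "closedin X ((?t - D) - U)"
          using op[OF D(1)] UV by (auto intro: closedin_diff)
        show "(?t - D - V) \<inter> (?t - D - U) = {}" "?t - D = ?t - D - V \<union> (?t - D - U)"
          using D(2) UV(5) unfolding R_def by blast+
        show "(?t - D) \<inter> P \<subseteq> ?t - D - V" "(?t - D) \<inter> Q \<subseteq> ?t - D - U"
          using D(2) UV(5) unfolding R_def by blast+
      qed
      then show False using D(1) sub by (auto simp: \<A>_def)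
    qed
    moreover have "openin X (\<Union>\<C>)" using op by blast
    moreover have "?t - Y \<subseteq> \<Union>\<C>" using C(1) sub unfolding \<A>_def by blast
    ultimately show ?thesis by (simp add: \<A>_def)
  qed
  from subset_Zorn_nonempty[OF ne this]
  obtain M where M: "M \<in> \<A>" "\<And>D. D \<in> \<A> \<Longrightarrow> M \<subseteq> D \<Longrightarrow> D = M" by blast
  show ?thesis
  proof
    show "closedin X (?t - M)" "?t - M \<subseteq> Y" "\<not> splits X P Q (?t - M)"
      using M(1) by (auto simp: \<A>_def)
    show "splits X P Q D" if D: "closedin X D" "D \<subseteq> ?t - M" "D \<noteq> ?t - M" for D
    proof (rule ccontr)
      assume "\<not> splits X P Q D"
      moreover have "?t - (?t - D) = D" using closedin_subset[OF D(1)] by blast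
      moreover have "?t - Y \<subseteq> ?t - D" using D(2) M(1) unfolding \<A>_def by blast
      ultimately have "?t - D \<in> \<A>" using D(1) by (auto simp: \<A>_def)
      moreover have "M \<subseteq> ?t" using M(1) openin_subset unfolding \<A>_def by blast
      ultimately have "?t - D = M" using M(2)[of "?t - D"] D(2) by blast
      then show False using D(2,3) closedin_subset[OF D(1)] by blast
    qed
  qed
qed

text \<open>A minimal closed set that cannot be split between \<open>P\<close> and \<open>Q\<close> becomes connected when
  \<open>P\<close> and \<open>Q\<close> are removed, and what remains accumulates at both of them.\<close>

lemma splits_of_no_essential_quasicomponent:
  assumes X: "compact_space X" "Hausdorff_space X" and PQ: "closedin X P" "closedin X Q" "P \<inter> Q = {}"
    and A: "A \<subseteq> topspace X - (P \<union> Q)" "closedin X (A \<union> (P \<union> Q))"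
    and ness: "\<And>F. F \<in> quasi_components_of (subtopology X (topspace X - (P \<union> Q))) \<Longrightarrow>
      (X closure_of F) \<inter> P \<noteq> {} \<Longrightarrow> (X closure_of F) \<inter> Q \<noteq> {} \<Longrightarrow> F \<inter> A = {}"
  shows "splits X P Q (A \<union> (P \<union> Q))"
proof (rule ccontr)
  assume "\<not> splits X P Q (A \<union> (P \<union> Q))"
  then obtain C where C: "closedin X C" "C \<subseteq> A \<union> (P \<union> Q)" "\<not> splits X P Q C"
    and min: "\<And>D. closedin X D \<Longrightarrow> D \<subseteq> C \<Longrightarrow> D \<noteq> C \<Longrightarrow> splits X P Q D"
    using minimal_nonsplit[OF X PQ(1,2) A(2)] by blast
  let ?U = "topspace X - (P \<union> Q)"
  define S where "S = C - (P \<union> Q)"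
  have S: "S \<subseteq> ?U" "S \<subseteq> A" "S \<subseteq> C" using C(2) closedin_subset[OF C(1)] by (auto simp: S_def)
  have cPQ: "closedin X (C \<inter> (P \<union> Q))" "closedin X (C \<inter> P)" "closedin X (C \<inter> Q)"
    using C(1) PQ by auto
  \<comment> \<open>A separation of \<open>S\<close> gives two proper closed subsets of
    \<open>C\<close>, both containing its trace on \<open>P \<union> Q\<close>. They split by
    minimality, and the splittings glue because they overlap only in \<open>P \<union> Q\<close>,
    where the sides are prescribed.\<close>
  have "connectedin X S"
  proof (rule ccontr)
    assume "\<not> connectedin X S"
    then obtain E1 E2 where E: "closedin X E1" "closedin X E2" "S \<subseteq> E1 \<union> E2" "E1 \<inter> E2 \<inter> S = {}" "E1 \<inter> S \<noteq> {}" "E2 \<inter> S \<noteq> {}"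
      using S(1) unfolding connectedin_closedin by blast
    have "splits X P Q (C \<inter> E1 \<union> C \<inter> (P \<union> Q))"
      by (rule min) (use C(1) E cPQ S in \<open>auto simp: S_def\<close>)
    then obtain S1 T1 where 1: "closedin X S1" "closedin X T1" "S1 \<inter> T1 = {}" "C \<inter> E1 \<union> C \<inter> (P \<union> Q) = S1 \<union> T1"
       "(C \<inter> E1 \<union> C \<inter> (P \<union> Q)) \<inter> P \<subseteq> S1" "(C \<inter> E1 \<union> C \<inter> (P \<union> Q)) \<inter> Q \<subseteq> T1"
      unfolding splits_def by blast
    have "splits X P Q (C \<inter> E2 \<union> C \<inter> (P \<union> Q))"
      by (rule min) (use C(1) E cPQ S in \<open>auto simp: S_def\<close>)
    then obtain S2 T2 where 2: "closedin X S2" "closedin X T2" "S2 \<inter> T2 = {}" "C \<inter> E2 \<union> C \<inter> (P \<union> Q) = S2 \<union> T2"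
       "(C \<inter> E2 \<union> C \<inter> (P \<union> Q)) \<inter> P \<subseteq> S2" "(C \<inter> E2 \<union> C \<inter> (P \<union> Q)) \<inter> Q \<subseteq> T2"
      unfolding splits_def by blast
    have SC: "S1 \<union> T1 \<subseteq> C" "S2 \<union> T2 \<subseteq> C" using 1(4) 2(4) by blast+
    have out: "x \<in> P \<union> Q" if "x \<in> S1 \<union> T1" "x \<in> S2 \<union> T2" for x
    proof (rule ccontr)
      assume "x \<notin> P \<union> Q"
      then have "x \<in> E1 \<inter> E2 \<inter> S" using that 1(4) 2(4) unfolding S_def by blast
      then show False using E(4) by blast
    qed
    have "splits X P Q C"
    proof (rule splitsI)
      show "closedin X (S1 \<union> S2)" "closedin X (T1 \<union> T2)" using 1 2 by auto
      show "C = S1 \<union> S2 \<union> (T1 \<union> T2)"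
      proof
        show "C \<subseteq> S1 \<union> S2 \<union> (T1 \<union> T2)"
          using E(3) 1(4) 2(4) unfolding S_def by blast
      qed (use SC in blast)
      show "(S1 \<union> S2) \<inter> (T1 \<union> T2) = {}"
      proof (rule ccontr)
        assume "\<not> ?thesis"
        then obtain x where "x \<in> S1 \<inter> T2 \<or> x \<in> S2 \<inter> T1" using 1(3) 2(3) by blast
        then have x: "x \<in> P \<union> Q" "x \<in> C" "(x \<in> S1 \<and> x \<in> T2) \<or> (x \<in> S2 \<and> x \<in> T1)"
          using out SC by blast+
        then show False using 1(3,5,6) 2(3,5,6) by blast
      qed
      show "C \<inter> P \<subseteq> S1 \<union> S2" "C \<inter> Q \<subseteq> T1 \<union> T2" using 1(5,6) by blast+
    qed
    with C(3) show False by simp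
  qed
  have "S \<noteq> {}"
  proof
    assume "S = {}"
    then have "C = C \<inter> P \<union> C \<inter> Q" by (auto simp: S_def)
    then have "splits X P Q C" using cPQ PQ(3) by (intro splitsI[of X "C \<inter> P" "C \<inter> Q"]) auto
    with C(3) show False by simp
  qed
  then obtain x where x: "x \<in> S" by blast
  let ?X = "subtopology X ?U"
  define F where "F = quasi_component_of_set ?X x"
  have F: "F \<in> quasi_components_of ?X"
    unfolding F_def quasi_component_in_quasi_components_of using x S(1) by auto
  have "connectedin ?X S" using \<open>connectedin X S\<close> S(1) by (simp add: connectedin_subtopology)
  then have "S \<subseteq> F"
    using x connected_imp_quasi_component_of unfolding F_def connected_component_of_def by fastforce
  have clS: "X closure_of S \<subseteq> C" using S(3) C(1) by (rule closure_of_minimal)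
  have SclS: "S \<subseteq> X closure_of S" using S(1) by (intro closure_of_subset) auto
  have clF: "X closure_of S \<subseteq> X closure_of F" using \<open>S \<subseteq> F\<close> by (rule closure_of_mono)
  have CS: "C = (X closure_of S) \<union> (C \<inter> P) \<union> (C \<inter> Q)"
    using clS SclS unfolding S_def by blast
  \<comment> \<open>Otherwise \<open>C \<inter> P\<close> is disjoint from the closed rest of
    \<open>C\<close>, and the two would split \<open>C\<close>; the same argument serves
    \<open>Q\<close>.\<close>
  have "(X closure_of F) \<inter> P \<noteq> {}"
  proof
    assume "(X closure_of F) \<inter> P = {}"
    then have "splits X P Q C"
      using cPQ clF clS CS PQ(3) by (intro splitsI[of X "C \<inter> P" "(X closure_of S) \<union> (C \<inter> Q)"]) auto
    with C(3) show False by simp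
  qed
  moreover have "(X closure_of F) \<inter> Q \<noteq> {}"
  proof
    assume "(X closure_of F) \<inter> Q = {}"
    then have "splits X P Q C"
      using cPQ clF clS CS PQ(3) by (intro splitsI[of X "(X closure_of S) \<union> (C \<inter> P)" "C \<inter> Q"]) auto
    with C(3) show False by simp
  qed
  ultimately have "F \<inter> A = {}" by (rule ness[OF F])
  with \<open>S \<subseteq> F\<close> S(2) x show False by blast
qed

section \<open>Primitives from a linear recurrence\<close>

lemma continuous_map_funpow: "continuous_map X X S \<Longrightarrow> continuous_map X X (S ^^ k)"
  by (induction k) (auto simp: continuous_map_compose id_def[symmetric])

lemma funpow_in_topspace: "continuous_map X X S \<Longrightarrow> x \<in> topspace X \<Longrightarrow> (S ^^ k) x \<in> topspace X"
  using continuous_map_funpow[of X S k] by (auto simp: continuous_map_def)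

lemma funpow_invariant: "S ` A \<subseteq> A \<Longrightarrow> x \<in> A \<Longrightarrow> (S ^^ k) x \<in> A"
  by (induction k) auto

text \<open>A point near \<open>P\<close> is compared with its retract:
  \<open>\<phi> (r x) x\<close> is a primitive, because \<open>\<phi>\<close> vanishes between
  nearby points of \<open>P\<close> and the retraction keeps points inside a common set on which
  \<open>\<phi>\<close> has a primitive.\<close>

lemma local_primitive_near_closed:
  fixes \<phi> :: "'b \<Rightarrow> 'b \<Rightarrow> 'k::field"
  assumes X: "compact_space X" "Hausdorff_space X" and P: "closedin X P" and phi: "\<phi> \<in> as_cocycles X P"
  obtains G u where "openin X G" "P \<subseteq> G" "\<And>x. x \<in> P \<Longrightarrow> u x = 0" "\<And>x. x \<in> G \<Longrightarrow> near X x (\<lambda>a b. \<phi> a b = u b - u a)"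
proof -
  have PX: "P \<subseteq> topspace X" using P by (rule closedin_subset)
  define \<O> where "\<O> = {V. (\<exists>w. \<forall>a\<in>V. \<forall>b\<in>V. \<phi> a b = w b - w a) \<and> (\<forall>a\<in>V \<inter> P. \<forall>b\<in>V \<inter> P. \<phi> a b = 0)}"
  have "\<exists>V\<in>\<O>. openin X V \<and> x \<in> V" if x: "x \<in> P" for x
  proof -
    have "\<exists>w. near X x (\<lambda>a b. \<phi> a b = w b - w a)"
      using phi x PX by (auto simp: as_cocycles_def)
    then obtain w where 1: "near X x (\<lambda>a b. \<phi> a b = w b - w a)" ..
    have "near X x (\<lambda>a b. \<phi> a b = w b - w a \<and> (a \<in> P \<and> b \<in> P \<longrightarrow> \<phi> a b = 0))"
      by (rule near_conj[OF 1 as_cocycles_rel[OF phi x]]) auto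
    then obtain V where V: "openin X V" "x \<in> V" "\<forall>a\<in>V. \<forall>b\<in>V. \<phi> a b = w b - w a \<and> (a \<in> P \<and> b \<in> P \<longrightarrow> \<phi> a b = 0)"
      unfolding near_def by auto
    have "V \<in> \<O>" unfolding \<O>_def
    proof (intro CollectI conjI exI[of _ w])
      show "\<forall>a\<in>V \<inter> P. \<forall>b\<in>V \<inter> P. \<phi> a b = 0" using V(3) by blast
    qed (use V(3) in auto)
    with V show ?thesis by auto
  qed
  from cover_retraction[OF X P this]
  obtain G r where G: "openin X G" "P \<subseteq> G" "r ` G \<subseteq> P" "\<And>x. x \<in> P \<Longrightarrow> r x = x"
    and loc: "\<And>y. y \<in> G \<Longrightarrow> \<exists>V. \<exists>O'\<in>\<O>. openin X V \<and> y \<in> V \<and> V \<subseteq> G \<and> V \<subseteq> O' \<and> r ` V \<subseteq> O'"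
    by blast
  show ?thesis
  proof
    show "openin X G" "P \<subseteq> G" using G by auto
    show "\<phi> (r x) x = 0" if "x \<in> P" for x
    proof -
      have "\<exists>w. near X x (\<lambda>a b. \<phi> a b = w b - w a)"
        using phi that PX by (auto simp: as_cocycles_def)
      then show ?thesis using G(4)[OF that] near_refl by fastforce
    qed
    show "near X x (\<lambda>a b. \<phi> a b = \<phi> (r b) b - \<phi> (r a) a)" if x: "x \<in> G" for x
    proof -
      obtain V O' where V: "O' \<in> \<O>" "openin X V" "x \<in> V" "V \<subseteq> G" "V \<subseteq> O'" "r ` V \<subseteq> O'"
        using loc[OF x] by blast
      have "\<exists>w. \<forall>a\<in>O'. \<forall>b\<in>O'. \<phi> a b = w b - w a" using V(1) by (simp add: \<O>_def)
      then obtain w where "\<forall>a\<in>O'. \<forall>b\<in>O'. \<phi> a b = w b - w a" ..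
      then have w: "\<phi> a b = w b - w a" if "a \<in> O'" "b \<in> O'" for a b using that by simp
      show ?thesis
      proof (rule nearI[OF V(2,3)])
        fix a b assume ab: "a \<in> V" "b \<in> V"
        have O': "a \<in> O'" "b \<in> O'" "r a \<in> O'" "r b \<in> O'" using ab V by auto
        have "r a \<in> P" "r b \<in> P" using ab V(4) G(3) by blast+
        then have "\<phi> (r a) (r b) = 0" using V(1) O' unfolding \<O>_def by blast
        then have "w (r b) = w (r a)" using w[OF O'(3,4)] by simp
        then show "\<phi> a b = \<phi> (r b) b - \<phi> (r a) a"
          using w[OF O'(1,2)] w[OF O'(4,2)] w[OF O'(3,1)] by simp
      qed
    qed
  qed
qed

lemma sum_lessThan_add:
  fixes f :: "nat \<Rightarrow> 'k::comm_monoid_add"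
  shows "(\<Sum>i<m + n. f i) = (\<Sum>i<m. f i) + (\<Sum>i<n. f (m + i))"
  by (induction n) (simp_all add: add.assoc)

lemma funpow_left_inverse:
  assumes "continuous_map X X S" "continuous_map X X S'" "\<And>x. x \<in> topspace X \<Longrightarrow> S (S' x) = x" "x \<in> topspace X"
  shows "(S ^^ (m + n)) ((S' ^^ m) x) = (S ^^ n) x"
  using assms(4)
proof (induction m arbitrary: x)
  case (Suc m)
  have "(S ^^ (Suc m + n)) ((S' ^^ Suc m) x) = (S ^^ (m + n)) (S (S' ((S' ^^ m) x)))"
    by (simp add: funpow_swap1)
  also have "\<dots> = (S ^^ (m + n)) ((S' ^^ m) x)"
    using assms(3) funpow_in_topspace[OF assms(2) Suc.prems] by simp
  finally show ?case using Suc by simp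
qed simp

text \<open>The first \<open>d\<close> pullbacks of \<open>\<phi>\<close> are dependent. Pulling the
  relation back by a power of the right inverse \<open>S'\<close> moves its lowest nonzero term to
  \<open>\<phi>\<close> itself, and division by that coefficient leaves only strictly later
  iterates.\<close>

lemma dep_bound_recurrence:
  fixes \<phi> :: "'b \<Rightarrow> 'b \<Rightarrow> 'k::field"
  assumes S: "continuous_map X X S" "continuous_map X X S'" "\<And>x. x \<in> topspace X \<Longrightarrow> S (S' x) = x"
    and A: "A \<subseteq> topspace X" "S ` A \<subseteq> A" "S' ` A \<subseteq> A"
    and d: "dep_bound (as_cocycles X A :: ('b \<Rightarrow> 'b \<Rightarrow> 'k) set) (as_coboundaries X A) d"
    and phi: "\<phi> \<in> as_cocycles X A"
  obtains n C g where "\<And>x. x \<in> A \<Longrightarrow> g x = 0"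
    "\<And>x. x \<in> topspace X \<Longrightarrow> near X x (\<lambda>a b. \<phi> a b =
       (\<Sum>k<n. C k * \<phi> ((S ^^ Suc k) a) ((S ^^ Suc k) b)) + (g b - g a))"
proof -
  have "(\<lambda>a b. \<phi> ((S ^^ i) a) ((S ^^ i) b)) \<in> as_cocycles X A" for i
    by (rule as_cocycles_pullback[OF continuous_map_funpow[OF S(1)] _ A(1) phi])
       (use funpow_invariant[OF A(2)] in auto)
  then have "\<exists>c. (\<exists>i<d. c i \<noteq> 0) \<and> (\<lambda>a b. \<Sum>i<d. c i * \<phi> ((S ^^ i) a) ((S ^^ i) b)) \<in> as_coboundaries X A"
    using d[unfolded dep_bound_def, rule_format, of "\<lambda>i a b. \<phi> ((S ^^ i) a) ((S ^^ i) b)"] by simp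
  then obtain c where c: "(\<exists>i<d. c i \<noteq> 0) \<and> (\<lambda>a b. \<Sum>i<d. c i * \<phi> ((S ^^ i) a) ((S ^^ i) b)) \<in> as_coboundaries X A"
    ..
  define m where "m = (LEAST i. c i \<noteq> 0)"
  obtain i where i: "i < d" "c i \<noteq> 0" using c by blast
  have m1: "c m \<noteq> 0" unfolding m_def by (rule LeastI[of "\<lambda>i. c i \<noteq> 0", OF i(2)])
  have "m \<le> i" unfolding m_def by (rule Least_le) (rule i(2))
  then have m2: "m < d" using i(1) by simp
  have m3: "c j = 0" if "j < m" for j
    using not_less_Least[of j "\<lambda>i. c i \<noteq> 0"] that unfolding m_def by blast
  note m = m1 m2 m3
  define n where "n = d - Suc m"
  have dn: "d = m + Suc n" using m(2) by (simp add: n_def)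
  have "(\<lambda>a b. (\<lambda>a b. \<Sum>i<d. c i * \<phi> ((S ^^ i) a) ((S ^^ i) b)) ((S' ^^ m) a) ((S' ^^ m) b)) \<in> as_coboundaries X A"
    by (rule as_coboundaries_pullback[OF continuous_map_funpow[OF S(2)], where A = A and B = A])
       (use funpow_invariant[OF A(3)] c in auto)
  then have "\<exists>u. (\<forall>x\<in>A. u x = 0) \<and> (\<forall>x\<in>topspace X. near X x
     (\<lambda>a b. (\<Sum>i<d. c i * \<phi> ((S ^^ i) ((S' ^^ m) a)) ((S ^^ i) ((S' ^^ m) b))) = u b - u a))"
    unfolding as_coboundaries_def mem_Collect_eq .
  then obtain u where "(\<forall>x\<in>A. u x = 0) \<and> (\<forall>x\<in>topspace X. near X x
     (\<lambda>a b. (\<Sum>i<d. c i * \<phi> ((S ^^ i) ((S' ^^ m) a)) ((S ^^ i) ((S' ^^ m) b))) = u b - u a))" ..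
  then have u0: "\<forall>x\<in>A. u x = 0" and u: "\<forall>x\<in>topspace X. near X x
     (\<lambda>a b. (\<Sum>i<d. c i * \<phi> ((S ^^ i) ((S' ^^ m) a)) ((S ^^ i) ((S' ^^ m) b))) = u b - u a)"
    by auto
  have eq: "(\<Sum>i<d. c i * \<phi> ((S ^^ i) ((S' ^^ m) a)) ((S ^^ i) ((S' ^^ m) b)))
      = c m * \<phi> a b + (\<Sum>k<n. c (m + Suc k) * \<phi> ((S ^^ Suc k) a) ((S ^^ Suc k) b))"
    if "a \<in> topspace X" "b \<in> topspace X" for a b
  proof -
    have fl: "(S ^^ (m + k)) ((S' ^^ m) x) = (S ^^ k) x" if "x \<in> topspace X" for x k
      by (rule funpow_left_inverse[OF S(1,2) _ that]) (use S(3) in auto)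
    have "(\<Sum>i<d. c i * \<phi> ((S ^^ i) ((S' ^^ m) a)) ((S ^^ i) ((S' ^^ m) b)))
       = (\<Sum>k<Suc n. c (m + k) * \<phi> ((S ^^ (m + k)) ((S' ^^ m) a)) ((S ^^ (m + k)) ((S' ^^ m) b)))"
      unfolding dn sum_lessThan_add using m(3) by simp
    also have "\<dots> = (\<Sum>k<Suc n. c (m + k) * \<phi> ((S ^^ k) a) ((S ^^ k) b))"
      by (simp only: fl[OF that(1)] fl[OF that(2)])
    also have "\<dots> = c m * \<phi> a b + (\<Sum>k<n. c (m + Suc k) * \<phi> ((S ^^ Suc k) a) ((S ^^ Suc k) b))"
      unfolding sum.lessThan_Suc_shift by simp
    finally show ?thesis .
  qed
  show ?thesis
  proof
    show "u x / c m = 0" if "x \<in> A" for x using u0 that by simp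
    show "near X x (\<lambda>a b. \<phi> a b = (\<Sum>k<n. (- c (m + Suc k) / c m) * \<phi> ((S ^^ Suc k) a) ((S ^^ Suc k) b)) + (u b / c m - u a / c m))"
      if x: "x \<in> topspace X" for x
    proof (rule near_mono[OF u[rule_format, OF x]])
      fix a b assume ab: "a \<in> topspace X" "b \<in> topspace X"
        and *: "(\<Sum>i<d. c i * \<phi> ((S ^^ i) ((S' ^^ m) a)) ((S ^^ i) ((S' ^^ m) b))) = u b - u a"
      let ?s = "\<Sum>k<n. c (m + Suc k) * \<phi> ((S ^^ Suc k) a) ((S ^^ Suc k) b)"
      have "c m * \<phi> a b + ?s = u b - u a" using eq[OF ab] * by simp
      then have "c m * \<phi> a b = (u b - u a) - ?s" by (simp add: eq_diff_eq)
      then have "\<phi> a b = ((u b - u a) - ?s) / c m" using m(1) by (simp add: eq_divide_eq mult.commute)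
      moreover have "(\<Sum>k<n. (- c (m + Suc k) / c m) * \<phi> ((S ^^ Suc k) a) ((S ^^ Suc k) b)) = - (?s / c m)"
        by (simp add: sum_divide_distrib sum_negf)
      ultimately show "\<phi> a b = (\<Sum>k<n. (- c (m + Suc k) / c m) * \<phi> ((S ^^ Suc k) a) ((S ^^ Suc k) b)) + (u b / c m - u a / c m)"
        by (simp only: diff_divide_distrib) simp
    qed
  qed
qed

text \<open>The recurrence expresses \<open>\<phi>\<close> through its pullbacks along high iterates of \<open>S\<close>, which
  vanish on any given compact set away from \<open>Q\<close>; the accumulated corrections form a locally
  finite sum.\<close>

lemma primitive_of_recurrence:
  fixes \<phi> :: "'b \<Rightarrow> 'b \<Rightarrow> 'k::field"
  assumes X: "compact_space X" "Hausdorff_space X" and P: "closedin X P"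
    and S: "continuous_map X X S" "S ` P \<subseteq> P"
    and attr: "\<And>G x. openin X G \<Longrightarrow> P \<subseteq> G \<Longrightarrow> x \<in> topspace X - Q \<Longrightarrow>
       \<exists>B n. openin X B \<and> x \<in> B \<and> (\<forall>j\<ge>n. (S ^^ j) ` B \<subseteq> G)"
    and phi: "\<phi> \<in> as_cocycles X P"
    and g0: "\<And>x. x \<in> P \<Longrightarrow> g x = 0"
    and rec: "\<And>x. x \<in> topspace X \<Longrightarrow> near X x (\<lambda>a b. \<phi> a b =
       (\<Sum>k<n. C k * \<phi> ((S ^^ Suc k) a) ((S ^^ Suc k) b)) + (g b - g a))"
  shows "\<exists>u. (\<forall>x\<in>P. u x = 0) \<and> (\<forall>x\<in>topspace X - Q. near X x (\<lambda>a b. \<phi> a b = u b - u a))"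
proof -
  have PX: "P \<subseteq> topspace X" using P by (rule closedin_subset)
  note top = funpow_in_topspace[OF S(1)]
  note pull = near_pullback[OF continuous_map_funpow[OF S(1)]]
  obtain G u where G: "openin X G" "P \<subseteq> G" and u0: "\<And>x. x \<in> P \<Longrightarrow> u x = 0"
    and u: "\<And>x. x \<in> G \<Longrightarrow> near X x (\<lambda>a b. \<phi> a b = u b - u a)"
    using local_primitive_near_closed[OF X P phi] by blast
  \<comment> \<open>Subtracting a primitive found near \<open>P\<close> makes the cocycle vanish
    there. Under this change the correction term \<open>g\<close> of the recurrence becomes
    \<open>h\<close>; \<open>Pf\<close> and \<open>PP\<close> are the operators of the recurrence on
    functions and on two-point functions.\<close>
  define \<psi> where "\<psi> a b = \<phi> a b - (u b - u a)" for a b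
  define h where "h x = g x - u x + (\<Sum>k<n. C k * u ((S ^^ Suc k) x))" for x
  define Pf where "Pf f x = (\<Sum>k<n. C k * f ((S ^^ Suc k) x))" for f :: "'b \<Rightarrow> 'k" and x
  define PP where "PP f a b = (\<Sum>k<n. C k * f ((S ^^ Suc k) a) ((S ^^ Suc k) b))" for f :: "'b \<Rightarrow> 'b \<Rightarrow> 'k" and a b
  have psi_rec: "near X x (\<lambda>a b. \<psi> a b = PP \<psi> a b + (h b - h a))" if "x \<in> topspace X" for x
    by (rule near_mono[OF rec[OF that]])
       (simp add: \<psi>_def h_def PP_def right_diff_distrib sum_subtractf)
  have psi0: "near X x (\<lambda>a b. \<psi> a b = 0)" if "x \<in> G" for x
    by (rule near_mono[OF u[OF that]]) (simp add: \<psi>_def)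
  have h0: "h x = 0" if "x \<in> P" for x
    using g0[OF that] u0[OF that] u0[OF funpow_invariant[OF S(2) that]]
    unfolding h_def by (simp del: funpow.simps)
  \<comment> \<open>Near \<open>P\<close> both \<open>\<psi>\<close> and the terms of
    \<open>PP \<psi>\<close> vanish, so the recurrence leaves \<open>h\<close> locally constant,
    with the value 0 that it has on \<open>P\<close>.\<close>
  have hP: "near X x (\<lambda>a b. h a = 0)" if x: "x \<in> P" for x
  proof -
    have xX: "x \<in> topspace X" using x PX by auto
    have 1: "near X x (\<lambda>a b. \<forall>k\<in>{..<n}. \<psi> ((S ^^ Suc k) a) ((S ^^ Suc k) b) = 0)"
    proof (rule near_ball[OF _ xX])
      fix k assume "k \<in> {..<n}"
      show "near X x (\<lambda>a b. \<psi> ((S ^^ Suc k) a) ((S ^^ Suc k) b) = 0)"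
        by (rule pull[OF xX psi0]) (use funpow_invariant[OF S(2) x] G(2) in blast)
    qed simp
    have 2: "near X x (\<lambda>a b. \<psi> a b = 0)" using psi0 x G(2) by auto
    have 3: "near X x (\<lambda>a b. \<psi> a b = h b - h a)"
      by (rule near_conj[OF 1 psi_rec[OF xX]]) (simp add: PP_def)
    have "near X x (\<lambda>a b. h a = h b)"
      by (rule near_conj[OF 2 3]) simp
    then obtain V where V: "openin X V" "x \<in> V" "\<And>a b. a \<in> V \<Longrightarrow> b \<in> V \<Longrightarrow> h a = h b"
      unfolding near_def by auto
    show ?thesis
      by (rule nearI[OF V(1,2)]) (use V(3)[OF _ V(2)] h0[OF x] in auto)
  qed
  define G1 where "G1 = G \<inter> \<Union>{V. openin X V \<and> (\<forall>a\<in>V. h a = 0)}"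
  have G1: "openin X G1" unfolding G1_def using G by (intro openin_Int openin_Union) auto
  have "P \<subseteq> G1"
    using G(2) hP unfolding G1_def near_def by fastforce
  have hG1: "h x = 0" if "x \<in> G1" for x using that by (auto simp: G1_def)
  \<comment> \<open>Each \<open>PP\<close> moves at least one step along \<open>S\<close>, so
    \<open>m\<close> applications see only iterates from \<open>m\<close> on; once these stay in
    \<open>G1\<close>, nothing remains.\<close>
  have a: "near X x (\<lambda>a b. (PP ^^ m) \<psi> a b = 0)" if "x \<in> topspace X" "\<forall>j\<ge>m. (S ^^ j) x \<in> G1" for m x
    using that
  proof (induction m arbitrary: x)
    case 0
    then have "x \<in> G" by (auto simp: G1_def dest: spec[of _ 0])
    then show ?case using psi0 by simp
  next
    case (Suc m)
    have "near X x (\<lambda>a b. \<forall>k\<in>{..<n}. (PP ^^ m) \<psi> ((S ^^ Suc k) a) ((S ^^ Suc k) b) = 0)"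
    proof (rule near_ball)
      fix k assume "k \<in> {..<n}"
      have "(S ^^ j) ((S ^^ Suc k) x) \<in> G1" if "j \<ge> m" for j
      proof -
        have "(S ^^ (j + Suc k)) x \<in> G1"
          by (rule Suc.prems(2)[rule_format]) (use that in simp)
        then show ?thesis by (simp only: funpow_add o_apply)
      qed
      then show "near X x (\<lambda>a b. (PP ^^ m) \<psi> ((S ^^ Suc k) a) ((S ^^ Suc k) b) = 0)"
        by (intro pull[OF Suc.prems(1) Suc.IH]) (use top Suc.prems(1) in blast)+
    qed (use Suc.prems in auto)
    then show ?case
      by (rule near_mono) (simp add: PP_def[of "(PP ^^ m) \<psi>"])
  qed
  have b: "(Pf ^^ m) h x = 0" if "\<forall>j\<ge>m. (S ^^ j) x \<in> G1" for m x
    using that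
  proof (induction m arbitrary: x)
    case 0
    then show ?case using hG1 by (auto dest: spec[of _ 0])
  next
    case (Suc m)
    have "(Pf ^^ m) h ((S ^^ Suc k) x) = 0" for k
    proof (rule Suc.IH, intro allI impI)
      fix j assume "j \<ge> m"
      then have "(S ^^ (j + Suc k)) x \<in> G1"
        by (intro Suc.prems[rule_format]) simp
      then show "(S ^^ j) ((S ^^ Suc k) x) \<in> G1" by (simp only: funpow_add o_apply)
    qed
    then show ?case by (simp add: Pf_def[of "(Pf ^^ m) h"])
  qed
  \<comment> \<open>A partial sum of the Neumann series of \<open>Pf\<close> at \<open>h\<close>:
    unrolling the recurrence \<open>m\<close> times writes \<open>\<psi>\<close> as
    \<open>(PP ^^ m) \<psi>\<close> plus the coboundary of \<open>H m\<close>.\<close>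
  define H where "H m x = (\<Sum>i<m. (Pf ^^ i) h x)" for m x
  have Pf_H: "Pf (H m) x + h x = H (Suc m) x" for m x
  proof -
    have "Pf (H m) x = (\<Sum>k<n. \<Sum>i<m. C k * (Pf ^^ i) h ((S ^^ Suc k) x))"
      by (simp add: Pf_def[of "H m"] H_def sum_distrib_left)
    also have "\<dots> = (\<Sum>i<m. \<Sum>k<n. C k * (Pf ^^ i) h ((S ^^ Suc k) x))"
      by (rule sum.swap)
    also have "\<dots> = (\<Sum>i<m. (Pf ^^ Suc i) h x)"
      by (simp add: Pf_def[of "(Pf ^^ _) h"])
    finally show ?thesis
      unfolding H_def sum.lessThan_Suc_shift by (simp add: add.commute)
  qed
  have c: "near X x (\<lambda>a b. \<psi> a b = (PP ^^ m) \<psi> a b + (H m b - H m a))" if "x \<in> topspace X" for m x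
    using that
  proof (induction m arbitrary: x)
    case 0
    then show ?case by (simp add: H_def near_always)
  next
    case (Suc m)
    have 1: "near X x (\<lambda>a b. \<forall>k\<in>{..<n}. \<psi> ((S ^^ Suc k) a) ((S ^^ Suc k) b) =
        (PP ^^ m) \<psi> ((S ^^ Suc k) a) ((S ^^ Suc k) b) + (H m ((S ^^ Suc k) b) - H m ((S ^^ Suc k) a)))"
      by (rule near_ball[OF finite_lessThan Suc.prems]) (rule pull[OF Suc.prems Suc.IH[OF top[OF Suc.prems]]])
    have "PP \<psi> a b = PP ((PP ^^ m) \<psi>) a b + (Pf (H m) b - Pf (H m) a)"
      if "\<forall>k\<in>{..<n}. \<psi> ((S ^^ Suc k) a) ((S ^^ Suc k) b) =
        (PP ^^ m) \<psi> ((S ^^ Suc k) a) ((S ^^ Suc k) b) + (H m ((S ^^ Suc k) b) - H m ((S ^^ Suc k) a))" for a b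
    proof -
      have "PP \<psi> a b = (\<Sum>k<n. C k * ((PP ^^ m) \<psi> ((S ^^ Suc k) a) ((S ^^ Suc k) b) + (H m ((S ^^ Suc k) b) - H m ((S ^^ Suc k) a))))"
        unfolding PP_def[of \<psi>] by (rule sum.cong[OF refl]) (use that in auto)
      then show ?thesis
        unfolding PP_def[of "(PP ^^ m) \<psi>"] Pf_def
        by (simp only: distrib_left right_diff_distrib sum.distrib sum_subtractf)
    qed
    then have 2: "near X x (\<lambda>a b. PP \<psi> a b = PP ((PP ^^ m) \<psi>) a b + (Pf (H m) b - Pf (H m) a))"
      by (rule near_mono[OF 1])
    show ?case
      by (rule near_conj[OF 2 psi_rec[OF Suc.prems]]) (simp add: Pf_H[symmetric])
  qed
  \<comment> \<open>The cut-off \<open>N\<close> need not be locally constant, but beyond it the sum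
    no longer changes, so on the neighbourhood supplied by attraction \<open>H (N x) x\<close>
    agrees with one fixed \<open>H m\<close>.\<close>
  define N where "N x = (LEAST m. \<forall>j\<ge>m. (S ^^ j) x \<in> G1)" for x
  have HN: "H (N x) x = H m x" if "\<forall>j\<ge>m. (S ^^ j) x \<in> G1" for m x
  proof -
    have Nm: "N x \<le> m" unfolding N_def by (rule Least_le) (rule that)
    have Nx: "\<forall>j\<ge>N x. (S ^^ j) x \<in> G1" unfolding N_def by (rule LeastI) (rule that)
    have "(\<Sum>i<m. (Pf ^^ i) h x) = (\<Sum>i<N x. (Pf ^^ i) h x)"
    proof (rule sum.mono_neutral_right)
      show "\<forall>i\<in>{..<m} - {..<N x}. (Pf ^^ i) h x = 0"
        using Nx b by auto
    qed (use Nm in auto)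
    then show ?thesis by (simp add: H_def)
  qed
  have fin: "near X x (\<lambda>a b. \<psi> a b = H (N b) b - H (N a) a)" if x: "x \<in> topspace X - Q" for x
  proof -
    obtain B m where B: "openin X B" "x \<in> B" "\<forall>j\<ge>m. (S ^^ j) ` B \<subseteq> G1"
      using attr[OF G1 \<open>P \<subseteq> G1\<close> x] by blast
    have xX: "x \<in> topspace X" using x by simp
    have 1: "near X x (\<lambda>a b. (PP ^^ m) \<psi> a b = 0)"
      by (rule a[OF xX]) (use B in blast)
    have 2: "near X x (\<lambda>a b. \<psi> a b = H m b - H m a)"
      by (rule near_conj[OF 1 c[OF xX, of m]]) simp
    show ?thesis
    proof (rule near_conj[OF 2 near_open[OF B(1,2)]])
      fix y z assume "\<psi> y z = H m z - H m y" "y \<in> B \<and> z \<in> B"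
      then show "\<psi> y z = H (N z) z - H (N y) y"
        using HN[of m y] HN[of m z] B(3) by (simp add: image_subset_iff)
    qed
  qed
  have "near X x (\<lambda>a b. \<phi> a b = (u b + H (N b) b) - (u a + H (N a) a))" if "x \<in> topspace X - Q" for x
    by (rule near_mono[OF fin[OF that]]) (simp add: \<psi>_def diff_eq_eq)
  moreover have "u x + H (N x) x = 0" if "x \<in> P" for x
  proof -
    have "\<forall>j\<ge>0. (S ^^ j) x \<in> G1" using funpow_invariant[OF S(2) that] \<open>P \<subseteq> G1\<close> by blast
    from HN[OF this] show ?thesis using u0[OF that] by (simp add: H_def)
  qed
  ultimately show ?thesis
    by (intro exI[of _ "\<lambda>x. u x + H (N x) x"]) auto
qed

section \<open>Attractor-repeller pairs\<close>

definition locally_constant_on :: "'b topology \<Rightarrow> 'b set \<Rightarrow> ('b \<Rightarrow> 'k) \<Rightarrow> bool" where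
  "locally_constant_on X S f \<longleftrightarrow> (\<forall>x\<in>S. near X x (\<lambda>a b. f a = f b))"

lemma locally_constant_on_clopen:
  assumes f: "locally_constant_on X S f" and S: "openin X S"
  shows "openin (subtopology X S) {x \<in> S. f x \<in> K}" "closedin (subtopology X S) {x \<in> S. f x \<in> K}"
proof -
  have op: "openin X {x \<in> S. f x \<in> K}" for K
  proof (subst openin_subopen, intro ballI)
    fix x assume x: "x \<in> {x \<in> S. f x \<in> K}"
    have "near X x (\<lambda>a b. f a = f b)" using f x by (auto simp: locally_constant_on_def)
    then obtain V where V: "openin X V" "x \<in> V" "\<And>a b. a \<in> V \<Longrightarrow> b \<in> V \<Longrightarrow> f a = f b"
      unfolding near_def by auto
    show "\<exists>T. openin X T \<and> x \<in> T \<and> T \<subseteq> {x \<in> S. f x \<in> K}"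
    proof (intro exI conjI)
      show "openin X (V \<inter> S)" using V(1) S by (rule openin_Int)
      show "x \<in> V \<inter> S" using V(2) x by simp
      show "V \<inter> S \<subseteq> {x \<in> S. f x \<in> K}"
      proof
        fix y assume y: "y \<in> V \<inter> S"
        then have "f y = f x" by (intro V(3)) (use V(2) in auto)
        then show "y \<in> {x \<in> S. f x \<in> K}" using x y by simp
      qed
    qed
  qed
  show "openin (subtopology X S) {x \<in> S. f x \<in> K}"
    using op[of K] S by (simp add: openin_open_subtopology)
  have "openin (subtopology X S) {x \<in> S. f x \<in> - K}"
    using op[of "- K"] S by (simp add: openin_open_subtopology)
  then show "closedin (subtopology X S) {x \<in> S. f x \<in> K}"
  proof -
    have "topspace (subtopology X S) = S" using openin_subset[OF S] by auto
    moreover have "S - {x \<in> S. f x \<in> K} = {x \<in> S. f x \<in> - K}" by auto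
    ultimately show ?thesis
      unfolding closedin_def using \<open>openin (subtopology X S) {x \<in> S. f x \<in> - K}\<close> by auto
  qed
qed

text \<open>Level sets are clopen, and points of one quasicomponent lie in the same clopen
  sets.\<close>

lemma locally_constant_on_quasi_component:
  assumes f: "locally_constant_on X S f" and S: "openin X S"
    and F: "F \<in> quasi_components_of (subtopology X S)" "x \<in> F" "y \<in> F"
  shows "f x = f y"
proof -
  obtain z where z: "F = quasi_component_of_set (subtopology X S) z"
    using F(1) by (auto simp: quasi_components_of_def)
  then have "quasi_component_of (subtopology X S) x y"
    using F(2,3) by (metis mem_Collect_eq quasi_component_of_sym quasi_component_of_trans)
  then have q: "x \<in> topspace (subtopology X S)"
      "\<And>K. closedin (subtopology X S) K \<Longrightarrow> openin (subtopology X S) K \<Longrightarrow> x \<in> K \<longleftrightarrow> y \<in> K"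
    by (auto simp: quasi_component_of_def)
  have "x \<in> {x' \<in> S. f x' \<in> {f x}} \<longleftrightarrow> y \<in> {x' \<in> S. f x' \<in> {f x}}"
    by (rule q(2)) (rule locally_constant_on_clopen[OF f S])+
  then show ?thesis using q(1) by auto
qed

text \<open>The dynamics in abstract form, with \<open>P\<close> as repeller and \<open>Q\<close> as
  attractor of \<open>T\<close>. Attraction is demanded of a whole neighbourhood \<open>B\<close>
  from a common time on, since the sum of corrections has to be locally finite.\<close>

locale attractor_repeller =
  fixes W :: "'b topology" and P Q :: "'b set" and T T' :: "'b \<Rightarrow> 'b"
  assumes compact: "compact_space W" and Hausdorff: "Hausdorff_space W"
    and closed_P: "closedin W P" and closed_Q: "closedin W Q" and disjoint: "P \<inter> Q = {}"
    and cont: "continuous_map W W T" and cont': "continuous_map W W T'"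
    and inv: "x \<in> topspace W \<Longrightarrow> T (T' x) = x" and inv': "x \<in> topspace W \<Longrightarrow> T' (T x) = x"
    and invar_P: "x \<in> topspace W \<Longrightarrow> T x \<in> P \<longleftrightarrow> x \<in> P"
    and invar_Q: "x \<in> topspace W \<Longrightarrow> T x \<in> Q \<longleftrightarrow> x \<in> Q"
    and attract_P: "openin W G \<Longrightarrow> P \<subseteq> G \<Longrightarrow> x \<in> topspace W - Q \<Longrightarrow>
       \<exists>B n. openin W B \<and> x \<in> B \<and> (\<forall>j\<ge>n. (T' ^^ j) ` B \<subseteq> G)"
    and attract_Q: "openin W G \<Longrightarrow> Q \<subseteq> G \<Longrightarrow> x \<in> topspace W - P \<Longrightarrow>
       \<exists>B n. openin W B \<and> x \<in> B \<and> (\<forall>j\<ge>n. (T ^^ j) ` B \<subseteq> G)"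
begin

abbreviation "Z \<equiv> P \<union> Q"
abbreviation "U \<equiv> topspace W - Z"

definition E :: "'b set set" where
  "E = {F \<in> quasi_components_of (subtopology W U). (W closure_of F) \<inter> P \<noteq> {} \<and> (W closure_of F) \<inter> Q \<noteq> {}}"

lemma PW: "P \<subseteq> topspace W" and QW: "Q \<subseteq> topspace W" and ZW: "Z \<subseteq> topspace W"
  using closed_P closed_Q closedin_subset by blast+

lemma open_U: "openin W U"
  using closed_P closed_Q by blast

lemma TW: "x \<in> topspace W \<Longrightarrow> T x \<in> topspace W" and T'W: "x \<in> topspace W \<Longrightarrow> T' x \<in> topspace W"
  using cont cont' by (auto simp: continuous_map_def)

lemma T_image: "T ` P \<subseteq> P" "T ` Q \<subseteq> Q" "T ` Z \<subseteq> Z"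
  using invar_P invar_Q PW QW by blast+

lemma T'_image: "T' ` P \<subseteq> P" "T' ` Q \<subseteq> Q" "T' ` Z \<subseteq> Z"
proof -
  have "T' x \<in> P" if "x \<in> P" for x using invar_P[of "T' x"] inv[of x] T'W[of x] that PW by auto
  moreover have "T' x \<in> Q" if "x \<in> Q" for x using invar_Q[of "T' x"] inv[of x] T'W[of x] that QW by auto
  ultimately show "T' ` P \<subseteq> P" "T' ` Q \<subseteq> Q" "T' ` Z \<subseteq> Z" by auto
qed

lemma E_subset: "F \<in> E \<Longrightarrow> F \<subseteq> U"
  unfolding E_def using quasi_components_of_subset by fastforce

lemma E_nonempty: "F \<in> E \<Longrightarrow> F \<noteq> {}"
  unfolding E_def using nonempty_quasi_components_of by fastforce

text \<open>\<open>u\<close> is the jump between the primitive of \<open>\<phi>\<close> normalised on \<open>Q\<close> and the one normalised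
  on \<open>P\<close>.\<close>

definition jump :: "('b \<Rightarrow> 'b \<Rightarrow> 'k::field) \<Rightarrow> ('b \<Rightarrow> 'k) \<Rightarrow> bool" where
  "jump \<phi> u \<longleftrightarrow> (\<exists>v w.
     ((\<forall>x\<in>Q. v x = 0) \<and> (\<forall>x\<in>topspace W - P. near W x (\<lambda>a b. \<phi> a b = v b - v a))) \<and>
     ((\<forall>x\<in>P. w x = 0) \<and> (\<forall>x\<in>topspace W - Q. near W x (\<lambda>a b. \<phi> a b = w b - w a))) \<and>
     (\<forall>x\<in>U. u x = v x - w x))"

lemma jumpE:
  assumes "jump \<phi> u"
  obtains v w where "\<forall>x\<in>Q. v x = 0" "\<forall>x\<in>topspace W - P. near W x (\<lambda>a b. \<phi> a b = v b - v a)"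
     "\<forall>x\<in>P. w x = 0" "\<forall>x\<in>topspace W - Q. near W x (\<lambda>a b. \<phi> a b = w b - w a)"
     "\<forall>x\<in>U. u x = v x - w x"
  using assms unfolding jump_def by (elim exE conjE) (rule that)

lemma jumpI:
  assumes "\<forall>x\<in>Q. v x = 0" "\<forall>x\<in>topspace W - P. near W x (\<lambda>a b. \<phi> a b = v b - v a)"
     "\<forall>x\<in>P. w x = 0" "\<forall>x\<in>topspace W - Q. near W x (\<lambda>a b. \<phi> a b = w b - w a)"
     "\<forall>x\<in>U. u x = v x - w x"
  shows "jump \<phi> u"
  unfolding jump_def by (rule exI[of _ v], rule exI[of _ w]) (intro conjI assms)

lemma jump_exists:
  fixes \<phi> :: "'b \<Rightarrow> 'b \<Rightarrow> 'k::field"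
  assumes d: "dep_bound (as_cocycles W Z :: ('b \<Rightarrow> 'b \<Rightarrow> 'k) set) (as_coboundaries W Z) d"
    and phi: "\<phi> \<in> as_cocycles W Z"
  shows "\<exists>u. jump \<phi> u"
proof -
  have phi': "\<phi> \<in> as_cocycles W P" "\<phi> \<in> as_cocycles W Q"
    using as_cocycles_pullback[of W W id P Z \<phi>] as_cocycles_pullback[of W W id Q Z \<phi>] PW QW phi by auto
  obtain n C g where g: "\<And>x. x \<in> Z \<Longrightarrow> g x = 0" and
    rec: "\<And>x. x \<in> topspace W \<Longrightarrow> near W x (\<lambda>a b. \<phi> a b =
       (\<Sum>k<n. C k * \<phi> ((T ^^ Suc k) a) ((T ^^ Suc k) b)) + (g b - g a))"
    by (rule dep_bound_recurrence[OF cont cont' inv ZW T_image(3) T'_image(3) d phi]) auto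
  have "\<exists>v. (\<forall>x\<in>Q. v x = 0) \<and> (\<forall>x\<in>topspace W - P. near W x (\<lambda>a b. \<phi> a b = v b - v a))"
    by (rule primitive_of_recurrence[OF compact Hausdorff closed_Q cont T_image(2) attract_Q phi'(2) _ rec])
       (use g in auto)
  then obtain v where v: "(\<forall>x\<in>Q. v x = 0) \<and> (\<forall>x\<in>topspace W - P. near W x (\<lambda>a b. \<phi> a b = v b - v a))" ..
  \<comment> \<open>Reversing time exchanges the roles: the recurrence along \<open>T'\<close> gives
    the primitive normalised on \<open>P\<close>.\<close>
  obtain n C g where g: "\<And>x. x \<in> Z \<Longrightarrow> g x = 0" and
    rec: "\<And>x. x \<in> topspace W \<Longrightarrow> near W x (\<lambda>a b. \<phi> a b =
       (\<Sum>k<n. C k * \<phi> ((T' ^^ Suc k) a) ((T' ^^ Suc k) b)) + (g b - g a))"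
    by (rule dep_bound_recurrence[OF cont' cont inv' ZW T'_image(3) T_image(3) d phi]) auto
  have "\<exists>w. (\<forall>x\<in>P. w x = 0) \<and> (\<forall>x\<in>topspace W - Q. near W x (\<lambda>a b. \<phi> a b = w b - w a))"
    by (rule primitive_of_recurrence[OF compact Hausdorff closed_P cont' T'_image(1) attract_P phi'(1) _ rec])
       (use g in auto)
  then obtain w where w: "(\<forall>x\<in>P. w x = 0) \<and> (\<forall>x\<in>topspace W - Q. near W x (\<lambda>a b. \<phi> a b = w b - w a))" ..
  have "jump \<phi> (\<lambda>x. v x - w x)"
    by (rule jumpI[of v _ w]) (use v w in auto)
  then show ?thesis by (intro exI[of _ "\<lambda>x. v x - w x"])
qed

lemma jump_locally_constant:
  assumes "jump \<phi> u" shows "locally_constant_on W U u"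
proof -
  obtain v w where 1: "\<forall>x\<in>topspace W - P. near W x (\<lambda>a b. \<phi> a b = v b - v a)"
    and 2: "\<forall>x\<in>topspace W - Q. near W x (\<lambda>a b. \<phi> a b = w b - w a)" and u: "\<forall>x\<in>U. u x = v x - w x"
    using assms by (rule jumpE)
  show ?thesis
    unfolding locally_constant_on_def
  proof
    fix x assume x: "x \<in> U"
    have x1: "x \<in> topspace W - P" and x2: "x \<in> topspace W - Q" using x by auto
    have 3: "near W x (\<lambda>a b. v b - v a = w b - w a)"
      by (rule near_conj[OF 1[rule_format, OF x1] 2[rule_format, OF x2]]) simp
    show "near W x (\<lambda>a b. u a = u b)"
    proof (rule near_conj[OF 3 near_open[OF open_U x]])
      fix a b assume *: "v b - v a = w b - w a" "a \<in> U \<and> b \<in> U"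
      have "v b = w b - w a + v a" using *(1) by (simp add: diff_eq_eq)
      then show "u a = u b" using u * by simp
    qed
  qed
qed

lemma jump_const:
  assumes "jump \<phi> u" "F \<in> E" "x \<in> F" "y \<in> F"
  shows "u x = u y"
  using locally_constant_on_quasi_component[OF jump_locally_constant[OF assms(1)] open_U] assms
  by (auto simp: E_def)

text \<open>A closure point of \<open>F\<close> in \<open>R\<close> has a neighbourhood on which
  \<open>f\<close> is 0; it meets \<open>F\<close>, and \<open>f\<close> is constant on the
  quasicomponent \<open>F\<close>.\<close>

lemma zero_on_essential:
  assumes R: "R \<subseteq> topspace W" "closedin W R'" "locally_constant_on W (topspace W - R') f" "R' \<subseteq> Z" "R \<inter> R' = {}"
    and f0: "\<forall>x\<in>R. f x = 0" and F: "F \<in> E" "(W closure_of F) \<inter> R \<noteq> {}" and x: "x \<in> F"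
  shows "f x = 0"
proof -
  obtain z where z: "z \<in> R" "z \<in> W closure_of F" using F(2) by blast
  have "near W z (\<lambda>a b. f a = f b)"
    using R z by (auto simp: locally_constant_on_def)
  then obtain V where V: "openin W V" "z \<in> V" "\<And>a b. a \<in> V \<Longrightarrow> b \<in> V \<Longrightarrow> f a = f b"
    unfolding near_def by auto
  obtain y where y: "y \<in> F" "y \<in> V" using z(2) V(1,2) unfolding in_closure_of by blast
  have "locally_constant_on W U f"
    using R(3,4) unfolding locally_constant_on_def by blast
  then have "f x = f y"
    using locally_constant_on_quasi_component[OF _ open_U] F(1) x y(1) by (auto simp: E_def)
  then show ?thesis using V(3)[OF y(2) V(2)] f0 z(1) by simp
qed

text \<open>Two primitives off \<open>P\<close> differ by a locally constant function that is 0 on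
  \<open>Q\<close>, hence 0 on essential quasicomponents; likewise with \<open>P\<close> and
  \<open>Q\<close> exchanged. This is where accumulation at both sets enters.\<close>

lemma jump_unique:
  fixes \<phi> :: "'b \<Rightarrow> 'b \<Rightarrow> 'k::field"
  assumes "jump \<phi> u" "jump \<phi> u'" "F \<in> E" "x \<in> F"
  shows "u x = u' x"
proof -
  obtain v w where 1: "\<forall>x\<in>Q. v x = 0" "\<forall>x\<in>topspace W - P. near W x (\<lambda>a b. \<phi> a b = v b - v a)"
     "\<forall>x\<in>P. w x = 0" "\<forall>x\<in>topspace W - Q. near W x (\<lambda>a b. \<phi> a b = w b - w a)"
     "\<forall>x\<in>U. u x = v x - w x"
    using assms(1) by (rule jumpE)
  obtain v' w' where 2: "\<forall>x\<in>Q. v' x = 0" "\<forall>x\<in>topspace W - P. near W x (\<lambda>a b. \<phi> a b = v' b - v' a)"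
     "\<forall>x\<in>P. w' x = 0" "\<forall>x\<in>topspace W - Q. near W x (\<lambda>a b. \<phi> a b = w' b - w' a)"
     "\<forall>x\<in>U. u' x = v' x - w' x"
    using assms(2) by (rule jumpE)
  have diff: "s a - t a = s b - t b" if "s b - s a = t b - t a" for s t :: "'b \<Rightarrow> 'k" and a b
  proof -
    have "s b = t b - t a + s a" using that by (simp add: diff_eq_eq)
    then show ?thesis by simp
  qed
  have "locally_constant_on W (topspace W - P) (\<lambda>x. v x - v' x)"
    unfolding locally_constant_on_def
    by (intro ballI near_conj[OF 1(2)[rule_format] 2(2)[rule_format]]) (auto intro!: diff)
  then have "v x - v' x = 0"
    by (rule zero_on_essential[OF QW closed_P]) (use disjoint 1(1) 2(1) assms(3,4) in \<open>auto simp: E_def\<close>)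
  moreover have "locally_constant_on W (topspace W - Q) (\<lambda>x. w x - w' x)"
    unfolding locally_constant_on_def
    by (intro ballI near_conj[OF 1(4)[rule_format] 2(4)[rule_format]]) (auto intro!: diff)
  then have "w x - w' x = 0"
    by (rule zero_on_essential[OF PW closed_Q]) (use disjoint 1(3) 2(3) assms(3,4) in \<open>auto simp: E_def\<close>)
  moreover have "x \<in> U" using E_subset[OF assms(3)] assms(4) by blast
  ultimately show ?thesis
    using 1(5) 2(5) by simp
qed

lemma jump_coboundary:
  assumes "\<phi> \<in> as_coboundaries W Z" shows "jump \<phi> (\<lambda>_. 0)"
proof -
  have "\<exists>u. (\<forall>x\<in>Z. u x = 0) \<and> (\<forall>x\<in>topspace W. near W x (\<lambda>a b. \<phi> a b = u b - u a))"
    using assms unfolding as_coboundaries_def mem_Collect_eq .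
  then obtain u where "(\<forall>x\<in>Z. u x = 0) \<and> (\<forall>x\<in>topspace W. near W x (\<lambda>a b. \<phi> a b = u b - u a))" ..
  then show ?thesis by (intro jumpI[of u _ u]) auto
qed

lemma jump_scale:
  assumes "jump \<phi> u" shows "jump (\<lambda>a b. k * \<phi> a b) (\<lambda>x. k * u x)"
proof -
  obtain v w where 1: "\<forall>x\<in>Q. v x = 0" "\<forall>x\<in>topspace W - P. near W x (\<lambda>a b. \<phi> a b = v b - v a)"
     "\<forall>x\<in>P. w x = 0" "\<forall>x\<in>topspace W - Q. near W x (\<lambda>a b. \<phi> a b = w b - w a)"
     "\<forall>x\<in>U. u x = v x - w x"
    using assms(1) by (rule jumpE)
  show ?thesis
  proof (rule jumpI[of "\<lambda>x. k * v x" _ "\<lambda>x. k * w x"])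
    show "\<forall>x\<in>topspace W - P. near W x (\<lambda>a b. k * \<phi> a b = k * v b - k * v a)"
      by (intro ballI near_mono[OF 1(2)[rule_format]]) (auto simp: right_diff_distrib)
    show "\<forall>x\<in>topspace W - Q. near W x (\<lambda>a b. k * \<phi> a b = k * w b - k * w a)"
      by (intro ballI near_mono[OF 1(4)[rule_format]]) (auto simp: right_diff_distrib)
  qed (use 1(1,3,5) in \<open>auto simp: right_diff_distrib\<close>)
qed

lemma jump_add:
  assumes "jump \<phi> u" "jump \<psi> u'" shows "jump (\<lambda>a b. \<phi> a b + \<psi> a b) (\<lambda>x. u x + u' x)"
proof -
  obtain v w where 1: "\<forall>x\<in>Q. v x = 0" "\<forall>x\<in>topspace W - P. near W x (\<lambda>a b. \<phi> a b = v b - v a)"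
     "\<forall>x\<in>P. w x = 0" "\<forall>x\<in>topspace W - Q. near W x (\<lambda>a b. \<phi> a b = w b - w a)"
     "\<forall>x\<in>U. u x = v x - w x"
    using assms(1) by (rule jumpE)
  obtain v' w' where 2: "\<forall>x\<in>Q. v' x = 0" "\<forall>x\<in>topspace W - P. near W x (\<lambda>a b. \<psi> a b = v' b - v' a)"
     "\<forall>x\<in>P. w' x = 0" "\<forall>x\<in>topspace W - Q. near W x (\<lambda>a b. \<psi> a b = w' b - w' a)"
     "\<forall>x\<in>U. u' x = v' x - w' x"
    using assms(2) by (rule jumpE)
  show ?thesis
  proof (rule jumpI[of "\<lambda>x. v x + v' x" _ "\<lambda>x. w x + w' x"])
    show "\<forall>x\<in>topspace W - P. near W x (\<lambda>a b. \<phi> a b + \<psi> a b = v b + v' b - (v a + v' a))"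
      by (intro ballI near_conj[OF 1(2)[rule_format] 2(2)[rule_format]]) auto
    show "\<forall>x\<in>topspace W - Q. near W x (\<lambda>a b. \<phi> a b + \<psi> a b = w b + w' b - (w a + w' a))"
      by (intro ballI near_conj[OF 1(4)[rule_format] 2(4)[rule_format]]) auto
  qed (use 1(1,3,5) 2(1,3,5) in auto)
qed

lemma jump_sum:
  assumes "finite I" "\<And>i. i \<in> I \<Longrightarrow> jump (\<phi> i) (u i)"
  shows "jump (\<lambda>a b. \<Sum>i\<in>I. c i * \<phi> i a b) (\<lambda>x. \<Sum>i\<in>I. c i * u i x)"
  using assms
proof (induction I rule: finite_induct)
  case empty
  then show ?case using jump_coboundary[OF as_coboundaries_zero] by simp
next
  case (insert i I)
  have "jump (\<lambda>a b. c i * \<phi> i a b) (\<lambda>x. c i * u i x)"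
    by (rule jump_scale) (use insert in auto)
  from jump_add[OF this, of "\<lambda>a b. \<Sum>i\<in>I. c i * \<phi> i a b" "\<lambda>x. \<Sum>i\<in>I. c i * u i x"] insert
  show ?case by simp
qed

lemma jump_pullback:
  assumes "jump \<phi> u" shows "jump (\<lambda>a b. \<phi> (T a) (T b)) (\<lambda>x. u (T x))"
proof -
  obtain v w where 1: "\<forall>x\<in>Q. v x = 0" "\<forall>x\<in>topspace W - P. near W x (\<lambda>a b. \<phi> a b = v b - v a)"
     "\<forall>x\<in>P. w x = 0" "\<forall>x\<in>topspace W - Q. near W x (\<lambda>a b. \<phi> a b = w b - w a)"
     "\<forall>x\<in>U. u x = v x - w x"
    using assms(1) by (rule jumpE)
  show ?thesis
  proof (rule jumpI[of "\<lambda>x. v (T x)" _ "\<lambda>x. w (T x)"])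
    show "\<forall>x\<in>topspace W - P. near W x (\<lambda>a b. \<phi> (T a) (T b) = v (T b) - v (T a))"
      using TW invar_P by (intro ballI near_pullback[OF cont _ 1(2)[rule_format]]) auto
    show "\<forall>x\<in>topspace W - Q. near W x (\<lambda>a b. \<phi> (T a) (T b) = w (T b) - w (T a))"
      using TW invar_Q by (intro ballI near_pullback[OF cont _ 1(4)[rule_format]]) auto
    show "\<forall>x\<in>U. u (T x) = v (T x) - w (T x)"
      using 1(5) TW invar_P invar_Q by auto
  qed (use 1(1,3) T_image in auto)
qed

text \<open>The support of the jump, together with \<open>P\<close> and \<open>Q\<close>, splits
  into a closed part \<open>S\<close> around \<open>P\<close> and a closed part \<open>R\<close>
  around \<open>Q\<close>. Subtracting the jump from \<open>v\<close> on \<open>S\<close> turns it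
  into \<open>w\<close> near \<open>P\<close> without altering it near \<open>Q\<close>.\<close>

lemma coboundary_if_jump_zero:
  assumes J: "jump \<phi> u" and u0: "\<And>F x. F \<in> E \<Longrightarrow> x \<in> F \<Longrightarrow> u x = 0"
  shows "\<phi> \<in> as_coboundaries W Z"
proof -
  obtain v w where 1: "\<forall>x\<in>Q. v x = 0" "\<forall>x\<in>topspace W - P. near W x (\<lambda>a b. \<phi> a b = v b - v a)"
     "\<forall>x\<in>P. w x = 0" "\<forall>x\<in>topspace W - Q. near W x (\<lambda>a b. \<phi> a b = w b - w a)"
     "\<forall>x\<in>U. u x = v x - w x"
    using J by (rule jumpE)
  note lc = jump_locally_constant[OF J]
  define A where "A = {x \<in> U. u x \<noteq> 0}"
  have "openin W {x \<in> U. u x \<in> {0}}"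
    using locally_constant_on_clopen(1)[OF lc open_U, of "{0}"] openin_open_subtopology[OF open_U] by blast
  moreover have "topspace W - (A \<union> Z) = {x \<in> U. u x \<in> {0}}" unfolding A_def by blast
  ultimately have "closedin W (A \<union> Z)" using ZW unfolding closedin_def A_def by auto
  moreover have "F \<inter> A = {}" if "F \<in> quasi_components_of (subtopology W U)" "(W closure_of F) \<inter> P \<noteq> {}" "(W closure_of F) \<inter> Q \<noteq> {}" for F
    using u0[of F] that unfolding E_def A_def by blast
  ultimately have "splits W P Q (A \<union> Z)"
    by (intro splits_of_no_essential_quasicomponent[OF compact Hausdorff closed_P closed_Q disjoint])
       (auto simp: A_def)
  then obtain S R where SR: "closedin W S" "closedin W R" "S \<inter> R = {}" "A \<union> Z = S \<union> R" "P \<subseteq> S" "Q \<subseteq> R"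
    unfolding splits_def by (metis Int_absorb1 sup.cobounded1 sup.cobounded2 sup.coboundedI2)
  have S': "openin W (topspace W - S)" "openin W (topspace W - R)" using SR by auto
  \<comment> \<open>Off \<open>S\<close> this is \<open>v\<close>; off \<open>R\<close> it is
    \<open>w\<close>, because there the jump has been subtracted or is 0. As \<open>S\<close> and
    \<open>R\<close> are disjoint, one of these descriptions holds near every point.\<close>
  define g where "g x = (if x \<in> P then 0 else v x - (if x \<in> S then u x else 0))" for x
  have gS: "g x = v x" if "x \<in> topspace W - S" for x using that SR(5) by (auto simp: g_def)
  have gR: "g x = w x" if "x \<in> topspace W - R" for x
  proof (cases "x \<in> P")
    case True
    then show ?thesis using 1(3) by (simp add: g_def)
  next
    case False
    then have xU: "x \<in> U" using that SR(6) by auto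
    show ?thesis
    proof (cases "x \<in> S")
      case True
      then show ?thesis using False 1(5) xU by (simp add: g_def)
    next
      case False
      then have "x \<notin> A" using that SR(4) by blast
      then have "u x = 0" using xU by (simp add: A_def)
      then show ?thesis using False 1(5) xU by (simp add: g_def)
    qed
  qed
  have "near W x (\<lambda>a b. \<phi> a b = g b - g a)" if x: "x \<in> topspace W" for x
  proof -
    consider "x \<notin> S" | "x \<notin> R" using SR(3) by blast
    then show ?thesis
    proof cases
      case 1
      then have xS: "x \<in> topspace W - S" and xP: "x \<in> topspace W - P" using x SR(5) by auto
      show ?thesis
        by (rule near_conj[OF \<open>\<forall>x\<in>topspace W - P. near W x (\<lambda>a b. \<phi> a b = v b - v a)\<close>[rule_format, OF xP]
              near_open[OF S'(1) xS]]) (simp add: gS)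
    next
      case 2
      then have xR: "x \<in> topspace W - R" and xQ: "x \<in> topspace W - Q" using x SR(6) by auto
      show ?thesis
        by (rule near_conj[OF 1(4)[rule_format, OF xQ] near_open[OF S'(2) xR]]) (simp add: gR)
    qed
  qed
  moreover have "g x = 0" if "x \<in> Z" for x
    using that 1(1) SR(3,6) by (auto simp: g_def)
  ultimately show ?thesis unfolding as_coboundaries_def by (intro CollectI exI[of _ g]) auto
qed

text \<open>The connecting map for the cover of \<open>W\<close> by the complements of
  \<open>P\<close> and \<open>Q\<close>: a locally constant function on their intersection is
  written as the difference of \<open>v\<close>, which vanishes near \<open>Q\<close>, and
  \<open>w\<close>, which vanishes near \<open>P\<close>.\<close>

lemma cocycle_with_jump:
  fixes u :: "'b \<Rightarrow> 'k::field"
  assumes u: "locally_constant_on W U u"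
  obtains \<phi> where "\<phi> \<in> as_cocycles W Z" "jump \<phi> u"
proof -
  obtain O1 O2 where O: "openin W O1" "openin W O2" "P \<subseteq> O1" "Q \<subseteq> O2" "O1 \<inter> O2 = {}"
    using closedin_separation[OF compact Hausdorff closed_P closed_Q disjoint] by metis
  define u' where "u' x = (if x \<in> Z then 0 else u x)" for x
  define v where "v x = (if x \<in> O2 then 0 else u' x)" for x
  define w where "w x = v x - u' x" for x
  \<comment> \<open>The cut-off to 0 is needed near \<open>P\<close>, where \<open>u\<close> may
    fail to be locally constant; at points off \<open>P\<close> the result agrees locally with the
    coboundary of \<open>v\<close>.\<close>
  define \<phi> where "\<phi> a b = (if a \<in> O2 \<or> b \<in> O2 then v b - v a else 0)" for a b
  have nP: "near W x (\<lambda>a b. \<phi> a b = 0 \<and> w a = w b)" if "x \<in> P" for x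
    by (rule near_mono[OF near_open[of W O1 x]]) (use O that in \<open>auto simp: \<phi>_def w_def v_def\<close>)
  have nQ: "near W x (\<lambda>a b. \<phi> a b = 0 \<and> v a = v b)" if "x \<in> Q" for x
    by (rule near_mono[OF near_open[of W O2 x]]) (use O that in \<open>auto simp: \<phi>_def v_def\<close>)
  have nU: "near W x (\<lambda>a b. \<phi> a b = v b - v a \<and> u' a = u' b)" if x: "x \<in> U" for x
  proof (rule near_conj[OF _ near_open[OF open_U x]])
    show "near W x (\<lambda>a b. u a = u b)" using u x by (auto simp: locally_constant_on_def)
  qed (auto simp: \<phi>_def v_def u'_def)
  have n1: "near W x (\<lambda>a b. \<phi> a b = v b - v a)" if "x \<in> topspace W - P" for x
  proof (cases "x \<in> Q")
    case True
    show ?thesis by (rule near_mono[OF nQ[OF True]]) simp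
  next
    case False
    show ?thesis by (rule near_mono[OF nU]) (use False that in auto)
  qed
  have n2: "near W x (\<lambda>a b. \<phi> a b = w b - w a)" if "x \<in> topspace W - Q" for x
  proof (cases "x \<in> P")
    case True
    show ?thesis by (rule near_mono[OF nP[OF True]]) simp
  next
    case False
    show ?thesis by (rule near_mono[OF nU]) (use False that in \<open>auto simp: w_def\<close>)
  qed
  show ?thesis
  proof
    show "\<phi> \<in> as_cocycles W Z"
      unfolding as_cocycles_def
    proof (intro CollectI conjI ballI)
      fix x assume "x \<in> topspace W"
      then consider "x \<in> topspace W - P" | "x \<in> topspace W - Q" using disjoint by blast
      then show "\<exists>w. near W x (\<lambda>a b. \<phi> a b = w b - w a)"
        by cases (blast intro: n1 n2)+
    next
      fix x assume "x \<in> Z"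
      then have "near W x (\<lambda>a b. \<phi> a b = 0)"
        using near_mono[OF nP[of x], of "\<lambda>a b. \<phi> a b = 0"] near_mono[OF nQ[of x], of "\<lambda>a b. \<phi> a b = 0"] by auto
      then show "near W x (\<lambda>a b. a \<in> Z \<and> b \<in> Z \<longrightarrow> \<phi> a b = 0)"
        by (rule near_mono) simp
    qed
    show "jump \<phi> u"
    proof (rule jumpI[of v _ w])
      show "\<forall>x\<in>Q. v x = 0" "\<forall>x\<in>P. w x = 0" "\<forall>x\<in>U. u x = v x - w x"
        using O by (auto simp: v_def w_def u'_def)
    qed (use n1 n2 in auto)
  qed
qed

text \<open>Distinct quasicomponents are separated by a clopen set; finitely many such sets
  intersect in a clopen one, whose indicator is locally constant on \<open>U\<close>.\<close>

lemma essential_indicator: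
  assumes F: "F \<in> E" and E0: "finite E0" "E0 \<subseteq> E"
  obtains u :: "'b \<Rightarrow> 'k::field" where "locally_constant_on W U u" "\<And>x. x \<in> F \<Longrightarrow> u x = 1"
    "\<And>G x. G \<in> E0 \<Longrightarrow> G \<noteq> F \<Longrightarrow> x \<in> G \<Longrightarrow> u x = 0"
proof -
  let ?X = "subtopology W U"
  have tX: "topspace ?X = U" by auto
  obtain y where y: "F = quasi_component_of_set ?X y" "y \<in> U"
    using F tX unfolding E_def quasi_components_of_def by auto
  have "\<exists>K. closedin ?X K \<and> openin ?X K \<and> F \<subseteq> K \<and> G \<inter> K = {}" if G: "G \<in> E" "G \<noteq> F" for G
  proof -
    obtain z where z: "G = quasi_component_of_set ?X z" "z \<in> U"
      using G tX unfolding E_def quasi_components_of_def by auto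
    have "\<not> quasi_component_of ?X y z"
      using G(2) y z quasi_component_of_equiv[of ?X y z] by auto
    then obtain K where K: "closedin ?X K" "openin ?X K" "y \<in> K" "z \<notin> K"
      using y(2) z(2) tX unfolding quasi_component_of by blast
    have "F \<subseteq> K" "G \<inter> K = {}" using K y(1) z(1) unfolding quasi_component_of_def by blast+
    with K show ?thesis by blast
  qed
  then obtain K where K: "\<And>G. G \<in> E \<Longrightarrow> G \<noteq> F \<Longrightarrow> closedin ?X (K G) \<and> openin ?X (K G) \<and> F \<subseteq> K G \<and> G \<inter> K G = {}"
    by metis
  define K' where "K' = U \<inter> (\<Inter>G\<in>E0 - {F}. K G)"
  define u :: "'b \<Rightarrow> 'k" where "u x = (if x \<in> K' then 1 else 0)" for x
  have opK: "openin W (K G)" "openin W (U - K G)" if "G \<in> E0 - {F}" for G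
    using K[of G] that E0(2) tX openin_open_subtopology[OF open_U] unfolding closedin_def by auto
  have KG: "near W x (\<lambda>a b. a \<in> K G \<longleftrightarrow> b \<in> K G)" if "G \<in> E0 - {F}" "x \<in> U" for x G
  proof (cases "x \<in> K G")
    case True
    show ?thesis by (rule near_mono[OF near_open[OF opK(1)[OF that(1)] True]]) simp
  next
    case False
    then have "x \<in> U - K G" using that(2) by blast
    from near_open[OF opK(2)[OF that(1)] this] show ?thesis by (rule near_mono) blast
  qed
  show ?thesis
  proof
    show "locally_constant_on W U u"
      unfolding locally_constant_on_def
    proof
      fix x assume x: "x \<in> U"
      have 1: "near W x (\<lambda>a b. \<forall>G\<in>E0 - {F}. a \<in> K G \<longleftrightarrow> b \<in> K G)"
        by (rule near_ball) (use E0(1) x KG in auto)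
      show "near W x (\<lambda>a b. u a = u b)"
        by (rule near_conj[OF 1 near_open[OF open_U x]]) (auto simp: u_def K'_def)
    qed
    show "u x = 1" if "x \<in> F" for x
      using that K E_subset[OF F] E0(2) by (auto simp: u_def K'_def)
    show "u x = 0" if "G \<in> E0" "G \<noteq> F" "x \<in> G" for G x
      using that K[of G] E0(2) by (auto simp: u_def K'_def)
  qed
qed

text \<open>Any \<open>d\<close> essential quasicomponents carry \<open>d\<close> cocycles with
  indicator jumps. A dependence modulo coboundaries has zero jump on each of them, which makes all
  its coefficients vanish.\<close>

lemma finite_E:
  assumes d: "dep_bound (as_cocycles W Z :: ('b \<Rightarrow> 'b \<Rightarrow> 'k::field) set) (as_coboundaries W Z) d"
  shows "finite E"
proof (rule ccontr)
  assume "infinite E"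
  then obtain E0 where E0: "E0 \<subseteq> E" "finite E0" "card E0 = d"
    using infinite_arbitrarily_large by blast
  obtain F where F: "bij_betw F {..<d} E0"
    using ex_bij_betw_nat_finite[OF E0(2)] E0(3) by (auto simp: atLeast0LessThan)
  have FE: "F i \<in> E0" "F i \<in> E" if "i < d" for i
    using F that E0(1) unfolding bij_betw_def by auto
  have "\<exists>\<phi> (u :: 'b \<Rightarrow> 'k). \<phi> \<in> as_cocycles W Z \<and> jump \<phi> u \<and> (\<forall>x\<in>F i. u x = 1) \<and>
      (\<forall>G\<in>E0. G \<noteq> F i \<longrightarrow> (\<forall>x\<in>G. u x = 0))" if i: "i < d" for i
  proof -
    obtain u :: "'b \<Rightarrow> 'k" where u: "locally_constant_on W U u" "\<And>x. x \<in> F i \<Longrightarrow> u x = 1"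
        "\<And>G x. G \<in> E0 \<Longrightarrow> G \<noteq> F i \<Longrightarrow> x \<in> G \<Longrightarrow> u x = 0"
      using essential_indicator[OF FE(2)[OF i] E0(2,1)] by metis
    obtain \<phi> where "\<phi> \<in> as_cocycles W Z" "jump \<phi> u" using cocycle_with_jump[OF u(1)] by metis
    with u show ?thesis by blast
  qed
  then obtain \<phi> :: "nat \<Rightarrow> 'b \<Rightarrow> 'b \<Rightarrow> 'k" and u :: "nat \<Rightarrow> 'b \<Rightarrow> 'k" where
    pu: "\<And>i. i < d \<Longrightarrow> \<phi> i \<in> as_cocycles W Z \<and> jump (\<phi> i) (u i) \<and> (\<forall>x\<in>F i. u i x = 1) \<and>
      (\<forall>G\<in>E0. G \<noteq> F i \<longrightarrow> (\<forall>x\<in>G. u i x = 0))"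
    by metis
  have "\<exists>c. (\<exists>i<d. c i \<noteq> 0) \<and> (\<lambda>a b. \<Sum>i<d. c i * \<phi> i a b) \<in> as_coboundaries W Z"
    using d[unfolded dep_bound_def, rule_format, of \<phi>] pu by simp
  then obtain c where c: "(\<exists>i<d. c i \<noteq> 0) \<and> (\<lambda>a b. \<Sum>i<d. c i * \<phi> i a b) \<in> as_coboundaries W Z" ..
  have J1: "jump (\<lambda>a b. \<Sum>i<d. c i * \<phi> i a b) (\<lambda>x. \<Sum>i<d. c i * u i x)"
    by (rule jump_sum) (use pu in auto)
  have J2: "jump (\<lambda>a b. \<Sum>i<d. c i * \<phi> i a b) (\<lambda>_. 0)"
    by (rule jump_coboundary) (use c in simp)
  have "c j = 0" if j: "j < d" for j
  proof -
    obtain x where x: "x \<in> F j" using E_nonempty[OF FE(2)[OF j]] by blast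
    have "(\<Sum>i<d. c i * u i x) = (\<Sum>i<d. if i = j then c j else 0)"
    proof (rule sum.cong[OF refl])
      fix i assume i: "i \<in> {..<d}"
      have "F j \<noteq> F i" if "i \<noteq> j"
        using F i j that unfolding bij_betw_def inj_on_def by auto
      then show "c i * u i x = (if i = j then c j else 0)"
        using pu[of i] i x FE(1)[OF j] by auto
    qed
    then show ?thesis
      using jump_unique[OF J1 J2 FE(2)[OF j] x] j by simp
  qed
  with c show False by blast
qed

lemma cocycle_with_values:
  fixes t :: "'b set \<Rightarrow> 'k::field"
  assumes "finite E"
  obtains \<phi> u where "\<phi> \<in> as_cocycles W Z" "jump \<phi> u" "\<And>F x. F \<in> E \<Longrightarrow> x \<in> F \<Longrightarrow> u x = t F"
proof -
  have "\<exists>u :: 'b \<Rightarrow> 'k. locally_constant_on W U u \<and> (\<forall>x\<in>F. u x = 1) \<and> (\<forall>G\<in>E. G \<noteq> F \<longrightarrow> (\<forall>x\<in>G. u x = 0))"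
    if "F \<in> E" for F
    using essential_indicator[OF that assms subset_refl] by metis
  then obtain u :: "'b set \<Rightarrow> 'b \<Rightarrow> 'k" where u: "\<And>F. F \<in> E \<Longrightarrow> locally_constant_on W U (u F) \<and>
      (\<forall>x\<in>F. u F x = 1) \<and> (\<forall>G\<in>E. G \<noteq> F \<longrightarrow> (\<forall>x\<in>G. u F x = 0))"
    by metis
  have "locally_constant_on W U (\<lambda>x. \<Sum>F\<in>E. t F * u F x)"
    unfolding locally_constant_on_def
  proof
    fix x assume x: "x \<in> U"
    have 1: "near W x (\<lambda>a b. \<forall>F\<in>E. u F a = u F b)"
      by (rule near_ball) (use assms x u in \<open>auto simp: locally_constant_on_def\<close>)
    show "near W x (\<lambda>a b. (\<Sum>F\<in>E. t F * u F a) = (\<Sum>F\<in>E. t F * u F b))"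
      by (rule near_mono[OF 1]) (auto intro: sum.cong)
  qed
  then obtain \<phi> where "\<phi> \<in> as_cocycles W Z" "jump \<phi> (\<lambda>x. \<Sum>F\<in>E. t F * u F x)"
    using cocycle_with_jump by metis
  moreover have "(\<Sum>G\<in>E. t G * u G x) = t F" if F: "F \<in> E" "x \<in> F" for F x
  proof -
    have "(\<Sum>G\<in>E. t G * u G x) = (\<Sum>G\<in>E. if G = F then t F else 0)"
      by (rule sum.cong[OF refl]) (use u F in auto)
    then show ?thesis using F assms by simp
  qed
  ultimately show ?thesis by (rule that)
qed

section \<open>The action of the homeomorphism on essential quasicomponents\<close>

lemma homeomorphic_T: "homeomorphic_map W W T" "homeomorphic_map W W T'"
proof -
  have "homeomorphic_maps W W T T'"
    unfolding homeomorphic_maps_def using cont cont' inv inv' by auto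
  then show "homeomorphic_map W W T" "homeomorphic_map W W T'"
    by (auto simp: homeomorphic_maps_map)
qed

lemma preimage_eq: "F \<subseteq> topspace W \<Longrightarrow> {x \<in> topspace W. T x \<in> F} = T' ` F"
  using inv inv' T'W by (force simp: image_iff)

lemma essential_image:
  assumes "F \<in> E"
  shows "T ` F \<in> E" "T' ` F \<in> E"
proof -
  have main: "S ` F \<in> E" if h: "homeomorphic_map W W S" and S: "S ` P \<subseteq> P" "S ` Q \<subseteq> Q" "S ` U = U" for S
  proof -
    have "homeomorphic_map (subtopology W U) (subtopology W U) S"
      using homeomorphic_map_subtopologies[OF h, of U U] S(3) by auto
    then have "S ` F \<in> quasi_components_of (subtopology W U)"
      using homeomorphic_map_quasi_components_of assms unfolding E_def by blast
    moreover have "W closure_of (S ` F) = S ` (W closure_of F)"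
      by (rule homeomorphic_map_closure_of[OF h]) (use E_subset[OF assms] in blast)
    ultimately show ?thesis
      using assms S(1,2) unfolding E_def by blast
  qed
  have "T ` U = U"
  proof
    show "T ` U \<subseteq> U" using TW invar_P invar_Q by auto
    show "U \<subseteq> T ` U"
    proof
      fix x assume x: "x \<in> U"
      then have "T' x \<in> U" "T (T' x) = x" using inv[of x] T'W[of x] invar_P[of "T' x"] invar_Q[of "T' x"] by auto
      then show "x \<in> T ` U" by (metis imageI)
    qed
  qed
  have "T' (T x) = x" if "x \<in> U" for x using inv' that by auto
  then have "T' ` (T ` U) = U" by force
  with \<open>T ` U = U\<close> have "T' ` U = U" by simp
  show "T ` F \<in> E" by (rule main[OF homeomorphic_T(1) T_image(1,2) \<open>T ` U = U\<close>])
  show "T' ` F \<in> E" by (rule main[OF homeomorphic_T(2) T'_image(1,2) \<open>T' ` U = U\<close>])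
qed

end

section \<open>The pointed quotient and the index map\<close>

locale conley_pair =
  fixes M :: "'a topology" and D X N L :: "'a set" and f :: "'a \<Rightarrow> 'a"
  assumes M: "Hausdorff_space M"
    and D: "openin M D" and f: "continuous_map (subtopology M D) M f"
    and X: "isolated_invariant_set M D f X"
    and NL: "index_pair M D f X N L"
begin

abbreviation "Y \<equiv> index_space M N L"
abbreviation "g \<equiv> index_map N L f"
abbreviation "W \<equiv> Wu M f N L"
abbreviation "T \<equiv> shift_map f N L"
abbreviation "A \<equiv> M closure_of (N - L)"

lemma index_pair_facts: "compactin M L" "compactin M N" "L \<subseteq> N" "N \<subseteq> D" "X \<inter> L = {}" "f ` (N - L) \<subseteq> N" "f ` L \<inter> N \<subseteq> L"
  "compactin M A" "A \<subseteq> D" "X \<subseteq> M interior_of A" "X = Inv f A" "compactin M X" "f ` X = X"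
  using NL X unfolding index_pair_def isolating_neighbourhood_def isolated_invariant_set_def
  by argo+

lemma NM: "N \<subseteq> topspace M"
  using index_pair_facts(2) by (rule compactin_subset_topspace)

lemma closed_NL: "closedin M N" "closedin M L" "closedin M X"
  using index_pair_facts compactin_imp_closedin[OF M] by auto

lemma A_subset: "N - L \<subseteq> A" "A \<subseteq> N"
proof -
  show "N - L \<subseteq> A" by (rule closure_of_subset) (use NM in auto)
  show "A \<subseteq> N" by (rule closure_of_minimal) (use closed_NL in auto)
qed

lemma X_subset: "X \<subseteq> N - L"
proof -
  have "X \<subseteq> A" using index_pair_facts(10) interior_of_subset by (rule subset_trans)
  then show ?thesis using A_subset index_pair_facts(5) by blast
qed

lemma open_nbhd: "openin M (M interior_of A - L)" "X \<subseteq> M interior_of A - L" "M interior_of A - L \<subseteq> N - L"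
  using index_pair_facts(5,10) closed_NL interior_of_subset[of M A] A_subset by auto

lemma topspace_Y: "topspace Y = insert None (Some ` (N - L))"
  by (rule topspace_index_space[OF index_pair_facts(3) NM])

lemma topN: "topspace (subtopology M N) = N"
  using NM by auto

lemma openin_Y: "openin Y U \<longleftrightarrow> U \<subseteq> topspace Y \<and> openin (subtopology M N) {x \<in> N. quotient_proj L x \<in> U}"
  unfolding openin_index_space topspace_Y topN ..

lemma closedin_Y: "closedin Y C \<longleftrightarrow> C \<subseteq> topspace Y \<and> closedin M {x \<in> N. quotient_proj L x \<in> C}"
proof -
  have "N - {x \<in> N. quotient_proj L x \<in> C} = {x \<in> N. quotient_proj L x \<in> topspace Y - C}"
    by (auto simp: topspace_Y quotient_proj_def)
  then have "closedin Y C \<longleftrightarrow> C \<subseteq> topspace Y \<and> closedin (subtopology M N) {x \<in> N. quotient_proj L x \<in> C}"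
    unfolding closedin_def openin_Y topN by auto
  then show ?thesis
    using closedin_closed_subtopology[OF closed_NL(1)] by auto
qed

lemma openin_Y_Some: "openin M V \<Longrightarrow> openin Y (Some ` (V \<inter> (N - L)))"
proof -
  assume V: "openin M V"
  have "{x \<in> N. quotient_proj L x \<in> Some ` (V \<inter> (N - L))} = (V - L) \<inter> N"
    by (auto simp: quotient_proj_def)
  moreover have "openin M (V - L)" using V closed_NL by auto
  ultimately show ?thesis
    unfolding openin_Y topspace_Y by (auto simp: openin_subtopology)
qed

lemma closedin_Y_Some: "closedin M C \<Longrightarrow> C \<subseteq> N - L \<Longrightarrow> closedin Y (Some ` C)"
proof -
  assume C: "closedin M C" "C \<subseteq> N - L"
  have "{x \<in> N. quotient_proj L x \<in> Some ` C} = C"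
    using C by (auto simp: quotient_proj_def)
  then show ?thesis using C unfolding closedin_Y topspace_Y by auto
qed

lemma closedin_None: "closedin Y {None}"
proof -
  have "{x \<in> N. quotient_proj L x \<in> {None}} = L"
    using index_pair_facts(3) by (auto simp: quotient_proj_def)
  then show ?thesis using closed_NL unfolding closedin_Y topspace_Y by auto
qed

lemma continuous_quotient_proj: "continuous_map (subtopology M N) Y (quotient_proj L)"
  unfolding continuous_map_def topN by (auto simp: openin_Y topspace_Y quotient_proj_def)

lemma compact_Y: "compact_space Y"
proof -
  have "compactin (subtopology M N) N" using index_pair_facts(2) by (simp add: compactin_subtopology)
  then have "compactin Y (quotient_proj L ` N)"
    by (rule image_compactin[OF _ continuous_quotient_proj])
  moreover have "compactin Y {None}" by (rule finite_imp_compactin) (auto simp: topspace_Y)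
  ultimately have "compactin Y ({None} \<union> quotient_proj L ` N)" by (rule compactin_Un[rotated])
  moreover have "{None} \<union> quotient_proj L ` N = topspace Y"
    by (force simp: topspace_Y quotient_proj_def image_iff)
  ultimately show ?thesis by (simp add: compact_space_def)
qed

lemma Hausdorff_Y: "Hausdorff_space Y"
proof -
  have SomeNone: "\<exists>U V. openin Y U \<and> openin Y V \<and> Some x \<in> U \<and> None \<in> V \<and> disjnt U V" if x: "x \<in> N - L" for x
  proof -
    have "compactin M {x}" using x NM by (intro finite_imp_compactin) auto
    moreover have "disjnt {x} L" using x by auto
    ultimately obtain U V where UV: "openin M U" "openin M V" "{x} \<subseteq> U" "L \<subseteq> V" "disjnt U V"
      using Hausdorff_space_compact_separation[OF M _ index_pair_facts(1)] by metis
    have "{y \<in> N. quotient_proj L y \<in> insert None (Some ` (V \<inter> (N - L)))} = V \<inter> N"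
      using UV(4) by (auto simp: quotient_proj_def)
    then have "openin Y (insert None (Some ` (V \<inter> (N - L))))"
      unfolding openin_Y topspace_Y using UV(2) by (auto simp: openin_subtopology)
    moreover have "openin Y (Some ` (U \<inter> (N - L)))" using UV(1) by (rule openin_Y_Some)
    ultimately show ?thesis
      using UV(3,5) x by (intro exI[of _ "Some ` (U \<inter> (N - L))"] exI[of _ "insert None (Some ` (V \<inter> (N - L)))"])
        (auto simp: disjnt_def)
  qed
  have SomeSome: "\<exists>U V. openin Y U \<and> openin Y V \<and> Some x \<in> U \<and> Some y \<in> V \<and> disjnt U V"
    if "x \<in> N - L" "y \<in> N - L" "x \<noteq> y" for x y
  proof -
    have "x \<in> topspace M \<and> y \<in> topspace M \<and> x \<noteq> y" using that NM by auto
    then have "\<exists>U V. openin M U \<and> openin M V \<and> x \<in> U \<and> y \<in> V \<and> disjnt U V"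
      by (rule M[unfolded Hausdorff_space_def, rule_format])
    then obtain U V where "openin M U" "openin M V" "x \<in> U" "y \<in> V" "disjnt U V"
      by (elim exE conjE)
    then show ?thesis
      using openin_Y_Some that
      by (intro exI[of _ "Some ` (U \<inter> (N - L))"] exI[of _ "Some ` (V \<inter> (N - L))"]) (auto simp: disjnt_def)
  qed
  show ?thesis
    unfolding Hausdorff_space_def
  proof (intro allI impI)
    fix a b assume ab: "a \<in> topspace Y \<and> b \<in> topspace Y \<and> a \<noteq> b"
    show "\<exists>U V. openin Y U \<and> openin Y V \<and> a \<in> U \<and> b \<in> V \<and> disjnt U V"
    proof (cases a; cases b)
      fix x assume "a = None" "b = Some x"
      then obtain U V where "openin Y U" "openin Y V" "Some x \<in> U" "None \<in> V" "disjnt U V"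
        using SomeNone[of x] ab unfolding topspace_Y by blast
      then show ?thesis using \<open>a = None\<close> \<open>b = Some x\<close> disjnt_sym by blast
    next
      fix x assume "a = Some x" "b = None"
      then show ?thesis using SomeNone[of x] ab unfolding topspace_Y by blast
    next
      fix x y assume "a = Some x" "b = Some y"
      then show ?thesis using SomeSome[of x y] ab unfolding topspace_Y by blast
    qed (use ab in auto)
  qed
qed

lemma g_None [simp]: "g None = None"
  by (simp add: index_map_def)

lemma g_Some: "g (Some x) = (if x \<in> N - L \<and> f x \<in> N - L then Some (f x) else None)"
  by (simp add: index_map_def)

text \<open>The two inclusions of an index pair enter one case each. For open sets without the base
  point, images of \<open>N - L\<close> stay in \<open>N\<close>; for open sets containing it,
  points of \<open>L\<close> cannot be mapped into the closed set \<open>K\<close> inside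
  \<open>N - L\<close>.\<close>

lemma continuous_g: "continuous_map Y Y g"
  unfolding continuous_map_def
proof (intro conjI allI impI)
  show "g \<in> topspace Y \<rightarrow> topspace Y"
    by (auto simp: topspace_Y index_map_def split: option.splits)
  have fN: "continuous_map (subtopology M N) M f"
    using f index_pair_facts(4) by (rule continuous_map_from_subtopology_mono)
  fix U assume U: "openin Y U"
  let ?B = "{x \<in> N. g (quotient_proj L x) \<in> U}"
  have "openin (subtopology M N) ?B"
  proof (cases "None \<in> U")
    case False
    have "openin (subtopology M N) {x \<in> N. quotient_proj L x \<in> U}" using U by (simp add: openin_Y)
    then obtain U0 where U0: "openin M U0" "{x \<in> N. quotient_proj L x \<in> U} = U0 \<inter> N"
      by (auto simp: openin_subtopology)
    have B: "?B = {x \<in> N. f x \<in> U0} \<inter> (topspace M - L)"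
    proof (intro subset_antisym subsetI)
      fix x assume x: "x \<in> ?B"
      then have "x \<in> N - L" "f x \<in> N - L" "Some (f x) \<in> U"
        using False by (auto simp: quotient_proj_def g_Some split: if_splits)
      then have "f x \<in> {x \<in> N. quotient_proj L x \<in> U}" by (auto simp: quotient_proj_def)
      then show "x \<in> {x \<in> N. f x \<in> U0} \<inter> (topspace M - L)"
        using U0(2) \<open>x \<in> N - L\<close> NM by auto
    next
      fix x assume x: "x \<in> {x \<in> N. f x \<in> U0} \<inter> (topspace M - L)"
      then have "f x \<in> N" using index_pair_facts(6) by auto
      then have "f x \<in> {x \<in> N. quotient_proj L x \<in> U}" using x U0(2) by auto
      then have "f x \<in> N - L" "Some (f x) \<in> U" using False by (auto simp: quotient_proj_def split: if_splits)
      then show "x \<in> ?B" using x by (auto simp: quotient_proj_def g_Some)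
    qed
    have 1: "openin (subtopology M N) {x \<in> N. f x \<in> U0}"
      using openin_continuous_map_preimage[OF fN U0(1)] unfolding topN .
    have 2: "openin (subtopology M N) ((topspace M - L) \<inter> N)"
      using closed_NL by (intro openin_subtopology_Int openin_diff openin_topspace)
    have "openin (subtopology M N) ({x \<in> N. f x \<in> U0} \<inter> ((topspace M - L) \<inter> N))"
      using 1 2 by (rule openin_Int)
    moreover have "{x \<in> N. f x \<in> U0} \<inter> ((topspace M - L) \<inter> N) = {x \<in> N. f x \<in> U0} \<inter> (topspace M - L)"
      by blast
    ultimately show ?thesis unfolding B by simp
  next
    case True
    define K where "K = {x \<in> N. quotient_proj L x \<in> topspace Y - U}"
    have "closedin Y (topspace Y - U)" using U by auto
    then have K: "closedin M K" by (simp add: closedin_Y K_def)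
    have KNL: "K \<subseteq> N - L" using True by (auto simp: K_def quotient_proj_def split: if_splits)
    have "N - ?B = {x \<in> N. f x \<in> K}"
    proof (intro subset_antisym subsetI)
      fix x assume "x \<in> N - ?B"
      then have "x \<in> N - L" "f x \<in> N - L" "Some (f x) \<notin> U"
        using True by (auto simp: quotient_proj_def g_Some split: if_splits)
      then show "x \<in> {x \<in> N. f x \<in> K}" by (auto simp: K_def quotient_proj_def topspace_Y)
    next
      fix x assume x: "x \<in> {x \<in> N. f x \<in> K}"
      then have "x \<notin> L" using index_pair_facts(7) KNL by auto
      moreover have "f x \<in> N - L" "Some (f x) \<notin> U"
        using x KNL by (auto simp: K_def quotient_proj_def split: if_splits)
      ultimately show "x \<in> N - ?B" using x by (auto simp: quotient_proj_def g_Some)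
    qed
    moreover have "closedin (subtopology M N) {x \<in> N. f x \<in> K}"
      using closedin_continuous_map_preimage[OF fN K] unfolding topN .
    moreover have "N - (N - ?B) = ?B" by auto
    ultimately have "closedin (subtopology M N) (N - ?B)" by simp
    then have "openin (subtopology M N) (N - (N - ?B))" unfolding closedin_def topN by blast
    then show ?thesis unfolding \<open>N - (N - ?B) = ?B\<close> .
  qed
  moreover have "{x \<in> N. quotient_proj L x \<in> {y \<in> topspace Y. g y \<in> U}} = ?B"
    by (auto simp: topspace_Y quotient_proj_def)
  ultimately show "openin Y {x \<in> topspace Y. g x \<in> U}"
    unfolding openin_Y by auto
qed

section \<open>The compactified unstable manifold\<close>

lemma topspace_W: "topspace W = {\<xi>. (\<forall>i. \<xi> i \<in> topspace Y) \<and> (\<forall>i. g (\<xi> (Suc i)) = \<xi> i)}"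
  unfolding Wu_def by (auto simp: PiE_iff)

lemma continuous_coord: "continuous_map W Y (\<lambda>\<xi>. \<xi> i)"
  unfolding Wu_def by (intro continuous_map_from_subtopology continuous_map_product_projection) simp

lemma continuous_into_W:
  assumes "\<And>i. continuous_map V Y (\<lambda>z. h z i)" "\<And>z i. z \<in> topspace V \<Longrightarrow> g (h z (Suc i)) = h z i"
  shows "continuous_map V W h"
  unfolding Wu_def
  by (rule continuous_map_into_subtopology) (use assms in \<open>auto simp: continuous_map_componentwise_UNIV\<close>)

lemma closed_W: "closedin (product_topology (\<lambda>_. Y) UNIV) {\<xi> \<in> topspace (product_topology (\<lambda>_. Y) UNIV). \<forall>i. g (\<xi> (Suc i)) = \<xi> i}"
proof -
  let ?R = "product_topology (\<lambda>_::nat. Y) UNIV"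
  have pr: "continuous_map ?R Y (\<lambda>\<xi>. \<xi> i)" for i by (rule continuous_map_product_projection) simp
  have "closedin ?R {\<xi> \<in> topspace ?R. g (\<xi> (Suc i)) = \<xi> i}" for i
    by (rule closedin_continuous_maps_eq[OF Hausdorff_Y _ pr])
       (rule continuous_map_compose[OF pr continuous_g, unfolded o_def])
  then have "closedin ?R (\<Inter>i. {\<xi> \<in> topspace ?R. g (\<xi> (Suc i)) = \<xi> i})" by blast
  moreover have "(\<Inter>i. {\<xi> \<in> topspace ?R. g (\<xi> (Suc i)) = \<xi> i}) = {\<xi> \<in> topspace ?R. \<forall>i. g (\<xi> (Suc i)) = \<xi> i}"
    by blast
  ultimately show ?thesis by simp
qed

lemma W_alt: "W = subtopology (product_topology (\<lambda>_. Y) UNIV) {\<xi> \<in> topspace (product_topology (\<lambda>_. Y) UNIV). \<forall>i. g (\<xi> (Suc i)) = \<xi> i}"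
proof -
  let ?R = "product_topology (\<lambda>_::nat. Y) UNIV"
  have "topspace ?R \<inter> {\<xi>. \<forall>i. g (\<xi> (Suc i)) = \<xi> i} = {\<xi> \<in> topspace ?R. \<forall>i. g (\<xi> (Suc i)) = \<xi> i}"
    by blast
  then show ?thesis
    unfolding Wu_def using subtopology_restrict[of ?R "{\<xi>. \<forall>i. g (\<xi> (Suc i)) = \<xi> i}"] by simp
qed

lemma compact_W: "compact_space W"
proof -
  have "compact_space (product_topology (\<lambda>_::nat. Y) UNIV)"
    by (simp add: compact_space_product_topology compact_Y)
  then show ?thesis
    unfolding W_alt by (intro compact_space_subtopology closedin_compact_space closed_W)
qed

lemma Hausdorff_W: "Hausdorff_space W"
  unfolding Wu_def by (intro Hausdorff_space_subtopology) (simp add: Hausdorff_space_product_topology Hausdorff_Y)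

definition T' :: "(nat \<Rightarrow> 'a option) \<Rightarrow> nat \<Rightarrow> 'a option" where
  "T' \<xi> i = \<xi> (Suc i)"

lemma T_simps [simp]: "T \<xi> 0 = g (\<xi> 0)" "T \<xi> (Suc i) = \<xi> i"
  by (simp_all add: shift_map_def)

lemma W_g: "\<xi> \<in> topspace W \<Longrightarrow> g (\<xi> (Suc i)) = \<xi> i"
  by (simp add: topspace_W)

lemma W_Y: "\<xi> \<in> topspace W \<Longrightarrow> \<xi> i \<in> topspace Y"
  by (simp add: topspace_W)

lemma continuous_T: "continuous_map W W T"
proof (rule continuous_into_W)
  fix i show "continuous_map W Y (\<lambda>\<xi>. T \<xi> i)"
    by (cases i) (use continuous_coord continuous_map_compose[OF continuous_coord continuous_g, unfolded o_def] in auto)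
next
  fix \<xi> i assume "\<xi> \<in> topspace W"
  then show "g (T \<xi> (Suc i)) = T \<xi> i" by (cases i) (auto simp: W_g)
qed

lemma continuous_T': "continuous_map W W T'"
  by (rule continuous_into_W) (auto simp: T'_def continuous_coord W_g)

lemma T_T': "\<xi> \<in> topspace W \<Longrightarrow> T (T' \<xi>) = \<xi>"
proof
  fix i assume "\<xi> \<in> topspace W"
  then show "T (T' \<xi>) i = \<xi> i" by (cases i) (auto simp: T'_def W_g)
qed

lemma T'_T: "T' (T \<xi>) = \<xi>"
  by (auto simp: T'_def)

lemma T'_funpow: "(T' ^^ k) \<xi> i = \<xi> (k + i)"
  by (induction k arbitrary: i) (auto simp: T'_def)

lemma T_funpow: "(T ^^ k) \<xi> (k + i) = \<xi> i"
  by (induction k) auto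

lemma TW: "\<xi> \<in> topspace W \<Longrightarrow> (T ^^ k) \<xi> \<in> topspace W" and T'W: "\<xi> \<in> topspace W \<Longrightarrow> (T' ^^ k) \<xi> \<in> topspace W"
proof -
  assume xi: "\<xi> \<in> topspace W"
  show "(T ^^ k) \<xi> \<in> topspace W"
    using continuous_T by (induction k) (auto simp: xi continuous_map_def)
  show "(T' ^^ k) \<xi> \<in> topspace W"
    using continuous_T' by (induction k) (auto simp: xi continuous_map_def)
qed

lemma W_funpow_g: "\<xi> \<in> topspace W \<Longrightarrow> (g ^^ k) (\<xi> (k + i)) = \<xi> i"
proof (induction k arbitrary: i)
  case (Suc k)
  have "(g ^^ Suc k) (\<xi> (Suc k + i)) = g ((g ^^ k) (\<xi> (k + Suc i)))" by simp
  also have "(g ^^ k) (\<xi> (k + Suc i)) = \<xi> (Suc i)" using Suc by blast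
  finally show ?case using W_g Suc.prems by simp
qed simp

lemma funpow_g_None [simp]: "(g ^^ k) None = None"
  by (induction k) auto

lemma W_not_None: "\<xi> \<in> topspace W \<Longrightarrow> \<xi> l \<noteq> None \<Longrightarrow> l \<le> j \<Longrightarrow> \<xi> j \<noteq> None"
  using W_funpow_g[of \<xi> "j - l" l] by (metis funpow_g_None le_add_diff_inverse2)

lemma W_Some: "\<xi> \<in> topspace W \<Longrightarrow> \<xi> j = Some x \<Longrightarrow> x \<in> N - L"
  using W_Y[of \<xi> j] by (auto simp: topspace_Y)

lemma W_step: "\<xi> \<in> topspace W \<Longrightarrow> \<xi> (Suc j) = Some x \<Longrightarrow> \<xi> j = Some y \<Longrightarrow> f x = y"
  using W_g[of \<xi> j] by (auto simp: g_Some split: if_splits)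

text \<open>Otherwise compactness of the space of two-sided sequences in \<open>A\<close> yields a
  full orbit in \<open>A\<close> with centre outside \<open>B\<close>, although \<open>X\<close> is
  the invariant part of \<open>A\<close>. The gain is one \<open>n\<close> for all segments.\<close>

lemma orbit_segment_near_X:
  assumes B: "openin M B" "X \<subseteq> B"
  obtains n :: nat where "\<And>s :: int \<Rightarrow> 'a. (\<And>i. s i \<in> A) \<Longrightarrow> (\<And>i. - int n \<le> i \<Longrightarrow> i < int n \<Longrightarrow> f (s i) = s (i + 1)) \<Longrightarrow> s 0 \<in> B"
proof (rule ccontr)
  assume no: "\<not> thesis"
  let ?R = "product_topology (\<lambda>_::int. subtopology M A) UNIV"
  have tR: "topspace ?R = {s. \<forall>i. s i \<in> A}"
    using compactin_subset_topspace[OF index_pair_facts(8)] by (auto simp: PiE_iff)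
  have pr: "continuous_map ?R (subtopology M A) (\<lambda>s. s i)" for i
    by (rule continuous_map_product_projection) simp
  have prM: "continuous_map ?R M (\<lambda>s. s i)" for i
    using pr by (rule continuous_map_into_fulltopology)
  have fA: "continuous_map (subtopology M A) M f"
    using f index_pair_facts(9) by (rule continuous_map_from_subtopology_mono)
  \<comment> \<open>Sequences are constrained to be orbits only on a window of length
    \<open>2 * n\<close>; all \<open>C n\<close> thus live in one compact product and
    decrease.\<close>
  define C where "C n = {s \<in> topspace ?R. s 0 \<notin> B} \<inter>
      (\<Inter>i\<in>{- int n..<int n}. {s \<in> topspace ?R. f (s i) = s (i + 1)}) \<inter> topspace ?R" for n :: nat
  have R: "compact_space ?R"
    using index_pair_facts(8) by (simp add: compact_space_product_topology compact_space_subtopology)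
  have "(\<Inter>n. C n) \<noteq> {}"
  proof (rule compact_space_imp_nest[OF R])
    fix n
    have "closedin ?R {s \<in> topspace ?R. s 0 \<in> topspace M - B}"
      by (rule closedin_continuous_map_preimage[OF prM]) (use B in auto)
    also have "{s \<in> topspace ?R. s 0 \<in> topspace M - B} = {s \<in> topspace ?R. s 0 \<notin> B}"
      using tR compactin_subset_topspace[OF index_pair_facts(8)] by auto
    finally have 0: "closedin ?R {s \<in> topspace ?R. s 0 \<notin> B}" .
    have 1: "closedin ?R {s \<in> topspace ?R. f (s i) = s (i + 1)}" for i
      by (rule closedin_continuous_maps_eq[OF M _ prM])
         (rule continuous_map_compose[OF pr fA, unfolded o_def])
    have "C n = \<Inter>(insert {s \<in> topspace ?R. s 0 \<notin> B} ((\<lambda>i. {s \<in> topspace ?R. f (s i) = s (i + 1)}) ` {- int n..<int n}))"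
      unfolding C_def by blast
    also have "closedin ?R \<dots>" by (rule closedin_Inter) (use 0 1 in \<open>blast+\<close>)
    finally show "closedin ?R (C n)" .
    show "C n \<noteq> {}"
    proof
      assume "C n = {}"
      have thesis
      proof (rule that[of n])
        fix s :: "int \<Rightarrow> 'a" assume s: "\<And>i. s i \<in> A" "\<And>i. - int n \<le> i \<Longrightarrow> i < int n \<Longrightarrow> f (s i) = s (i + 1)"
        show "s 0 \<in> B"
        proof (rule ccontr)
          assume "s 0 \<notin> B"
          then have "s \<in> C n" using s unfolding C_def tR by auto
          with \<open>C n = {}\<close> show False by simp
        qed
      qed
      with no show False by simp
    qed
    show "decseq C"
      by (auto simp: decseq_def C_def)
  qed
  then obtain s where s: "\<And>n. s \<in> C n" by blast
  have sA: "s i \<in> A" for i using s[of 0] unfolding C_def tR by auto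
  have "f (s i) = s (i + 1)" for i
  proof -
    have "i \<in> {- int (nat \<bar>i\<bar> + 1)..<int (nat \<bar>i\<bar> + 1)}" by auto
    then show ?thesis using s[of "nat \<bar>i\<bar> + 1"] unfolding C_def by blast
  qed
  then have "s 0 \<in> Inv f A" unfolding Inv_def using sA by auto
  then have "s 0 \<in> B" using index_pair_facts(11) B(2) by auto
  then show False using s[of 0] by (auto simp: C_def)
qed

text \<open>From level \<open>l\<close> on the coordinates form a backward orbit in
  \<open>N - L\<close>, and from level \<open>l + n\<close> on each of them is the centre of an
  orbit segment of radius \<open>n\<close>, to which the uniform estimate applies.\<close>

lemma W_near_X:
  assumes B: "openin M B" "X \<subseteq> B"
  obtains n where "\<And>\<xi> l j. \<xi> \<in> topspace W \<Longrightarrow> \<xi> l \<noteq> None \<Longrightarrow> l + n \<le> j \<Longrightarrow> \<xi> j \<in> Some ` B"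
proof -
  obtain n :: nat where n: "\<And>s :: int \<Rightarrow> 'a. (\<And>i. s i \<in> A) \<Longrightarrow> (\<And>i. - int n \<le> i \<Longrightarrow> i < int n \<Longrightarrow> f (s i) = s (i + 1)) \<Longrightarrow> s 0 \<in> B"
    using orbit_segment_near_X[OF B] by blast
  show ?thesis
  proof (rule that)
    fix \<xi> l j assume xi: "\<xi> \<in> topspace W" "\<xi> l \<noteq> None" and j: "l + n \<le> j"
    have S: "\<xi> k = Some (the (\<xi> k))" if "k \<ge> l" for k
      using W_not_None[OF xi that] by simp
    \<comment> \<open>Coordinates run backward in time, hence the reversed sign. Clamping at level
      \<open>l\<close> makes the sequence total and acts only beyond the window, as
      \<open>j - n \<ge> l\<close>.\<close>
    define s where "s i = the (\<xi> (nat (max (int l) (int j - i))))" for i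
    have "s 0 \<in> B"
    proof (rule n)
      fix i show "s i \<in> A"
        using W_Some[OF xi(1) S[of "nat (max (int l) (int j - i))"]] A_subset(1)
        unfolding s_def by (meson le_nat_iff max.cobounded1 of_nat_0_le_iff order_trans subsetD)
    next
      fix i assume i: "- int n \<le> i" "i < int n"
      have e: "nat (max (int l) (int j - i)) = Suc (nat (max (int l) (int j - (i + 1))))"
        using i j by (auto simp: max_def)
      show "f (s i) = s (i + 1)"
        unfolding s_def e
        by (rule W_step[OF xi(1) S S]) auto
    qed
    moreover have "s 0 = the (\<xi> j)" using j by (simp add: s_def)
    ultimately show "\<xi> j \<in> Some ` B" using S[of j] j by (metis add_leD1 imageI)
  qed
qed

section \<open>The invariant part, the base point and the attraction towards each\<close>

lemma None_in_Y: "None \<in> topspace Y"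
  by (simp add: topspace_Y)

lemma infty_in_W: "Wu_infty \<in> topspace W"
  by (simp add: topspace_W Wu_infty_def topspace_Y)

abbreviation "Xt \<equiv> Xtilde M f N L X"

lemma closed_Xt: "closedin W Xt"
proof -
  have "closedin Y (Some ` X)" using closed_NL(3) X_subset by (rule closedin_Y_Some)
  then have "closedin W {\<xi> \<in> topspace W. \<xi> i \<in> Some ` X}" for i
    by (rule closedin_continuous_map_preimage[OF continuous_coord])
  then have "closedin W (\<Inter>i. {\<xi> \<in> topspace W. \<xi> i \<in> Some ` X})" by blast
  moreover have "(\<Inter>i. {\<xi> \<in> topspace W. \<xi> i \<in> Some ` X}) = Xt"
    unfolding Xtilde_def by blast
  ultimately show ?thesis by simp
qed

lemma T'_Xt: "\<xi> \<in> Xt \<Longrightarrow> (T' ^^ k) \<xi> \<in> Xt"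
  unfolding Xtilde_def using T'W T'_funpow by auto

lemma T_Xt_iff: "\<xi> \<in> topspace W \<Longrightarrow> T \<xi> \<in> Xt \<longleftrightarrow> \<xi> \<in> Xt"
proof
  assume "\<xi> \<in> topspace W" "T \<xi> \<in> Xt"
  then show "\<xi> \<in> Xt" using T'_Xt[of "T \<xi>" 1] by (simp add: T'_T)
next
  assume xi: "\<xi> \<in> topspace W" "\<xi> \<in> Xt"
  then obtain x where x: "x \<in> X" "\<xi> 0 = Some x" by (auto simp: Xtilde_def)
  have "f x \<in> X" using index_pair_facts(13) x(1) by blast
  then have "g (\<xi> 0) = Some (f x)" using x X_subset by (auto simp: g_Some)
  then have "T \<xi> i \<in> Some ` X" for i
    using xi \<open>f x \<in> X\<close> by (cases i) (auto simp: Xtilde_def)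
  then show "T \<xi> \<in> Xt" using TW[OF xi(1), of 1] by (simp add: Xtilde_def)
qed

lemma T_Xt: "\<xi> \<in> Xt \<Longrightarrow> (T ^^ k) \<xi> \<in> Xt"
proof (induction k)
  case (Suc k)
  then have "(T ^^ k) \<xi> \<in> Xt" "(T ^^ k) \<xi> \<in> topspace W" by (auto simp: Xtilde_def)
  then show ?case using T_Xt_iff by simp
qed simp

lemma T_infty_iff: "\<xi> \<in> topspace W \<Longrightarrow> T \<xi> = Wu_infty \<longleftrightarrow> \<xi> = Wu_infty"
proof
  assume xi: "\<xi> \<in> topspace W" "T \<xi> = Wu_infty"
  then have "T' (T \<xi>) = T' Wu_infty" by simp
  then show "\<xi> = Wu_infty" by (simp add: T'_T) (auto simp: T'_def Wu_infty_def)
next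
  assume "\<xi> = Wu_infty"
  then have "T \<xi> i = None" for i by (cases i) (auto simp: Wu_infty_def)
  then show "T \<xi> = Wu_infty" by (auto simp: Wu_infty_def)
qed

lemma W_eq_infty: "\<xi> \<in> topspace W \<Longrightarrow> \<xi> \<noteq> Wu_infty \<Longrightarrow> \<exists>l. \<xi> l \<noteq> None"
  by (auto simp: Wu_infty_def)

text \<open>The forward iterates of the head and the coordinates splice into a two-sided orbit in
  \<open>N - L\<close>, which therefore lies in \<open>X\<close>.\<close>

lemma Xt_if_never_None:
  assumes xi: "\<xi> \<in> topspace W" and nn: "\<And>j. (T ^^ j) \<xi> 0 \<noteq> None"
  shows "\<xi> \<in> Xt"
proof -
  define s where "s i = the (if i \<ge> 0 then (T ^^ nat i) \<xi> 0 else \<xi> (nat (- i)))" for i :: int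
  have xi0: "\<xi> j \<noteq> None" for j
  proof -
    have "\<xi> 0 \<noteq> None" using nn[of 0] by simp
    then show ?thesis by (rule W_not_None[OF xi]) simp
  qed
  have sA: "s i \<in> N - L" for i
  proof (cases "i \<ge> 0")
    case True
    then show ?thesis using W_Some[OF TW[OF xi, of "nat i"], of 0 "s i"] nn[of "nat i"] by (simp add: s_def)
  next
    case False
    then show ?thesis using W_Some[OF xi, of "nat (- i)" "s i"] xi0[of "nat (- i)"] by (simp add: s_def)
  qed
  have step: "f (s i) = s (i + 1)" for i
  proof (cases "i \<ge> 0")
    case True
    then have e: "nat (i + 1) = Suc (nat i)" by simp
    have "(T ^^ Suc (nat i)) \<xi> 1 = (T ^^ nat i) \<xi> 0" by (simp add: One_nat_def[symmetric] del: One_nat_def) simp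
    then show ?thesis
      using W_step[OF TW[OF xi, of "Suc (nat i)"], of 0 "s i" "s (i + 1)"] nn[of "nat i"] nn[of "Suc (nat i)"] True e
      by (simp add: s_def del: funpow.simps)
  next
    case False
    then have e: "nat (- i) = Suc (nat (- (i + 1)))" by simp
    have "s (i + 1) = the (\<xi> (nat (- (i + 1))))" using False by (cases "i = -1") (auto simp: s_def)
    then show ?thesis
      using W_step[OF xi, of "nat (- (i + 1))" "s i" "s (i + 1)"] xi0[of "Suc (nat (- (i + 1)))"] xi0[of "nat (- (i + 1))"] False e
      by (simp add: s_def)
  qed
  have "s i \<in> Inv f A" for i
    unfolding Inv_def
  proof (intro CollectI conjI exI[of _ "\<lambda>j. s (i + j)"])
    show "s i \<in> A" using sA A_subset by blast
    show "\<forall>j. s (i + j) \<in> A" using sA A_subset by blast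
    show "\<forall>j. f (s (i + j)) = s (i + (j + 1))" using step by (simp add: add.assoc)
  qed simp
  then have "s i \<in> X" for i using index_pair_facts(11) by simp
  moreover have "\<xi> j = Some (s (- int j))" for j
    using xi0[of j] by (cases "j = 0") (auto simp: s_def)
  ultimately show ?thesis using xi by (auto simp: Xtilde_def)
qed

text \<open>Coordinates are known to enter the open set \<open>B\<close>, but leaving has to be an
  open condition on \<open>W\<close>. Leaving the closed set \<open>C\<close> is one, since
  \<open>C\<close> has closed image in the quotient.\<close>

lemma nested_nbhd:
  obtains B C where "openin M B" "closedin M C" "X \<subseteq> B" "B \<subseteq> C" "C \<subseteq> N - L"
proof -
  let ?V = "M interior_of A - L"
  have V: "openin M ?V" "X \<subseteq> ?V" "?V \<subseteq> N - L" using open_nbhd by auto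
  have "compactin M (N - ?V)"
    using index_pair_facts(2) V(1) by (intro closed_compactin[OF index_pair_facts(2)]) (auto intro: closedin_diff closed_NL)
  moreover have "disjnt X (N - ?V)" using V(2) by (auto simp: disjnt_def)
  ultimately obtain B R where BR: "openin M B" "openin M R" "X \<subseteq> B" "N - ?V \<subseteq> R" "disjnt B R"
    using Hausdorff_space_compact_separation[OF M index_pair_facts(12)] by metis
  show ?thesis
  proof (rule that)
    show "openin M (B \<inter> ?V)" using BR V by (intro openin_Int)
    show "closedin M (N - R)" using closed_NL(1) BR(2) by (rule closedin_diff)
    show "X \<subseteq> B \<inter> ?V" using BR V by blast
    show "B \<inter> ?V \<subseteq> N - R" using BR V by (auto simp: disjnt_def)
    show "N - R \<subseteq> N - L" using BR V by blast
  qed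
qed

text \<open>Reaching the base point is final in forward time: the shift moves the entry
  \<open>None\<close> to a higher index, and it forces \<open>None\<close> at all lower
  ones.\<close>

lemma T_None_mono: "\<xi> \<in> topspace W \<Longrightarrow> (T ^^ j) \<xi> i = None \<Longrightarrow> j \<le> k \<Longrightarrow> (T ^^ k) \<xi> i = None"
proof -
  assume xi: "\<xi> \<in> topspace W" and N: "(T ^^ j) \<xi> i = None" and "j \<le> k"
  have "(T ^^ k) \<xi> (k - j + i) = (T ^^ (k - j)) ((T ^^ j) \<xi>) (k - j + i)"
    using \<open>j \<le> k\<close> by (metis comp_apply funpow_add le_add_diff_inverse2)
  then have "(T ^^ k) \<xi> (k - j + i) = None" using N by (simp only: T_funpow)
  then show ?thesis using W_not_None[OF TW[OF xi], of k i "k - j + i"] by (metis le_add2)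
qed

text \<open>The closed sets where coordinate \<open>i\<close> is \<open>None\<close> decrease as
  \<open>i\<close> grows and meet only in \<open>Wu_infty\<close>, so by compactness one of them
  lies in \<open>G\<close>.\<close>

lemma coord_nbhd_infty:
  assumes G: "openin W G" "Wu_infty \<in> G"
  obtains i where "\<And>\<xi>. \<xi> \<in> topspace W \<Longrightarrow> \<xi> i = None \<Longrightarrow> \<xi> \<in> G"
proof -
  have K: "compactin W (topspace W - G)"
    by (rule closedin_compact_space[OF compact_W]) (use G in auto)
  have op: "openin W {\<xi> \<in> topspace W. \<xi> i \<in> topspace Y - {None}}" for i
    by (rule openin_continuous_map_preimage[OF continuous_coord]) (use closedin_None in auto)
  have "\<exists>l. \<xi> l \<noteq> None" if "\<xi> \<in> topspace W - G" for \<xi>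
    using W_eq_infty[of \<xi>] that G(2) by auto
  then obtain l where l: "\<And>\<xi>. \<xi> \<in> topspace W - G \<Longrightarrow> \<xi> (l \<xi>) \<noteq> None" by metis
  obtain F where F: "finite F" "F \<subseteq> topspace W - G"
      "topspace W - G \<subseteq> (\<Union>\<eta>\<in>F. {\<xi> \<in> topspace W. \<xi> (l \<eta>) \<in> topspace Y - {None}})"
  proof (rule compactin_finite_point_cover[OF K, of "\<lambda>\<eta>. {\<xi> \<in> topspace W. \<xi> (l \<eta>) \<in> topspace Y - {None}}"])
    show "openin W {\<xi> \<in> topspace W. \<xi> (l \<eta>) \<in> topspace Y - {None}} \<and> \<eta> \<in> {\<xi> \<in> topspace W. \<xi> (l \<eta>) \<in> topspace Y - {None}}"
      if "\<eta> \<in> topspace W - G" for \<eta>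
      using op l[OF that] that W_Y by auto
  qed blast
  define i where "i = Max (insert 0 (l ` F))"
  show ?thesis
  proof (rule that)
    fix \<xi> assume xi: "\<xi> \<in> topspace W" "\<xi> i = None"
    show "\<xi> \<in> G"
    proof (rule ccontr)
      assume "\<xi> \<notin> G"
      then obtain \<eta> where "\<eta> \<in> F" "\<xi> (l \<eta>) \<noteq> None" using F(3) xi(1) by blast
      moreover have "l \<eta> \<le> i" unfolding i_def by (rule Max_ge) (use F(1) \<open>\<eta> \<in> F\<close> in auto)
      ultimately show False using W_not_None[OF xi(1)] xi(2) by blast
    qed
  qed
qed

text \<open>Points outside \<open>G\<close> reach the base point in bounded time, so a point whose
  head survives long enough lies in \<open>G\<close>. High powers of \<open>T'\<close> ensure
  survival, since the coordinates of a point record its future after such a shift.\<close>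

lemma attract_X:
  assumes G: "openin W G" "Xt \<subseteq> G" and x: "\<eta> \<in> topspace W - {Wu_infty}"
  shows "\<exists>B n. openin W B \<and> \<eta> \<in> B \<and> (\<forall>j\<ge>n. (T' ^^ j) ` B \<subseteq> G)"
proof -
  obtain B C where BC: "openin M B" "closedin M C" "X \<subseteq> B" "B \<subseteq> C" "C \<subseteq> N - L"
    using nested_nbhd by metis
  obtain n where n: "\<And>\<xi> l j. \<xi> \<in> topspace W \<Longrightarrow> \<xi> l \<noteq> None \<Longrightarrow> l + n \<le> j \<Longrightarrow> \<xi> j \<in> Some ` B"
    using W_near_X[OF BC(1,3)] by blast
  have K: "compactin W (topspace W - G)"
    by (rule closedin_compact_space[OF compact_W]) (use G in auto)
  have cT: "continuous_map W Y (\<lambda>\<xi>. (T ^^ j) \<xi> 0)" for j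
    using continuous_map_compose[OF continuous_map_funpow[OF continuous_T, of j] continuous_coord[of 0]]
    by (simp add: o_def)
  have op: "openin W {\<xi> \<in> topspace W. (T ^^ j) \<xi> 0 \<in> topspace Y - Some ` C}" for j
    by (rule openin_continuous_map_preimage[OF cT]) (use closedin_Y_Some[OF BC(2,5)] in auto)
  have "\<exists>j. (T ^^ j) \<xi> 0 = None" if "\<xi> \<in> topspace W - G" for \<xi>
    using Xt_if_never_None[of \<xi>] that G(2) by (metis DiffD1 DiffD2 subsetD)
  then obtain l where l: "\<And>\<xi>. \<xi> \<in> topspace W - G \<Longrightarrow> (T ^^ l \<xi>) \<xi> 0 = None" by metis
  obtain F where F: "finite F" "F \<subseteq> topspace W - G"
      "topspace W - G \<subseteq> (\<Union>\<eta>\<in>F. {\<xi> \<in> topspace W. (T ^^ l \<eta>) \<xi> 0 \<in> topspace Y - Some ` C})"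
  proof (rule compactin_finite_point_cover[OF K, of "\<lambda>\<eta>. {\<xi> \<in> topspace W. (T ^^ l \<eta>) \<xi> 0 \<in> topspace Y - Some ` C}"])
    show "openin W {\<xi> \<in> topspace W. (T ^^ l \<eta>) \<xi> 0 \<in> topspace Y - Some ` C} \<and>
        \<eta> \<in> {\<xi> \<in> topspace W. (T ^^ l \<eta>) \<xi> 0 \<in> topspace Y - Some ` C}"
      if "\<eta> \<in> topspace W - G" for \<eta>
      using op l[OF that] that None_in_Y by auto
  qed blast
  define J where "J = Max (insert 0 (l ` F))"
  \<comment> \<open>For a point outside \<open>G\<close>, compactness puts the head outside
    \<open>C\<close> at some time at most \<open>J\<close>. Were the head not \<open>None\<close>
    after \<open>n\<close> more steps, \<open>W_near_X\<close> would place that earlier head in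
    \<open>B\<close>; and \<open>None\<close> persists up to time \<open>n + J\<close>.\<close>
  have out: "\<xi> \<in> G" if xi: "\<xi> \<in> topspace W" "(T ^^ (n + J)) \<xi> 0 \<noteq> None" for \<xi>
  proof (rule ccontr)
    assume "\<xi> \<notin> G"
    then obtain \<eta> where eta: "\<eta> \<in> F" "(T ^^ l \<eta>) \<xi> 0 \<notin> Some ` C" using F(3) xi(1) by blast
    have lJ: "l \<eta> \<le> J" unfolding J_def by (rule Max_ge) (use F(1) eta in auto)
    have "(T ^^ (n + l \<eta>)) \<xi> n = (T ^^ l \<eta>) \<xi> 0"
      using T_funpow[of n "(T ^^ l \<eta>) \<xi>" 0] by (simp add: funpow_add)
    then have "(T ^^ (n + l \<eta>)) \<xi> n \<notin> Some ` B" using eta(2) BC(4) by auto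
    then have "(T ^^ (n + l \<eta>)) \<xi> 0 = None"
      using n[OF TW[OF xi(1)], of "n + l \<eta>" 0 n] by auto
    then have "(T ^^ (n + J)) \<xi> 0 = None" by (rule T_None_mono[OF xi(1)]) (use lJ in auto)
    with xi(2) show False by simp
  qed
  obtain k where k: "\<eta> k \<noteq> None" using W_eq_infty x by blast
  define U where "U = {\<xi> \<in> topspace W. \<xi> k \<in> topspace Y - {None}}"
  have U: "openin W U" unfolding U_def
    by (rule openin_continuous_map_preimage[OF continuous_coord]) (use closedin_None in auto)
  have "(T' ^^ j) \<xi> \<in> G" if "\<xi> \<in> U" "j \<ge> n + J + k" for \<xi> j
  proof (rule out)
    have xi: "\<xi> \<in> topspace W" "\<xi> k \<noteq> None" using that by (auto simp: U_def)
    show "(T' ^^ j) \<xi> \<in> topspace W" using T'W[OF xi(1)] .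
    have "(T' ^^ j) \<xi> = (T' ^^ (n + J)) ((T' ^^ (j - (n + J))) \<xi>)"
      using that(2) by (metis add_leD1 comp_apply funpow_add le_add_diff_inverse)
    then have "(T ^^ (n + J + 0)) ((T' ^^ j) \<xi>) = (T ^^ 0) ((T' ^^ (j - (n + J))) \<xi>)"
      using funpow_left_inverse[OF continuous_T continuous_T' T_T' T'W[OF xi(1)], of "n + J" 0 "j - (n + J)"] by simp
    then have "(T ^^ (n + J)) ((T' ^^ j) \<xi>) 0 = \<xi> (j - (n + J))" by (simp add: T'_funpow)
    then show "(T ^^ (n + J)) ((T' ^^ j) \<xi>) 0 \<noteq> None"
      using W_not_None[OF xi, of "j - (n + J)"] that(2) by simp
  qed
  moreover have "\<eta> \<in> U" using x k W_Y by (auto simp: U_def)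
  ultimately show ?thesis using U by (intro exI[of _ U] exI[of _ "n + J + k"]) auto
qed

text \<open>A point off \<open>Xt\<close> has its head leave \<open>C\<close> at some time
  \<open>l\<close>, an open condition. After \<open>n\<close> further steps the head is
  \<open>None\<close>, and \<open>i\<close> more steps carry this to coordinate \<open>i\<close>,
  which suffices for membership in \<open>G\<close>.\<close>

lemma attract_infty:
  assumes G: "openin W G" "{Wu_infty} \<subseteq> G" and x: "\<eta> \<in> topspace W - Xt"
  shows "\<exists>B n. openin W B \<and> \<eta> \<in> B \<and> (\<forall>j\<ge>n. (T ^^ j) ` B \<subseteq> G)"
proof -
  obtain B C where BC: "openin M B" "closedin M C" "X \<subseteq> B" "B \<subseteq> C" "C \<subseteq> N - L"
    using nested_nbhd by metis
  obtain n where n: "\<And>\<xi> l j. \<xi> \<in> topspace W \<Longrightarrow> \<xi> l \<noteq> None \<Longrightarrow> l + n \<le> j \<Longrightarrow> \<xi> j \<in> Some ` B"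
    using W_near_X[OF BC(1,3)] by blast
  obtain i where i: "\<And>\<xi>. \<xi> \<in> topspace W \<Longrightarrow> \<xi> i = None \<Longrightarrow> \<xi> \<in> G"
    using coord_nbhd_infty[OF G(1)] G(2) by blast
  obtain l where l: "(T ^^ l) \<eta> 0 = None" using Xt_if_never_None[of \<eta>] x by (metis DiffD1 DiffD2)
  have cT: "continuous_map W Y (\<lambda>\<xi>. (T ^^ l) \<xi> 0)"
    using continuous_map_compose[OF continuous_map_funpow[OF continuous_T, of l] continuous_coord[of 0]]
    by (simp add: o_def)
  define U where "U = {\<xi> \<in> topspace W. (T ^^ l) \<xi> 0 \<in> topspace Y - Some ` C}"
  have U: "openin W U" unfolding U_def
    by (rule openin_continuous_map_preimage[OF cT]) (use closedin_Y_Some[OF BC(2,5)] in auto)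
  have "(T ^^ j) \<xi> \<in> G" if "\<xi> \<in> U" "j \<ge> i + (n + l)" for \<xi> j
  proof (rule i)
    have xi: "\<xi> \<in> topspace W" "(T ^^ l) \<xi> 0 \<notin> Some ` B" using that BC(4) by (auto simp: U_def)
    show "(T ^^ j) \<xi> \<in> topspace W" using TW[OF xi(1)] .
    have "(T ^^ (n + l)) \<xi> n = (T ^^ l) \<xi> 0"
      using T_funpow[of n "(T ^^ l) \<xi>" 0] by (simp add: funpow_add)
    then have "(T ^^ (n + l)) \<xi> 0 = None"
      using n[OF TW[OF xi(1)], of "n + l" 0 n] xi(2) by auto
    moreover have "(T ^^ (i + (n + l))) \<xi> i = (T ^^ (n + l)) \<xi> 0"
      using T_funpow[of i "(T ^^ (n + l)) \<xi>" 0] by (simp add: funpow_add)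
    ultimately have "(T ^^ (i + (n + l))) \<xi> i = None" by simp
    then show "(T ^^ j) \<xi> i = None" by (rule T_None_mono[OF xi(1)]) (use that(2) in simp)
  qed
  moreover have "\<eta> \<in> U" using x l None_in_Y by (auto simp: U_def)
  ultimately show ?thesis using U by (intro exI[of _ U] exI[of _ "i + (n + l)"]) auto
qed

lemma attractor_repeller_W: "attractor_repeller W Xt {Wu_infty} T T'"
proof
  show "compact_space W" "Hausdorff_space W" "closedin W Xt" "continuous_map W W T" "continuous_map W W T'"
    by (rule compact_W Hausdorff_W closed_Xt continuous_T continuous_T')+
  show "closedin W {Wu_infty}"
    by (rule compactin_imp_closedin[OF Hausdorff_W finite_imp_compactin]) (use infty_in_W in auto)
  show "Xt \<inter> {Wu_infty} = {}"
    by (auto simp: Xtilde_def Wu_infty_def)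
  show "T (T' \<xi>) = \<xi>" "T' (T \<xi>) = \<xi>" "T \<xi> \<in> Xt \<longleftrightarrow> \<xi> \<in> Xt" "T \<xi> \<in> {Wu_infty} \<longleftrightarrow> \<xi> \<in> {Wu_infty}"
    if "\<xi> \<in> topspace W" for \<xi>
    using that T_T' T'_T T_Xt_iff T_infty_iff by auto
qed (rule attract_X attract_infty; assumption)+

section \<open>Continuity of cohomology\<close>

lemma continuous_g_funpow: "continuous_map Y Y (g ^^ k)"
  using continuous_g by (rule continuous_map_funpow)

text \<open>In an inverse limit a coordinate determines all those of lower index through iterates of
  the bonding map, so finitely many conditions collapse to one at the highest level.\<close>

lemma W_basis:
  assumes V: "openin W V" "\<xi> \<in> V"
  obtains l U where "openin Y U" "\<xi> l \<in> U" "\<And>\<eta>. \<eta> \<in> topspace W \<Longrightarrow> \<eta> l \<in> U \<Longrightarrow> \<eta> \<in> V"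
proof -
  let ?R = "product_topology (\<lambda>_::nat. Y) UNIV"
  obtain V' where V': "openin ?R V'" "V = V' \<inter> {\<xi>. \<forall>i. g (\<xi> (Suc i)) = \<xi> i}"
    using V(1) unfolding Wu_def openin_subtopology by blast
  obtain B where B: "\<xi> \<in> (\<Pi>\<^sub>E i\<in>UNIV. B i)" "\<forall>i. openin Y (B i)" "finite {i. B i \<noteq> topspace Y}" "(\<Pi>\<^sub>E i\<in>UNIV. B i) \<subseteq> V'"
    using product_topology_open_contains_basis[OF V'(1), of \<xi>] V V'(2) by auto
  define l where "l = Max (insert 0 {i. B i \<noteq> topspace Y})"
  have l: "i \<le> l" if "B i \<noteq> topspace Y" for i
    unfolding l_def by (rule Max_ge) (use B(3) that in auto)
  define U where "U = (\<Inter>i\<in>{..l}. {y \<in> topspace Y. (g ^^ (l - i)) y \<in> B i})"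
  have xi: "\<xi> \<in> topspace W" using V openin_subset by blast
  have c: "(g ^^ (l - i)) (\<eta> l) = \<eta> i" if "\<eta> \<in> topspace W" "i \<le> l" for \<eta> i
    using W_funpow_g[OF that(1), of "l - i" i] that(2) by simp
  show ?thesis
  proof (rule that)
    show "openin Y U" unfolding U_def
      by (intro openin_INT2 openin_continuous_map_preimage[OF continuous_g_funpow]) (use B(2) in auto)
    show "\<xi> l \<in> U" using B(1) c[OF xi] W_Y[OF xi] by (auto simp: U_def)
    fix \<eta> assume eta: "\<eta> \<in> topspace W" "\<eta> l \<in> U"
    have "\<eta> i \<in> B i" for i
    proof (cases "B i = topspace Y")
      case True
      then show ?thesis using W_Y[OF eta(1)] by simp
    next
      case False
      then have "(g ^^ (l - i)) (\<eta> l) \<in> B i" using eta(2) l[OF False] by (simp add: U_def)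
      then show ?thesis using c[OF eta(1) l[OF False]] by simp
    qed
    then have "\<eta> \<in> V'" using B(4) by auto
    then show "\<eta> \<in> V" using V'(2) eta(1) by (auto simp: topspace_W)
  qed
qed

text \<open>By compactness finitely many basic sets suffice; their levels are dominated by the
  maximum, so one coordinate is fine enough for the whole cover.\<close>

lemma W_uniform_level:
  assumes S: "compactin W S" and V: "\<And>\<xi>. \<xi> \<in> S \<Longrightarrow> openin W (V \<xi>) \<and> \<xi> \<in> V \<xi>"
  obtains l where "\<And>\<xi>. \<xi> \<in> S \<Longrightarrow> \<exists>U. openin Y U \<and> \<xi> l \<in> U \<and> (\<exists>\<zeta>\<in>S. \<forall>\<eta>\<in>topspace W. \<eta> l \<in> U \<longrightarrow> \<eta> \<in> V \<zeta>)"
proof -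
  have "\<exists>l U. openin Y U \<and> \<xi> l \<in> U \<and> (\<forall>\<eta>\<in>topspace W. \<eta> l \<in> U \<longrightarrow> \<eta> \<in> V \<xi>)" if xi: "\<xi> \<in> S" for \<xi>
  proof -
    have "openin W (V \<xi>)" "\<xi> \<in> V \<xi>" using V[OF xi] by auto
    from W_basis[OF this] show ?thesis by metis
  qed
  then obtain k U where k: "\<And>\<xi>. \<xi> \<in> S \<Longrightarrow> openin Y (U \<xi>) \<and> \<xi> (k \<xi>) \<in> U \<xi> \<and> (\<forall>\<eta>\<in>topspace W. \<eta> (k \<xi>) \<in> U \<xi> \<longrightarrow> \<eta> \<in> V \<xi>)"
    by metis
  have SW: "S \<subseteq> topspace W" using S by (rule compactin_subset_topspace)
  obtain F where F: "finite F" "F \<subseteq> S" "S \<subseteq> (\<Union>\<zeta>\<in>F. {\<eta> \<in> topspace W. \<eta> (k \<zeta>) \<in> U \<zeta>})"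
  proof (rule compactin_finite_point_cover[OF S, of "\<lambda>\<zeta>. {\<eta> \<in> topspace W. \<eta> (k \<zeta>) \<in> U \<zeta>}"])
    show "openin W {\<eta> \<in> topspace W. \<eta> (k \<zeta>) \<in> U \<zeta>} \<and> \<zeta> \<in> {\<eta> \<in> topspace W. \<eta> (k \<zeta>) \<in> U \<zeta>}" if "\<zeta> \<in> S" for \<zeta>
      using k[OF that] openin_continuous_map_preimage[OF continuous_coord] that SW by auto
  qed blast
  define l where "l = Max (insert 0 (k ` F))"
  show ?thesis
  proof (rule that)
    fix \<xi> assume xi: "\<xi> \<in> S"
    then obtain \<zeta> where z: "\<zeta> \<in> F" "\<xi> (k \<zeta>) \<in> U \<zeta>" using F(3) by blast
    have kl: "k \<zeta> \<le> l" unfolding l_def by (rule Max_ge) (use F(1) z in auto)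
    have c: "(g ^^ (l - k \<zeta>)) (\<eta> l) = \<eta> (k \<zeta>)" if "\<eta> \<in> topspace W" for \<eta>
      using W_funpow_g[OF that, of "l - k \<zeta>" "k \<zeta>"] kl by simp
    have zS: "\<zeta> \<in> S" using z(1) F(2) by blast
    let ?U = "{y \<in> topspace Y. (g ^^ (l - k \<zeta>)) y \<in> U \<zeta>}"
    have "openin Y ?U"
      using openin_continuous_map_preimage[OF continuous_g_funpow] k[OF zS] by blast
    moreover have "\<xi> l \<in> ?U" using c W_Y z(2) xi SW by auto
    moreover have "\<forall>\<eta>\<in>topspace W. \<eta> l \<in> ?U \<longrightarrow> \<eta> \<in> V \<zeta>"
      using c k[OF zS] by auto
    ultimately show "\<exists>U. openin Y U \<and> \<xi> l \<in> U \<and> (\<exists>\<zeta>\<in>S. \<forall>\<eta>\<in>topspace W. \<eta> l \<in> U \<longrightarrow> \<eta> \<in> V \<zeta>)"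
      using zS by blast
  qed
qed

text \<open>The images of the iterates of \<open>g\<close> shrink to the set of heads of points of
  \<open>W\<close>. Were none of them inside \<open>G\<close>, a nested intersection of compact sets
  of partial threads would give a point of \<open>W\<close> with head outside
  \<open>G\<close>.\<close>

lemma image_stabilises:
  assumes G: "openin Y G" and sub: "\<And>\<xi>. \<xi> \<in> topspace W \<Longrightarrow> \<xi> 0 \<in> G"
  obtains k where "(g ^^ k) ` topspace Y \<subseteq> G"
proof (rule ccontr)
  assume no: "\<not> thesis"
  let ?R = "product_topology (\<lambda>_::nat. Y) UNIV"
  have tR: "topspace ?R = {\<xi>. \<forall>i. \<xi> i \<in> topspace Y}" by (auto simp: PiE_iff)
  have pr: "continuous_map ?R Y (\<lambda>\<xi>. \<xi> i)" for i by (rule continuous_map_product_projection) simp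
  define C where "C n = \<Inter>(insert {\<xi> \<in> topspace ?R. \<xi> 0 \<in> topspace Y - G} ((\<lambda>i. {\<xi> \<in> topspace ?R. g (\<xi> (Suc i)) = \<xi> i}) ` {..<n}))" for n
  have R: "compact_space ?R" by (simp add: compact_space_product_topology compact_Y)
  have gY: "(g ^^ k) y \<in> topspace Y" if "y \<in> topspace Y" for k y
    using that continuous_g_funpow[of k] by (auto simp: continuous_map_def)
  have "(\<Inter>n. C n) \<noteq> {}"
  proof (rule compact_space_imp_nest[OF R])
    fix n
    have 0: "closedin ?R {\<xi> \<in> topspace ?R. \<xi> 0 \<in> topspace Y - G}"
      by (rule closedin_continuous_map_preimage[OF pr]) (use G in auto)
    have 1: "closedin ?R {\<xi> \<in> topspace ?R. g (\<xi> (Suc i)) = \<xi> i}" for i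
      by (rule closedin_continuous_maps_eq[OF Hausdorff_Y _ pr])
         (rule continuous_map_compose[OF pr continuous_g, unfolded o_def])
    show "closedin ?R (C n)"
      unfolding C_def by (rule closedin_Inter) (use 0 1 in \<open>blast+\<close>)
    have "\<not> (g ^^ n) ` topspace Y \<subseteq> G" using no that by blast
    then obtain y where y: "y \<in> topspace Y" "(g ^^ n) y \<notin> G" by blast
    define \<xi> where "\<xi> i = (g ^^ (n - i)) y" for i
    have "g (\<xi> (Suc i)) = \<xi> i" if "i < n" for i
    proof -
      have "n - i = Suc (n - Suc i)" using that by simp
      then show ?thesis by (simp add: \<xi>_def)
    qed
    then have "\<xi> \<in> C n" using y gY[OF y(1)] by (auto simp: C_def tR \<xi>_def)
    then show "C n \<noteq> {}" by blast
  next
    show "decseq C" unfolding decseq_def C_def by auto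
  qed
  then obtain \<xi> where xi: "\<And>n. \<xi> \<in> C n" by blast
  have "\<xi> \<in> topspace ?R" "\<xi> 0 \<notin> G" using xi[of 0] by (auto simp: C_def)
  moreover have "g (\<xi> (Suc i)) = \<xi> i" for i using xi[of "Suc i"] by (auto simp: C_def)
  ultimately have "\<xi> \<in> topspace W" unfolding topspace_W tR by blast
  with sub \<open>\<xi> 0 \<notin> G\<close> show False by blast
qed

text \<open>A cocycle on \<open>W\<close> descends, via a discontinuous section \<open>s\<close>, to the image \<open>K\<close> of a coordinate
  projection, extends to a neighbourhood of \<open>K\<close> by the retraction \<open>r\<close>, and is pulled back to all of
  \<open>N/L\<close> by an iterate of the index map with image in that neighbourhood.\<close>

lemma cocycle_from_level:
  fixes \<phi> :: "(nat \<Rightarrow> 'a option) \<Rightarrow> (nat \<Rightarrow> 'a option) \<Rightarrow> 'k::field"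
  assumes phi: "\<phi> \<in> as_cocycles W {}"
  obtains l \<theta> where "\<theta> \<in> as_cocycles Y {}"
    "(\<lambda>\<xi> \<eta>. \<phi> \<xi> \<eta> - \<theta> (\<xi> l) (\<eta> l)) \<in> as_coboundaries W {}"
proof -
  have "\<exists>V w. openin W V \<and> \<xi> \<in> V \<and> (\<forall>a\<in>V. \<forall>b\<in>V. \<phi> a b = w b - w a)" if xi: "\<xi> \<in> topspace W" for \<xi>
  proof -
    have "\<exists>w. near W \<xi> (\<lambda>a b. \<phi> a b = w b - w a)"
      using phi xi by (auto simp: as_cocycles_def)
    then obtain w where "near W \<xi> (\<lambda>a b. \<phi> a b = w b - w a)" ..
    then show ?thesis unfolding near_def by auto
  qed
  then obtain V where V: "\<And>\<xi>. \<xi> \<in> topspace W \<Longrightarrow> openin W (V \<xi>) \<and> \<xi> \<in> V \<xi>"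
      and V': "\<And>\<xi>. \<xi> \<in> topspace W \<Longrightarrow> \<exists>w. \<forall>a\<in>V \<xi>. \<forall>b\<in>V \<xi>. \<phi> a b = w b - w a"
    by metis
  obtain l where l: "\<And>\<xi>. \<xi> \<in> topspace W \<Longrightarrow> \<exists>U. openin Y U \<and> \<xi> l \<in> U \<and> (\<exists>\<zeta>\<in>topspace W. \<forall>\<eta>\<in>topspace W. \<eta> l \<in> U \<longrightarrow> \<eta> \<in> V \<zeta>)"
    using W_uniform_level[of "topspace W" V] V compact_W unfolding compact_space_def by blast
  \<comment> \<open>Sets at level \<open>l\<close> over which \<open>\<phi>\<close> has a primitive.
    The primitive lives on \<open>W\<close> and may vary over a single coordinate, so a section is
    needed in order to descend.\<close>
  define \<O> where "\<O> = {U. \<exists>w. \<forall>\<xi>\<in>topspace W. \<forall>\<eta>\<in>topspace W. \<xi> l \<in> U \<longrightarrow> \<eta> l \<in> U \<longrightarrow> \<phi> \<xi> \<eta> = w \<eta> - w \<xi>}"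
  define K where "K = (\<lambda>\<xi>. \<xi> l) ` topspace W"
  have "compactin W (topspace W)" using compact_W by (simp add: compact_space_def)
  then have "compactin Y K" unfolding K_def by (rule image_compactin) (rule continuous_coord)
  then have K: "closedin Y K" by (rule compactin_imp_closedin[OF Hausdorff_Y])
  have cov: "\<exists>U\<in>\<O>. openin Y U \<and> y \<in> U" if y: "y \<in> K" for y
  proof -
    obtain \<xi> where xi: "\<xi> \<in> topspace W" "y = \<xi> l" using y by (auto simp: K_def)
    obtain U \<zeta> where U: "openin Y U" "\<xi> l \<in> U" "\<zeta> \<in> topspace W" "\<And>\<eta>. \<eta> \<in> topspace W \<Longrightarrow> \<eta> l \<in> U \<Longrightarrow> \<eta> \<in> V \<zeta>"
      using l[OF xi(1)] by blast
    obtain w where w: "\<forall>a\<in>V \<zeta>. \<forall>b\<in>V \<zeta>. \<phi> a b = w b - w a" using V'[OF U(3)] ..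
    have "U \<in> \<O>" unfolding \<O>_def
      by (intro CollectI exI[of _ w]) (use w U(4) in auto)
    with U xi show ?thesis by auto
  qed
  obtain G r where G: "openin Y G" "K \<subseteq> G" "r ` G \<subseteq> K" "\<And>y. y \<in> K \<Longrightarrow> r y = y"
    and loc: "\<And>y. y \<in> G \<Longrightarrow> \<exists>V. \<exists>O'\<in>\<O>. openin Y V \<and> y \<in> V \<and> V \<subseteq> G \<and> V \<subseteq> O' \<and> r ` V \<subseteq> O'"
    using cover_retraction[OF compact_Y Hausdorff_Y K cov] by blast
  \<comment> \<open>The \<open>l\<close>-fold shift moves the head to coordinate \<open>l\<close>,
    so heads lie in \<open>K\<close> as well, and some iterate of \<open>g\<close> maps all of
    \<open>Y\<close> into \<open>G\<close>.\<close>
  have "\<xi> 0 \<in> G" if xi: "\<xi> \<in> topspace W" for \<xi>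
  proof -
    have "(T ^^ l) \<xi> l \<in> K" unfolding K_def using TW[OF xi] by blast
    moreover have "(T ^^ l) \<xi> l = \<xi> 0" using T_funpow[of l \<xi> 0] by simp
    ultimately show ?thesis using G(2) by auto
  qed
  then obtain k where k: "(g ^^ k) ` topspace Y \<subseteq> G" using image_stabilises[OF G(1)] by blast
  define s where "s y = (SOME \<xi>. \<xi> \<in> topspace W \<and> \<xi> l = y)" for y
  have s: "s y \<in> topspace W \<and> s y l = y" if "y \<in> K" for y
  proof -
    obtain \<xi> where "\<xi> \<in> topspace W \<and> \<xi> l = y" using \<open>y \<in> K\<close> by (auto simp: K_def)
    then show ?thesis unfolding s_def by (rule someI[of "\<lambda>\<xi>. \<xi> \<in> topspace W \<and> \<xi> l = y"])
  qed
  define q where "q y = s (r ((g ^^ k) y))" for y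
  \<comment> \<open>One primitive \<open>w\<close> must serve both the points over \<open>U\<close>
    and the representatives \<open>s (r z)\<close> with which they are compared; for this the
    retraction has to respect the cover.\<close>
  define LP where "LP U w \<longleftrightarrow>
      (\<forall>\<xi>\<in>topspace W. \<forall>\<eta>\<in>topspace W. (\<xi> l \<in> U \<or> (\<exists>z\<in>U. \<xi> = s (r z))) \<longrightarrow> (\<eta> l \<in> U \<or> (\<exists>z\<in>U. \<eta> = s (r z))) \<longrightarrow> \<phi> \<xi> \<eta> = w \<eta> - w \<xi>)" for U w
  have locp: "\<exists>U w. openin Y U \<and> y \<in> U \<and> U \<subseteq> G \<and> LP U w"
    if y: "y \<in> G" for y
  proof -
    obtain U O' where U: "O' \<in> \<O>" "openin Y U" "y \<in> U" "U \<subseteq> G" "U \<subseteq> O'" "r ` U \<subseteq> O'" using loc[OF y] by blast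
    have "\<exists>w. \<forall>\<xi>\<in>topspace W. \<forall>\<eta>\<in>topspace W. \<xi> l \<in> O' \<longrightarrow> \<eta> l \<in> O' \<longrightarrow> \<phi> \<xi> \<eta> = w \<eta> - w \<xi>"
      using U(1) by (simp add: \<O>_def)
    then obtain w where w: "\<forall>\<xi>\<in>topspace W. \<forall>\<eta>\<in>topspace W. \<xi> l \<in> O' \<longrightarrow> \<eta> l \<in> O' \<longrightarrow> \<phi> \<xi> \<eta> = w \<eta> - w \<xi>" ..
    have in_O: "\<xi> l \<in> O'" if "\<xi> l \<in> U \<or> (\<exists>z\<in>U. \<xi> = s (r z))" for \<xi>
      using that
    proof
      assume "\<exists>z\<in>U. \<xi> = s (r z)"
      then obtain z where "z \<in> U" "\<xi> = s (r z)" by blast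
      then show ?thesis using s[of "r z"] U(4,6) G(3) by (metis image_subset_iff subsetD)
    qed (use U(5) in blast)
    show ?thesis
      unfolding LP_def by (intro exI[of _ U] exI[of _ w]) (use U w in_O in simp)
  qed
  show ?thesis
  proof (rule that)
    show "(\<lambda>y z. \<phi> (q y) (q z)) \<in> as_cocycles Y {}"
      unfolding as_cocycles_def
    proof (intro CollectI conjI ballI)
      fix y assume y: "y \<in> topspace Y"
      then have "(g ^^ k) y \<in> G" using k by blast
      then obtain U w where U: "openin Y U" "(g ^^ k) y \<in> U" "U \<subseteq> G" and "LP U w"
        using locp by metis
      then have w: "\<forall>\<xi>\<in>topspace W. \<forall>\<eta>\<in>topspace W. (\<xi> l \<in> U \<or> (\<exists>z\<in>U. \<xi> = s (r z))) \<longrightarrow> (\<eta> l \<in> U \<or> (\<exists>z\<in>U. \<eta> = s (r z))) \<longrightarrow> \<phi> \<xi> \<eta> = w \<eta> - w \<xi>"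
        by (simp add: LP_def)
      have "near Y y (\<lambda>a b. (g ^^ k) a \<in> U \<and> (g ^^ k) b \<in> U)"
        by (rule near_pullback[OF continuous_g_funpow y near_open[OF U(1,2)]])
      then have "near Y y (\<lambda>a b. \<phi> (q a) (q b) = w (q b) - w (q a))"
      proof (rule near_mono)
        fix a b assume ab: "(g ^^ k) a \<in> U \<and> (g ^^ k) b \<in> U"
        then have "q a \<in> topspace W" "q b \<in> topspace W"
          using s U(3) G(3) unfolding q_def by blast+
        then show "\<phi> (q a) (q b) = w (q b) - w (q a)"
          using w ab unfolding q_def by blast
      qed
      then show "\<exists>w. near Y y (\<lambda>a b. \<phi> (q a) (q b) = w b - w a)"
        by (intro exI[of _ "\<lambda>a. w (q a)"])
    qed simp
    \<comment> \<open>From level \<open>k + l\<close> the \<open>k\<close> iterates of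
      \<open>g\<close> lead back to coordinate \<open>l\<close>, which lies in \<open>K\<close>,
      where \<open>r\<close> is the identity. The descended cocycle thus differs from
      \<open>\<phi>\<close> only by the choice of the section, and
      \<open>\<phi> (s (\<xi> l)) \<xi>\<close> is the primitive.\<close>
    have qk: "q (\<xi> (k + l)) = s (\<xi> l)" if "\<xi> \<in> topspace W" for \<xi>
      unfolding q_def using W_funpow_g[OF that, of k l] G(4)[of "\<xi> l"] that by (simp add: K_def)
    have "near W \<xi> (\<lambda>a b. \<phi> a b - \<phi> (q (a (k + l))) (q (b (k + l))) = \<phi> (s (b l)) b - \<phi> (s (a l)) a)"
      if xi: "\<xi> \<in> topspace W" for \<xi>
    proof -
      have "\<xi> l \<in> G" using xi G(2) by (auto simp: K_def)
      then obtain U w where U: "openin Y U" "\<xi> l \<in> U" "U \<subseteq> G" and "LP U w"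
        using locp by metis
      then have w: "\<forall>\<xi>\<in>topspace W. \<forall>\<eta>\<in>topspace W. (\<xi> l \<in> U \<or> (\<exists>z\<in>U. \<xi> = s (r z))) \<longrightarrow> (\<eta> l \<in> U \<or> (\<exists>z\<in>U. \<eta> = s (r z))) \<longrightarrow> \<phi> \<xi> \<eta> = w \<eta> - w \<xi>"
        by (simp add: LP_def)
      have "near W \<xi> (\<lambda>a b. a l \<in> U \<and> b l \<in> U)"
        by (rule near_pullback[where g = "\<lambda>\<xi>. \<xi> l" and Q = "\<lambda>y z. y \<in> U \<and> z \<in> U", OF continuous_coord xi])
           (rule near_open[OF U(1,2)])
      then show ?thesis
      proof (rule near_mono)
        fix a b assume ab: "a \<in> topspace W" "b \<in> topspace W" "a l \<in> U \<and> b l \<in> U"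
        have K': "a l \<in> K" "b l \<in> K" using ab by (auto simp: K_def)
        have sW: "s (a l) \<in> topspace W" "s (b l) \<in> topspace W" "s (a l) = s (r (a l))" "s (b l) = s (r (b l))"
          using s[OF K'(1)] s[OF K'(2)] G(4)[OF K'(1)] G(4)[OF K'(2)] by auto
        have in1: "a l \<in> U \<or> (\<exists>z\<in>U. a = s (r z))" "b l \<in> U \<or> (\<exists>z\<in>U. b = s (r z))"
          "s (a l) l \<in> U \<or> (\<exists>z\<in>U. s (a l) = s (r z))" "s (b l) l \<in> U \<or> (\<exists>z\<in>U. s (b l) = s (r z))"
          using ab sW by blast+
        have "\<phi> a b = w b - w a" "\<phi> (s (a l)) (s (b l)) = w (s (b l)) - w (s (a l))"
          "\<phi> (s (b l)) b = w b - w (s (b l))" "\<phi> (s (a l)) a = w a - w (s (a l))"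
          using w[rule_format, OF ab(1,2) in1(1,2)] w[rule_format, OF sW(1,2) in1(3,4)]
            w[rule_format, OF sW(2) ab(2) in1(4,2)] w[rule_format, OF sW(1) ab(1) in1(3,1)] by auto
        then show "\<phi> a b - \<phi> (q (a (k + l))) (q (b (k + l))) = \<phi> (s (b l)) b - \<phi> (s (a l)) a"
          using qk ab by simp
      qed
    qed
    then show "(\<lambda>\<xi> \<eta>. \<phi> \<xi> \<eta> - \<phi> (q (\<xi> (k + l))) (q (\<eta> (k + l)))) \<in> as_coboundaries W {}"
      unfolding as_coboundaries_def by (intro CollectI exI[of _ "\<lambda>\<xi>. \<phi> (s (\<xi> l)) \<xi>"]) auto
  qed
qed

text \<open>The \<open>d\<close> cocycles come from finitely many levels and hence, after iterates
  of \<open>g\<close>, from one common level \<open>m\<close>; a dependence on \<open>Y\<close>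
  pulls back along that coordinate.\<close>

lemma dep_bound_W:
  assumes d: "dep_bound (as_cocycles Y {} :: ('a option \<Rightarrow> 'a option \<Rightarrow> 'k::field) set) (as_coboundaries Y {}) d"
  shows "dep_bound (as_cocycles W {} :: (_ \<Rightarrow> _ \<Rightarrow> 'k) set) (as_coboundaries W {}) d"
  unfolding dep_bound_def
proof (intro allI impI)
  fix v :: "nat \<Rightarrow> (nat \<Rightarrow> 'a option) \<Rightarrow> (nat \<Rightarrow> 'a option) \<Rightarrow> 'k"
  assume v: "\<forall>i<d. v i \<in> as_cocycles W {}"
  define R where "R i l \<theta> \<longleftrightarrow> \<theta> \<in> as_cocycles Y {} \<and> (\<lambda>\<xi> \<eta>. v i \<xi> \<eta> - \<theta> (\<xi> l) (\<eta> l)) \<in> as_coboundaries W {}" for i l \<theta>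
  have "\<exists>l \<theta>. R i l \<theta>" if i: "i < d" for i
  proof -
    have "v i \<in> as_cocycles W {}" using v i by simp
    then show ?thesis
    proof (rule cocycle_from_level)
      fix l \<theta> assume "\<theta> \<in> as_cocycles Y {}" "(\<lambda>\<xi> \<eta>. v i \<xi> \<eta> - \<theta> (\<xi> l) (\<eta> l)) \<in> as_coboundaries W {}"
      then have "R i l \<theta>" by (simp add: R_def)
      then show ?thesis by blast
    qed
  qed
  then obtain l \<theta> where "\<And>i. i < d \<Longrightarrow> R i (l i) (\<theta> i)" by metis
  then have theta: "\<And>i. i < d \<Longrightarrow> \<theta> i \<in> as_cocycles Y {}"
    "\<And>i. i < d \<Longrightarrow> (\<lambda>\<xi> \<eta>. v i \<xi> \<eta> - \<theta> i (\<xi> (l i)) (\<eta> (l i))) \<in> as_coboundaries W {}"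
    by (auto simp: R_def)
  define m where "m = Max (insert 0 (l ` {..<d}))"
  have lm: "l i \<le> m" if "i < d" for i unfolding m_def by (rule Max_ge) (use that in auto)
  define \<theta>' where "\<theta>' i y z = \<theta> i ((g ^^ (m - l i)) y) ((g ^^ (m - l i)) z)" for i y z
  have "\<theta>' i \<in> as_cocycles Y {}" if "i < d" for i
    unfolding \<theta>'_def by (rule as_cocycles_pullback[OF continuous_g_funpow _ _ theta(1)[OF that]]) auto
  then obtain c where c: "\<exists>i<d. c i \<noteq> 0" "(\<lambda>y z. \<Sum>i<d. c i * \<theta>' i y z) \<in> as_coboundaries Y {}"
    using dep_boundD[OF d, of \<theta>'] by blast
  have "(\<lambda>\<xi> \<eta>. (\<lambda>y z. \<Sum>i<d. c i * \<theta>' i y z) (\<xi> m) (\<eta> m)) \<in> as_coboundaries W {}"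
    by (rule as_coboundaries_pullback[OF continuous_coord _ c(2)]) simp
  then have 1: "(\<lambda>\<xi> \<eta>. \<Sum>i<d. c i * \<theta>' i (\<xi> m) (\<eta> m)) \<in> as_coboundaries W {}" by simp
  have 2: "(\<lambda>\<xi> \<eta>. \<Sum>i<d. c i * (v i \<xi> \<eta> - \<theta> i (\<xi> (l i)) (\<eta> (l i)))) \<in> as_coboundaries W {}"
    by (rule as_coboundaries_sum) (use theta in auto)
  have "\<exists>u. (\<forall>\<xi>\<in>{}. u \<xi> = 0) \<and> (\<forall>\<xi>\<in>topspace W. near W \<xi> (\<lambda>a b. (\<Sum>i<d. c i * \<theta>' i (a m) (b m)) +
      (\<Sum>i<d. c i * (v i a b - \<theta> i (a (l i)) (b (l i)))) = u b - u a))"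
    using as_coboundaries_add[OF 1 2] unfolding as_coboundaries_def mem_Collect_eq .
  then obtain u where u: "\<forall>\<xi>\<in>topspace W. near W \<xi> (\<lambda>a b. (\<Sum>i<d. c i * \<theta>' i (a m) (b m)) +
      (\<Sum>i<d. c i * (v i a b - \<theta> i (a (l i)) (b (l i)))) = u b - u a)"
    by (elim exE conjE)
  have "near W \<xi> (\<lambda>a b. (\<Sum>i<d. c i * v i a b) = u b - u a)" if "\<xi> \<in> topspace W" for \<xi>
  proof (rule near_mono[OF u[rule_format, OF that]])
    fix a b assume ab: "a \<in> topspace W" "b \<in> topspace W"
      and e: "(\<Sum>i<d. c i * \<theta>' i (a m) (b m)) + (\<Sum>i<d. c i * (v i a b - \<theta> i (a (l i)) (b (l i)))) = u b - u a"
    have "\<theta>' i (a m) (b m) = \<theta> i (a (l i)) (b (l i))" if "i < d" for i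
      using W_funpow_g[OF ab(1), of "m - l i" "l i"] W_funpow_g[OF ab(2), of "m - l i" "l i"] lm[OF that]
      by (simp add: \<theta>'_def)
    then have "(\<Sum>i<d. c i * \<theta>' i (a m) (b m)) + (\<Sum>i<d. c i * (v i a b - \<theta> i (a (l i)) (b (l i))))
        = (\<Sum>i<d. c i * v i a b)"
      by (simp add: right_diff_distrib sum_subtractf)
    with e show "(\<Sum>i<d. c i * v i a b) = u b - u a" by simp
  qed
  then have "(\<lambda>a b. \<Sum>i<d. c i * v i a b) \<in> as_coboundaries W {}"
    unfolding as_coboundaries_def by (intro CollectI exI[of _ u]) auto
  with c(1) show "\<exists>c. (\<exists>i<d. c i \<noteq> 0) \<and> (\<lambda>a b. \<Sum>i<d. c i * v i a b) \<in> as_coboundaries W {}" by blast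
qed

section \<open>Locally constant functions on the invariant part\<close>

text \<open>As \<open>f\<close> maps \<open>X\<close> onto itself, a backward orbit of
  \<open>x\<close> can be chosen in \<open>X\<close>; the \<open>l\<close>-fold shift places
  \<open>x\<close> at coordinate \<open>l\<close>.\<close>

lemma Xt_surj:
  assumes x: "x \<in> X"
  obtains \<xi> where "\<xi> \<in> Xt" "\<xi> l = Some x"
proof -
  have "\<forall>y. \<exists>z. y \<in> X \<longrightarrow> z \<in> X \<and> f z = y" using index_pair_facts(13) by (metis imageE)
  then obtain p where p: "\<And>y. y \<in> X \<Longrightarrow> p y \<in> X \<and> f (p y) = y" by metis
  have pX: "(p ^^ i) x \<in> X" for i using x p by (induction i) auto
  define \<xi> where "\<xi> i = Some ((p ^^ i) x)" for i
  have "g (\<xi> (Suc i)) = \<xi> i" for i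
    using p[OF pX[of i]] pX[of i] X_subset by (auto simp: \<xi>_def g_Some)
  then have "\<xi> \<in> Xt"
    using pX X_subset by (auto simp: Xtilde_def topspace_W \<xi>_def topspace_Y)
  then have "(T ^^ l) \<xi> \<in> Xt" by (rule T_Xt)
  moreover have "(T ^^ l) \<xi> l = Some x" using T_funpow[of l \<xi> 0] by (simp add: \<xi>_def)
  ultimately show ?thesis by (rule that)
qed

text \<open>By compactness \<open>v\<close> depends on one coordinate only, through which it becomes
  a locally constant function on \<open>X\<close>, hence constant on components.\<close>

lemma locally_constant_on_Xt:
  fixes v :: "(nat \<Rightarrow> 'a option) \<Rightarrow> 'v"
  assumes v: "\<And>\<xi>. \<xi> \<in> Xt \<Longrightarrow> near W \<xi> (\<lambda>a b. a \<in> Xt \<and> b \<in> Xt \<longrightarrow> v a = v b)"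
  obtains l where "\<And>\<xi> \<eta> x y C. \<xi> \<in> Xt \<Longrightarrow> \<eta> \<in> Xt \<Longrightarrow> \<xi> l = Some x \<Longrightarrow> \<eta> l = Some y \<Longrightarrow>
     C \<in> connected_components_of (subtopology M X) \<Longrightarrow> x \<in> C \<Longrightarrow> y \<in> C \<Longrightarrow> v \<xi> = v \<eta>"
proof -
  have "\<exists>V. openin W V \<and> \<xi> \<in> V \<and> (\<forall>a\<in>V \<inter> Xt. \<forall>b\<in>V \<inter> Xt. v a = v b)" if "\<xi> \<in> Xt" for \<xi>
    using v[OF that] unfolding near_def by auto
  then obtain V where V: "\<And>\<xi>. \<xi> \<in> Xt \<Longrightarrow> openin W (V \<xi>) \<and> \<xi> \<in> V \<xi>"
    "\<And>\<xi> a b. \<xi> \<in> Xt \<Longrightarrow> a \<in> V \<xi> \<Longrightarrow> a \<in> Xt \<Longrightarrow> b \<in> V \<xi> \<Longrightarrow> b \<in> Xt \<Longrightarrow> v a = v b"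
    by (metis IntI)
  have XtW: "Xt \<subseteq> topspace W" by (auto simp: Xtilde_def)
  have "compactin W Xt" by (rule closedin_compact_space[OF compact_W closed_Xt])
  from W_uniform_level[OF this V(1)] obtain l where
    l: "\<And>\<xi>. \<xi> \<in> Xt \<Longrightarrow> \<exists>U. openin Y U \<and> \<xi> l \<in> U \<and> (\<exists>\<zeta>\<in>Xt. \<forall>\<eta>\<in>topspace W. \<eta> l \<in> U \<longrightarrow> \<eta> \<in> V \<zeta>)"
    by blast
  have U: "\<exists>U. openin Y U \<and> \<xi> l \<in> U \<and> (\<forall>\<eta>\<in>Xt. \<eta> l \<in> U \<longrightarrow> v \<eta> = v \<xi>)" if xi: "\<xi> \<in> Xt" for \<xi>
  proof -
    obtain U \<zeta> where U: "openin Y U" "\<xi> l \<in> U" "\<zeta> \<in> Xt" "\<forall>\<eta>\<in>topspace W. \<eta> l \<in> U \<longrightarrow> \<eta> \<in> V \<zeta>"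
      using l[OF xi] by blast
    have "v \<eta> = v \<xi>" if "\<eta> \<in> Xt" "\<eta> l \<in> U" for \<eta>
      by (rule V(2)[OF U(3)]) (use that xi U XtW in auto)
    with U show ?thesis by blast
  qed
  have "\<exists>\<xi>. x \<in> X \<longrightarrow> \<xi> \<in> Xt \<and> \<xi> l = Some x" for x using Xt_surj[of x l] by metis
  then obtain s where s: "\<And>x. x \<in> X \<Longrightarrow> s x \<in> Xt \<and> s x l = Some x" by metis
  have vs: "v \<xi> = v (s x)" if "\<xi> \<in> Xt" "\<xi> l = Some x" for \<xi> x
  proof -
    have "\<xi> l \<in> Some ` X" using that(1) by (auto simp: Xtilde_def)
    then have x: "x \<in> X" using that(2) by auto
    show ?thesis using U[of "s x"] s[OF x] that by metis
  qed
  have tX: "topspace (subtopology M X) = X" using compactin_subset_topspace[OF index_pair_facts(12)] by auto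
  have lc: "locally_constant_on (subtopology M X) (topspace (subtopology M X)) (\<lambda>x. v (s x))"
    unfolding locally_constant_on_def tX
  proof
    fix x assume x: "x \<in> X"
    obtain U' where U': "openin Y U'" "Some x \<in> U'" "\<forall>\<eta>\<in>Xt. \<eta> l \<in> U' \<longrightarrow> v \<eta> = v (s x)"
      using U[of "s x"] s[OF x] by metis
    have "openin (subtopology M N) {y \<in> N. quotient_proj L y \<in> U'}" using U'(1) by (simp add: openin_Y)
    then obtain U0 where U0: "openin M U0" "{y \<in> N. quotient_proj L y \<in> U'} = U0 \<inter> N"
      by (auto simp: openin_subtopology)
    have mem: "y \<in> U0 \<longleftrightarrow> Some y \<in> U'" if "y \<in> X" for y
    proof -
      have "y \<in> N" "y \<notin> L" using that X_subset by auto
      then have "y \<in> {y \<in> N. quotient_proj L y \<in> U'} \<longleftrightarrow> Some y \<in> U'" by (simp add: quotient_proj_def)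
      then show ?thesis using U0(2) \<open>y \<in> N\<close> by blast
    qed
    have vy: "v (s y) = v (s x)" if "y \<in> X" "y \<in> U0" for y
      using U'(3) s[OF that(1)] mem[OF that(1)] that(2) by simp
    show "near (subtopology M X) x (\<lambda>a b. v (s a) = v (s b))"
    proof (rule nearI)
      show "openin (subtopology M X) (U0 \<inter> X)" using U0(1) by (rule openin_subtopology_Int)
      show "x \<in> U0 \<inter> X" using x mem[OF x] U'(2) by simp
      show "v (s a) = v (s b)" if "a \<in> U0 \<inter> X" "b \<in> U0 \<inter> X" for a b using vy that by simp
    qed
  qed
  show ?thesis
  proof (rule that)
    fix \<xi> \<eta> x y C assume *: "\<xi> \<in> Xt" "\<eta> \<in> Xt" "\<xi> l = Some x" "\<eta> l = Some y"
      and C: "C \<in> connected_components_of (subtopology M X)" "x \<in> C" "y \<in> C"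
    have "\<xi> l \<in> Some ` X" using *(1) by (auto simp: Xtilde_def)
    then have xX: "x \<in> X" using *(3) by auto
    have "connected_component_of (subtopology M X) x y"
      unfolding connected_component_of_def
      using connectedin_connected_components_of[OF C(1)] C(2,3) by blast
    then have q: "quasi_component_of (subtopology M X) x y" by (rule connected_imp_quasi_component_of)
    have "v (s x) = v (s y)"
      by (rule locally_constant_on_quasi_component[OF lc openin_topspace, unfolded subtopology_topspace, of "quasi_component_of_set (subtopology M X) x"])
         (use q xX tX quasi_component_in_quasi_components_of[of "subtopology M X" x] in simp_all)
    then show "v \<xi> = v \<eta>" using vs * by metis
  qed
qed

text \<open>One linear condition per component of \<open>X\<close> and one at
  \<open>Wu_infty\<close> decide whether a combination vanishes; \<open>n\<close> exceeds their
  number by one.\<close>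

lemma dependent_on_Z:
  fixes u :: "nat \<Rightarrow> (nat \<Rightarrow> 'a option) \<Rightarrow> 'k::field"
  assumes fin: "finite (connected_components_of (subtopology M X))"
    and n: "n = card (connected_components_of (subtopology M X)) + 2"
    and u: "\<And>i \<xi>. i < n \<Longrightarrow> \<xi> \<in> Xt \<union> {Wu_infty} \<Longrightarrow>
       near W \<xi> (\<lambda>a b. a \<in> Xt \<union> {Wu_infty} \<and> b \<in> Xt \<union> {Wu_infty} \<longrightarrow> u i a = u i b)"
  shows "\<exists>c. (\<exists>i<n. c i \<noteq> 0) \<and> (\<forall>\<xi>\<in>Xt \<union> {Wu_infty}. (\<Sum>i<n. c i * u i \<xi>) = 0)"
proof -
  let ?\<C> = "connected_components_of (subtopology M X)"
  \<comment> \<open>The \<open>n\<close> functions are bundled into one, so that a single level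
    \<open>l\<close> works for all; indices from \<open>n\<close> on are set to 0, as nothing is
    assumed about them.\<close>
  define v where "v \<xi> i = (if i < n then u i \<xi> else 0)" for \<xi> i
  have "near W \<xi> (\<lambda>a b. a \<in> Xt \<and> b \<in> Xt \<longrightarrow> v a = v b)" if xi: "\<xi> \<in> Xt" for \<xi>
  proof -
    have "near W \<xi> (\<lambda>a b. \<forall>i\<in>{..<n}. a \<in> Xt \<union> {Wu_infty} \<and> b \<in> Xt \<union> {Wu_infty} \<longrightarrow> u i a = u i b)"
      by (rule near_ball) (use xi u in \<open>auto simp: Xtilde_def\<close>)
    then show ?thesis
      by (rule near_mono) (auto simp: v_def)
  qed
  from locally_constant_on_Xt[OF this] obtain l where
    l: "\<And>\<xi> \<eta> x y C. \<xi> \<in> Xt \<Longrightarrow> \<eta> \<in> Xt \<Longrightarrow> \<xi> l = Some x \<Longrightarrow> \<eta> l = Some y \<Longrightarrow>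
     C \<in> ?\<C> \<Longrightarrow> x \<in> C \<Longrightarrow> y \<in> C \<Longrightarrow> v \<xi> = v \<eta>" by blast
  define rep where "rep j = (case j of None \<Rightarrow> Wu_infty | Some C \<Rightarrow> SOME \<xi>. \<xi> \<in> Xt \<and> (\<exists>x\<in>C. \<xi> l = Some x))" for j
  have "card (insert None (Some ` ?\<C>)) \<le> Suc (card ?\<C>)"
    using fin by (metis card_image card_insert_le_m1 card_insert_if finite_imageI inj_Some le_eq_less_or_eq lessI less_Suc_eq_le)
  then have "card (insert None (Some ` ?\<C>)) < card {..<n}" using n by simp
  then obtain c where c: "\<exists>i\<in>{..<n}. c i \<noteq> 0" "\<forall>j\<in>insert None (Some ` ?\<C>). (\<Sum>i<n. c i * u i (rep j)) = 0"
    using homogeneous_system[of "insert None (Some ` ?\<C>)" "{..<n}" "\<lambda>i j. u i (rep j)"] fin by auto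
  have "(\<Sum>i<n. c i * u i \<xi>) = 0" if xi: "\<xi> \<in> Xt" for \<xi>
  proof -
    obtain x where x: "x \<in> X" "\<xi> l = Some x" using xi by (auto simp: Xtilde_def)
    have "x \<in> topspace (subtopology M X)" using x compactin_subset_topspace[OF index_pair_facts(12)] by auto
    then obtain C where C: "C \<in> ?\<C>" "x \<in> C" using Union_connected_components_of[of "subtopology M X"] by blast
    have "rep (Some C) \<in> Xt \<and> (\<exists>y\<in>C. rep (Some C) l = Some y)"
      unfolding rep_def option.case by (rule someI[of _ \<xi>]) (use xi x C in auto)
    then obtain y where "rep (Some C) \<in> Xt" "y \<in> C" "rep (Some C) l = Some y" by blast
    then have "v \<xi> = v (rep (Some C))" using l[OF xi _ x(2) _ C(1) C(2)] by blast
    then have "u i \<xi> = u i (rep (Some C))" if "i < n" for i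
      using that by (auto simp: v_def dest: fun_cong[of _ _ i])
    then have "(\<Sum>i<n. c i * u i \<xi>) = (\<Sum>i<n. c i * u i (rep (Some C)))" by simp
    then show ?thesis using c(2) C(1) by simp
  qed
  moreover have "(\<Sum>i<n. c i * u i Wu_infty) = 0" using c(2) by (simp add: rep_def)
  ultimately show ?thesis using c(1) by auto
qed

end

section \<open>Independence of the index pair\<close>

text \<open>A point of \<open>W\<close> is determined by its tail, the germ at \<open>-\<infinity>\<close> of a backward orbit; away from
  \<open>\<infinity>\<close> the tail stays near \<open>X\<close>, where all index pairs agree.\<close>

definition tail_eq :: "(nat \<Rightarrow> 'a) \<Rightarrow> (nat \<Rightarrow> 'a) \<Rightarrow> bool" where
  "tail_eq \<xi> \<eta> \<longleftrightarrow> (\<exists>i. \<forall>j\<ge>i. \<xi> j = \<eta> j)"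

lemma tail_eq_sym: "tail_eq \<xi> \<eta> \<Longrightarrow> tail_eq \<eta> \<xi>"
  unfolding tail_eq_def by metis

lemma tail_eq_trans: "tail_eq \<xi> \<eta> \<Longrightarrow> tail_eq \<eta> \<zeta> \<Longrightarrow> tail_eq \<xi> \<zeta>"
  unfolding tail_eq_def by (metis le_trans max.cobounded1 max.cobounded2)

lemma (in conley_pair) tail_eq_unique:
  assumes "\<xi> \<in> topspace W" "\<eta> \<in> topspace W" "tail_eq \<xi> \<eta>"
  shows "\<xi> = \<eta>"
proof
  fix k
  obtain i where i: "\<forall>j\<ge>i. \<xi> j = \<eta> j" using assms(3) by (auto simp: tail_eq_def)
  then have "\<xi> (i + k) = \<eta> (i + k)" by simp
  then show "\<xi> k = \<eta> k"
    using W_funpow_g[OF assms(1), of i k] W_funpow_g[OF assms(2), of i k] by simp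
qed

locale conley_pairs = p: conley_pair M D X N L f + q: conley_pair M D X N' L' f
  for M :: "'a topology" and D X N L N' L' :: "'a set" and f :: "'a \<Rightarrow> 'a"
begin

lemma conley_pairs_commute: "conley_pairs M D X N' L' N L f"
  by unfold_locales

lemma q_step:
  assumes xi: "\<xi> \<in> topspace p.W" and B: "B \<subseteq> N' - L'" "\<xi> (Suc j) \<in> Some ` B" "\<xi> j \<in> Some ` B"
  shows "q.g (\<xi> (Suc j)) = \<xi> j"
proof -
  obtain x y where xy: "x \<in> B" "\<xi> (Suc j) = Some x" "y \<in> B" "\<xi> j = Some y" using B by auto
  then have "f x = y" using p.W_step[OF xi] by blast
  then show ?thesis using xy B(1) by (auto simp: q.g_Some)
qed

text \<open>Agreement of the tails propagates downward: as long as the entries of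
  \<open>\<xi>\<close> stay in \<open>B\<close>, both index maps act on them as
  \<open>f\<close>.\<close>

lemma tail_agrees:
  assumes xi: "\<xi> \<in> topspace p.W" and eta: "\<eta> \<in> topspace q.W" "tail_eq \<xi> \<eta>"
    and B: "B \<subseteq> N' - L'" "\<And>j. k \<le> j \<Longrightarrow> \<xi> j \<in> Some ` B" and "k \<le> j"
  shows "\<eta> j = \<xi> j"
proof -
  obtain i where i: "\<forall>j\<ge>i. \<xi> j = \<eta> j" using eta(2) by (auto simp: tail_eq_def)
  have "\<eta> (j + d) = \<xi> (j + d) \<Longrightarrow> \<eta> j = \<xi> j" for d
  proof (induction d)
    case (Suc d)
    have "q.g (\<xi> (Suc (j + d))) = \<xi> (j + d)"
      by (rule q_step[OF xi B(1)]) (use B(2) \<open>k \<le> j\<close> in auto)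
    then have "\<eta> (j + d) = \<xi> (j + d)" using q.W_g[OF eta(1), of "j + d"] Suc.prems by simp
    then show ?case by (rule Suc.IH)
  qed simp
  from this[of i] i show ?thesis by simp
qed

lemma tail_exists:
  assumes xi: "\<xi> \<in> topspace p.W"
  shows "\<exists>\<eta>\<in>topspace q.W. tail_eq \<xi> \<eta>"
proof (cases "\<xi> = Wu_infty")
  case True
  then show ?thesis using q.infty_in_W by (auto simp: tail_eq_def)
next
  case False
  then obtain l where l: "\<xi> l \<noteq> None" using p.W_eq_infty[OF xi] by blast
  define B where "B = M interior_of q.A - L'"
  have B: "openin M B" "X \<subseteq> B" "B \<subseteq> N' - L'" using q.open_nbhd by (auto simp: B_def)
  obtain n where n: "\<And>\<xi> l j. \<xi> \<in> topspace p.W \<Longrightarrow> \<xi> l \<noteq> None \<Longrightarrow> l + n \<le> j \<Longrightarrow> \<xi> j \<in> Some ` B"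
    using p.W_near_X[OF B(1,2)] by blast
  define i where "i = l + n"
  have xiB: "\<xi> j \<in> Some ` B" if "i \<le> j" for j using n[OF xi l] that by (simp add: i_def)
  \<comment> \<open>From level \<open>i\<close> on the entries of \<open>\<xi>\<close> already form
    a thread for the second pair; below \<open>i\<close> they are recomputed with its index
    map.\<close>
  define \<eta> where "\<eta> k = (q.g ^^ (i - k)) (\<xi> (max i k))" for k
  have "q.g (\<eta> (Suc k)) = \<eta> k" for k
  proof (cases "i \<le> k")
    case True
    then show ?thesis using q_step[OF xi B(3) xiB xiB, of k] by (simp add: \<eta>_def max_def)
  next
    case False
    then have "i - k = Suc (i - Suc k)" "max i (Suc k) = i" "max i k = i" by auto
    then show ?thesis by (simp add: \<eta>_def)
  qed
  moreover have "\<eta> k \<in> topspace q.Y" for k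
  proof -
    have "\<xi> (max i k) \<in> topspace q.Y"
      using xiB[of "max i k"] B(3) by (auto simp: q.topspace_Y)
    then show ?thesis
      using q.continuous_g_funpow[of "i - k"] by (auto simp: \<eta>_def continuous_map_def)
  qed
  ultimately have "\<eta> \<in> topspace q.W" by (simp add: q.topspace_W)
  moreover have "tail_eq \<xi> \<eta>" unfolding tail_eq_def
    by (rule exI[of _ i]) (auto simp: \<eta>_def max_def)
  ultimately show ?thesis by blast
qed

definition transfer :: "(nat \<Rightarrow> 'a option) \<Rightarrow> nat \<Rightarrow> 'a option" where
  "transfer \<xi> = (SOME \<eta>. \<eta> \<in> topspace q.W \<and> tail_eq \<xi> \<eta>)"

lemma transfer:
  assumes "\<xi> \<in> topspace p.W"
  shows "transfer \<xi> \<in> topspace q.W" "tail_eq \<xi> (transfer \<xi>)"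
proof -
  obtain \<eta> where "\<eta> \<in> topspace q.W \<and> tail_eq \<xi> \<eta>" using tail_exists[OF assms] by blast
  then have "transfer \<xi> \<in> topspace q.W \<and> tail_eq \<xi> (transfer \<xi>)"
    unfolding transfer_def by (rule someI[of "\<lambda>\<eta>. \<eta> \<in> topspace q.W \<and> tail_eq \<xi> \<eta>"])
  then show "transfer \<xi> \<in> topspace q.W" "tail_eq \<xi> (transfer \<xi>)" by auto
qed

lemma continuous_transfer: "continuous_map p.W q.W transfer"
proof (rule q.continuous_into_W)
  fix \<xi> i assume "\<xi> \<in> topspace p.W"
  then show "q.g (transfer \<xi> (Suc i)) = transfer \<xi> i" using transfer(1) q.W_g by blast
next
  fix l
  interpret r: conley_pairs M D X N' L' N L f by (rule conley_pairs_commute)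
  define B where "B = (M interior_of p.A - L) \<inter> (M interior_of q.A - L')"
  have B: "openin M B" "X \<subseteq> B" "B \<subseteq> N' - L'" "B \<subseteq> N - L"
    using q.open_nbhd p.open_nbhd by (auto simp: B_def)
  obtain m where m: "\<And>\<xi> l j. \<xi> \<in> topspace p.W \<Longrightarrow> \<xi> l \<noteq> None \<Longrightarrow> l + m \<le> j \<Longrightarrow> \<xi> j \<in> Some ` B"
    using p.W_near_X[OF B(1,2)] by blast
  obtain B' C where C: "openin M B'" "closedin M C" "X \<subseteq> B'" "B' \<subseteq> C" "C \<subseteq> N - L"
    using p.nested_nbhd by metis
  obtain n where n: "\<And>\<xi> l j. \<xi> \<in> topspace q.W \<Longrightarrow> \<xi> l \<noteq> None \<Longrightarrow> l + n \<le> j \<Longrightarrow> \<xi> j \<in> Some ` B'"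
    using q.W_near_X[OF C(1,3)] by blast
  show "continuous_map p.W q.Y (\<lambda>\<xi>. transfer \<xi> l)"
    unfolding continuous_map_def
  proof (intro conjI allI impI)
    show "(\<lambda>\<xi>. transfer \<xi> l) \<in> topspace p.W \<rightarrow> topspace q.Y"
      using transfer(1) q.W_Y by blast
    fix V assume V: "openin q.Y V"
    show "openin p.W {\<xi> \<in> topspace p.W. transfer \<xi> l \<in> V}"
    proof (subst openin_subopen, intro ballI)
      fix \<xi>0 assume "\<xi>0 \<in> {\<xi> \<in> topspace p.W. transfer \<xi> l \<in> V}"
      then have xi0: "\<xi>0 \<in> topspace p.W" "transfer \<xi>0 l \<in> V" by auto
      show "\<exists>U. openin p.W U \<and> \<xi>0 \<in> U \<and> U \<subseteq> {\<xi> \<in> topspace p.W. transfer \<xi> l \<in> V}"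
      proof (cases "\<xi>0 = Wu_infty")
        case True
        have "tail_eq Wu_infty (transfer Wu_infty)" using transfer(2)[OF xi0(1)] True by simp
        then have "transfer \<xi>0 = Wu_infty"
          using q.tail_eq_unique[OF q.infty_in_W transfer(1)[OF xi0(1)]] True by simp
        then have NV: "None \<in> V" using xi0(2) by (simp add: Wu_infty_def)
        \<comment> \<open>If coordinate \<open>l\<close> of the transferred point is not
          \<open>None\<close>, then from level \<open>l + n\<close> on that point lies in
          \<open>B'\<close> and agrees with \<open>\<xi>\<close>, which puts
          \<open>\<xi> (l + n)\<close> in the image of \<open>C\<close>. Excluding this is an open
          condition and forces coordinate \<open>l\<close> to be \<open>None\<close>.\<close>
        let ?U = "{\<xi> \<in> topspace p.W. \<xi> (l + n) \<in> topspace p.Y - Some ` C}"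
        have "openin p.W ?U"
          by (rule openin_continuous_map_preimage[OF p.continuous_coord]) (use p.closedin_Y_Some[OF C(2,5)] in auto)
        moreover have "\<xi>0 \<in> ?U" using True xi0(1) p.None_in_Y by (auto simp: Wu_infty_def)
        moreover have "transfer \<xi> l \<in> V" if xi: "\<xi> \<in> ?U" for \<xi>
        proof (cases "transfer \<xi> l")
          case None
          with NV show ?thesis by simp
        next
          case (Some y)
          have xW: "\<xi> \<in> topspace p.W" using xi by simp
          have B'j: "transfer \<xi> j \<in> Some ` B'" if "l + n \<le> j" for j
            by (rule n[OF transfer(1)[OF xW] _ that]) (simp add: Some)
          have "\<xi> (l + n) = transfer \<xi> (l + n)"
            by (rule r.tail_agrees[OF transfer(1)[OF xW] xW tail_eq_sym[OF transfer(2)[OF xW]] _ B'j]) (use C in auto)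
          then have "\<xi> (l + n) \<in> Some ` C" using B'j[of "l + n"] C(4) by auto
          then show ?thesis using xi by auto
        qed
        ultimately show ?thesis by (intro exI[of _ ?U]) auto
      next
        case False
        then obtain k where k: "\<xi>0 k \<noteq> None" using p.W_eq_infty[OF xi0(1)] by blast
        \<comment> \<open>From level \<open>k + m\<close> on \<open>\<xi>\<close> lies in
          \<open>B\<close>, where the two pairs agree; the maximum with \<open>l\<close> lets
          coordinate \<open>l\<close> be recovered from level \<open>i\<close> by iterating the
          index map.\<close>
        define i where "i = max (k + m) l"
        have agree: "\<xi> i \<in> Some ` B \<and> transfer \<xi> i = \<xi> i" if "\<xi> \<in> topspace p.W" "\<xi> k \<noteq> None" for \<xi>
        proof -
          have Bj: "\<xi> j \<in> Some ` B" if "k + m \<le> j" for j using m[OF \<open>\<xi> \<in> topspace p.W\<close> \<open>\<xi> k \<noteq> None\<close> that] .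
          have "transfer \<xi> i = \<xi> i"
            by (rule tail_agrees[OF that(1) transfer[OF that(1)] B(3) Bj]) (auto simp: i_def)
          then show ?thesis using Bj[of i] by (simp add: i_def)
        qed
        have tl: "transfer \<xi> l = (q.g ^^ (i - l)) (transfer \<xi> i)" if "\<xi> \<in> topspace p.W" for \<xi>
          using q.W_funpow_g[OF transfer(1)[OF that], of "i - l" l] by (simp add: i_def)
        have "openin q.Y {y \<in> topspace q.Y. (q.g ^^ (i - l)) y \<in> V}"
          by (rule openin_continuous_map_preimage[OF q.continuous_g_funpow V])
        then have "openin (subtopology M N') {x \<in> N'. quotient_proj L' x \<in> {y \<in> topspace q.Y. (q.g ^^ (i - l)) y \<in> V}}"
          by (simp add: q.openin_Y)
        then obtain V0 where V0: "openin M V0" "{x \<in> N'. quotient_proj L' x \<in> {y \<in> topspace q.Y. (q.g ^^ (i - l)) y \<in> V}} = V0 \<inter> N'"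
          by (auto simp: openin_subtopology)
        have mem: "x \<in> V0 \<longleftrightarrow> (q.g ^^ (i - l)) (Some x) \<in> V" if "x \<in> B" for x
        proof -
          have x: "x \<in> N'" "x \<notin> L'" using that B(3) by auto
          have "x \<in> V0 \<longleftrightarrow> x \<in> {x \<in> N'. quotient_proj L' x \<in> {y \<in> topspace q.Y. (q.g ^^ (i - l)) y \<in> V}}"
            using V0(2) x by blast
          then show ?thesis using x by (auto simp: quotient_proj_def q.topspace_Y)
        qed
        let ?U = "{\<xi> \<in> topspace p.W. \<xi> k \<in> topspace p.Y - {None}} \<inter> {\<xi> \<in> topspace p.W. \<xi> i \<in> Some ` ((B \<inter> V0) \<inter> (N - L))}"
        have "openin p.W ?U"
        proof (rule openin_Int)
          show "openin p.W {\<xi> \<in> topspace p.W. \<xi> k \<in> topspace p.Y - {None}}"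
            by (rule openin_continuous_map_preimage[OF p.continuous_coord]) (use p.closedin_None in auto)
          show "openin p.W {\<xi> \<in> topspace p.W. \<xi> i \<in> Some ` ((B \<inter> V0) \<inter> (N - L))}"
            by (rule openin_continuous_map_preimage[OF p.continuous_coord])
               (use p.openin_Y_Some[OF openin_Int[OF B(1) V0(1)]] in auto)
        qed
        moreover have "\<xi>0 \<in> ?U"
        proof -
          obtain x where x: "x \<in> B" "\<xi>0 i = Some x" "transfer \<xi>0 i = Some x" using agree[OF xi0(1) k] by auto
          have "x \<in> V0" using mem[OF x(1)] tl[OF xi0(1)] x(3) xi0(2) by simp
          then show ?thesis using x B(4) xi0(1) k p.W_Y[OF xi0(1)] by auto
        qed
        moreover have "transfer \<xi> l \<in> V" if U: "\<xi> \<in> ?U" for \<xi>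
        proof -
          have xi: "\<xi> \<in> topspace p.W" "\<xi> k \<noteq> None" using U by auto
          obtain x where x: "x \<in> B" "x \<in> V0" "\<xi> i = Some x" using U by auto
          then show ?thesis using agree[OF xi] tl[OF xi(1)] mem[OF x(1)] by simp
        qed
        ultimately show ?thesis by (intro exI[of _ ?U]) auto
      qed
    qed
  qed
qed

text \<open>Transferring forth and back preserves the tail, which determines the point; so the two
  transfers meet the hypotheses of \<open>dep_bound_pullback\<close>.\<close>

lemma dep_bound_transfer:
  assumes d: "dep_bound (as_cocycles q.W {} :: (_ \<Rightarrow> _ \<Rightarrow> 'k::field) set) (as_coboundaries q.W {}) d"
  shows "dep_bound (as_cocycles p.W {} :: (_ \<Rightarrow> _ \<Rightarrow> 'k) set) (as_coboundaries p.W {}) d"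
proof -
  interpret r: conley_pairs M D X N' L' N L f by (rule conley_pairs_commute)
  show ?thesis
  proof (rule dep_bound_pullback[OF continuous_transfer r.continuous_transfer _ d])
    fix \<xi> assume xi: "\<xi> \<in> topspace p.W"
    note t = transfer[OF xi]
    show "r.transfer (transfer \<xi>) = \<xi>"
      by (rule p.tail_eq_unique[OF r.transfer(1)[OF t(1)] xi])
         (rule tail_eq_sym[OF tail_eq_trans[OF t(2) r.transfer(2)[OF t(1)]]])
  qed
qed

end

text \<open>Finiteness is given for the quotient of the second pair; it passes to the inverse limit
  of that pair, by transfer to \<open>W\<close>, and by the exact sequence to the relative
  group.\<close>

lemma (in conley_pair) dep_bound_Z:
  fixes N' L' :: "'a set"
  assumes fin: "finite (connected_components_of (subtopology M X))"
    and N': "index_pair M D f X N' L'"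
    and fd: "vectorspace.fin_dim (class_ring :: 'k::field ring) (cech_cohomology 1 (index_space M N' L') {} :: ('k, _) module)"
  obtains d where "dep_bound (as_cocycles W (Xt \<union> {Wu_infty}) :: (_ \<Rightarrow> _ \<Rightarrow> 'k) set) (as_coboundaries W (Xt \<union> {Wu_infty})) d"
proof -
  interpret conley_pairs M D X N L N' L' f
    by (intro conley_pairs.intro conley_pair_axioms conley_pair.intro M D f X N')
  obtain d where d: "dep_bound (as_cocycles q.Y {} :: (_ \<Rightarrow> _ \<Rightarrow> 'k) set) (as_coboundaries q.Y {}) d"
    using dep_bound_cech_cohomology_1[OF _ fd] by auto
  have "dep_bound (as_cocycles W {} :: (_ \<Rightarrow> _ \<Rightarrow> 'k) set) (as_coboundaries W {}) d"
    by (rule dep_bound_transfer) (rule q.dep_bound_W[OF d])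
  then have "dep_bound (as_cocycles W (Xt \<union> {Wu_infty}) :: (_ \<Rightarrow> _ \<Rightarrow> 'k) set) (as_coboundaries W (Xt \<union> {Wu_infty}))
      ((card (connected_components_of (subtopology M X)) + 2) * d)"
  proof (rule dep_bound_relative[rotated])
    show "Xt \<union> {Wu_infty} \<subseteq> topspace W" using infty_in_W by (auto simp: Xtilde_def)
  qed (rule dependent_on_Z[OF fin refl])
  then show ?thesis by (rule that)
qed

section \<open>Free vector spaces\<close>

lemma vectorspace_free_vector_space:
  "vectorspace (class_ring :: 'k::field ring) (free_vector_space E :: ('k, 'e \<Rightarrow> 'k) module)"
proof -
  let ?V = "free_vector_space E :: ('k, 'e \<Rightarrow> 'k) module"
  have fin: "finite {F. v F + w F \<noteq> 0}" if "finite {F. v F \<noteq> 0}" "finite {F. w F \<noteq> 0}" for v w :: "'e \<Rightarrow> 'k"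
    by (rule finite_subset[OF _ finite_UnI[OF that]]) auto
  have fin2: "finite {F. k * v F \<noteq> 0}" if "finite {F. v F \<noteq> 0}" for v :: "'e \<Rightarrow> 'k" and k
    by (rule finite_subset[OF _ that]) auto
  have ag: "abelian_group ?V"
  proof (rule abelian_groupI)
    fix v assume v: "v \<in> carrier ?V"
    then have "(\<lambda>F. - v F) \<in> carrier ?V" "(\<lambda>F. - v F) \<oplus>\<^bsub>?V\<^esub> v = \<zero>\<^bsub>?V\<^esub>"
      by (auto simp: free_vector_space_def)
    then show "\<exists>w\<in>carrier ?V. w \<oplus>\<^bsub>?V\<^esub> v = \<zero>\<^bsub>?V\<^esub>" by blast
  qed (auto simp: free_vector_space_def fin add.assoc add.commute subset_iff, (metis add_0)?)
  have "Module.module (class_ring :: 'k ring) ?V"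
  proof (rule moduleI[OF _ ag])
    show "cring (class_ring :: 'k ring)" by unfold_locales
  qed (auto simp: free_vector_space_def fin2 distrib_left distrib_right mult.assoc)
  then show ?thesis by (simp add: vectorspace_def field_class_ring)
qed

lemma linear_mapI:
  fixes V W :: "('k::field, _) module"
  assumes "vectorspace class_ring V" "vectorspace class_ring W"
    and "\<And>x. x \<in> carrier V \<Longrightarrow> h x \<in> carrier W"
    and "\<And>x y. x \<in> carrier V \<Longrightarrow> y \<in> carrier V \<Longrightarrow> h (x \<oplus>\<^bsub>V\<^esub> y) = h x \<oplus>\<^bsub>W\<^esub> h y"
    and "\<And>k x. x \<in> carrier V \<Longrightarrow> h (k \<odot>\<^bsub>V\<^esub> x) = k \<odot>\<^bsub>W\<^esub> h x"
  shows "linear_map class_ring V W h"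
  using assms
  unfolding linear_map_def mod_hom_def mod_hom_axioms_def vectorspace_def LinearCombinations.module_hom_def
  by auto

section \<open>The first cohomology of an attractor-repeller pair\<close>

context attractor_repeller
begin

text \<open>For a cocycle that has a jump, \<open>jump_const\<close> and \<open>jump_unique\<close>
  make the description unique on \<open>E\<close>; the value 0 elsewhere keeps the support in
  \<open>E\<close>.\<close>

definition jump_value :: "('b \<Rightarrow> 'b \<Rightarrow> 'k::field) \<Rightarrow> 'b set \<Rightarrow> 'k" where
  "jump_value \<phi> F = (if F \<in> E then THE t. \<exists>u. jump \<phi> u \<and> (\<forall>x\<in>F. u x = t) else 0)"

lemma jump_value:
  assumes "jump \<phi> u" "F \<in> E" "x \<in> F"
  shows "jump_value \<phi> F = u x"
proof -
  have "(THE t. \<exists>u. jump \<phi> u \<and> (\<forall>x\<in>F. u x = t)) = u x"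
  proof (rule the_equality)
    show "\<exists>v. jump \<phi> v \<and> (\<forall>y\<in>F. v y = u x)"
      using assms jump_const[OF assms(1,2) _ assms(3)] by blast
    show "t = u x" if *: "\<exists>u. jump \<phi> u \<and> (\<forall>x\<in>F. u x = t)" for t
    proof -
      obtain v where "jump \<phi> v" "\<forall>x\<in>F. v x = t" using * by (elim exE conjE)
      then show ?thesis using jump_unique[OF _ assms(1,2,3), of v] assms(3) by simp
    qed
  qed
  then show ?thesis using assms(2) by (simp add: jump_value_def)
qed

lemma jump_value_eqI:
  assumes "jump \<phi> u" "\<And>F x. F \<in> E \<Longrightarrow> x \<in> F \<Longrightarrow> u x = t F" "\<And>F. F \<notin> E \<Longrightarrow> t F = 0"
  shows "jump_value \<phi> = t"
proof
  fix F show "jump_value \<phi> F = t F"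
  proof (cases "F \<in> E")
    case True
    then obtain x where "x \<in> F" using E_nonempty by blast
    then show ?thesis using jump_value[OF assms(1) True] assms(2)[OF True] by simp
  next
    case False
    then show ?thesis using assms(3) by (simp add: jump_value_def)
  qed
qed

text \<open>Reading off jump values identifies cohomology classes with functions on the finite set
  \<open>E\<close>: the values exist by the recurrence, all vanish only for coboundaries, and are
  arbitrary. Pulling a cocycle back along \<open>T\<close> composes its jump with \<open>T\<close>,
  whence the preimages of quasicomponents.\<close>

theorem first_cohomology:
  fixes d :: nat
  defines "H \<equiv> cech_cohomology 1 W Z :: ('k::field, ('b, 'k) cech_class) module"
    and "V \<equiv> free_vector_space E :: ('k, 'b set \<Rightarrow> 'k) module"
    and "inv_T \<equiv> (\<lambda>F. {\<xi> \<in> topspace W. T \<xi> \<in> F})"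
  assumes d: "dep_bound (as_cocycles W Z :: ('b \<Rightarrow> 'b \<Rightarrow> 'k) set) (as_coboundaries W Z) d"
  shows "finite E \<and> bij_betw inv_T E E \<and>
    (\<exists>\<Phi> R. linear_map class_ring H V \<Phi> \<and> bij_betw \<Phi> (carrier H) (carrier V) \<and>
       linear_map class_ring V V R \<and> (\<forall>F\<in>E. R (basis_vector F) = basis_vector (inv_T F)) \<and>
       (\<forall>h\<in>carrier H. \<Phi> (cech_induced 1 W Z T h) = R (\<Phi> h)))"
proof -
  have fin: "finite E" by (rule finite_E[OF d])
  have VS: "vectorspace class_ring H" "vectorspace class_ring V"
    unfolding H_def V_def by (rule vectorspace_cech_cohomology_1[OF ZW] vectorspace_free_vector_space)+
  have inv_T: "inv_T F = T' ` F" if "F \<in> E" for F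
    unfolding inv_T_def by (rule preimage_eq) (use E_subset[OF that] in blast)
  have T'T: "T' ` T ` F = F" "T ` T' ` F = F" if "F \<in> E" for F
  proof -
    have F: "F \<subseteq> topspace W" using E_subset[OF that] by blast
    have "T' (T x) = x" "T (T' x) = x" if "x \<in> F" for x using F that inv inv' by auto
    then show "T' ` T ` F = F" "T ` T' ` F = F" by force+
  qed
  note ess = essential_image
  have bij: "bij_betw inv_T E E"
  proof (rule bij_betw_byWitness[where f' = "\<lambda>F. T ` F"])
    show "\<forall>F\<in>E. T ` inv_T F = F" using inv_T T'T by simp
    show "\<forall>F\<in>E. inv_T (T ` F) = F" using inv_T ess(1) T'T by simp
    show "inv_T ` E \<subseteq> E" using inv_T ess(2) by auto
    show "(\<lambda>F. T ` F) ` E \<subseteq> E" using ess(1) by auto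
  qed
  have J: "\<exists>u. jump \<phi> u" if "\<phi> \<in> as_cocycles W Z" for \<phi> :: "'b \<Rightarrow> 'b \<Rightarrow> 'k"
    using jump_exists[OF d that] .
  \<comment> \<open>Precomposition with the direct image under \<open>T\<close>: the value at
    \<open>F\<close> is read at \<open>T\<close> applied to \<open>F\<close>, so the basis vector of
    a quasicomponent goes to that of its preimage.\<close>
  define R :: "('b set \<Rightarrow> 'k) \<Rightarrow> 'b set \<Rightarrow> 'k" where "R t F = (if F \<in> E then t (T ` F) else 0)" for t F
  define rep :: "('b, 'k) cech_class \<Rightarrow> 'b \<Rightarrow> 'b \<Rightarrow> 'k" where
    "rep h = (SOME \<phi>. \<phi> \<in> as_cocycles W Z \<and> cech_class W Z \<phi> = h)" for h
  define \<Phi> where "\<Phi> h = jump_value (rep h)" for h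
  have carH: "carrier H = cech_class W Z ` as_cocycles W Z"
    unfolding H_def by (rule carrier_cech_cohomology_1[OF ZW])
  have jv0: "jump_value \<phi> F = 0" if "F \<notin> E" for F and \<phi> :: "'b \<Rightarrow> 'b \<Rightarrow> 'k"
    using that by (simp add: jump_value_def)
  have Phi: "\<Phi> (cech_class W Z \<phi>) = jump_value \<phi>" if phi: "\<phi> \<in> as_cocycles W Z" for \<phi>
  proof -
    let ?h = "cech_class W Z \<phi>"
    have r: "rep ?h \<in> as_cocycles W Z \<and> cech_class W Z (rep ?h) = ?h"
      unfolding rep_def by (rule someI[of _ \<phi>]) (use phi in auto)
    then have "(\<lambda>a b. rep ?h a b - \<phi> a b) \<in> as_coboundaries W Z"
      using cech_class_eq_iff[OF ZW, of "rep ?h" \<phi>] phi by blast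
    then have j0: "jump (\<lambda>a b. rep ?h a b - \<phi> a b) (\<lambda>_. 0)" by (rule jump_coboundary)
    obtain u where u: "jump \<phi> u" using J[OF phi] by blast
    have "jump (rep ?h) u" using jump_add[OF j0 u] by simp
    then have "jump_value (rep ?h) = jump_value \<phi>"
      by (rule jump_value_eqI) (simp_all add: jump_value[OF u] jv0)
    then show ?thesis by (simp add: \<Phi>_def)
  qed
  have carV: "carrier V = {v. \<forall>F. F \<notin> E \<longrightarrow> v F = 0}"
    unfolding V_def free_vector_space_def using fin by (auto intro: finite_subset)
  have VV: "jump_value \<phi> \<in> carrier V" for \<phi> :: "'b \<Rightarrow> 'b \<Rightarrow> 'k"
    by (simp add: carV jump_value_def)
  have Vops: "v \<oplus>\<^bsub>V\<^esub> w = (\<lambda>F. v F + w F)" "k \<odot>\<^bsub>V\<^esub> v = (\<lambda>F. k * v F)" for v w k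
    by (simp_all add: V_def free_vector_space_def)
  have add: "jump_value (\<lambda>a b. \<phi> a b + \<psi> a b) = (\<lambda>F. jump_value \<phi> F + jump_value \<psi> F)"
    if *: "\<phi> \<in> as_cocycles W Z" "\<psi> \<in> as_cocycles W Z" for \<phi> \<psi> :: "'b \<Rightarrow> 'b \<Rightarrow> 'k"
  proof -
    obtain u v where uv: "jump \<phi> u" "jump \<psi> v" using J[OF *(1)] J[OF *(2)] by blast
    show ?thesis
      by (rule jump_value_eqI[OF jump_add[OF uv]]) (auto simp: jump_value[OF uv(1)] jump_value[OF uv(2)] jv0)
  qed
  have scale: "jump_value (\<lambda>a b. k * \<phi> a b) = (\<lambda>F. k * jump_value \<phi> F)"
    if *: "\<phi> \<in> as_cocycles W Z" for \<phi> :: "'b \<Rightarrow> 'b \<Rightarrow> 'k" and k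
  proof -
    obtain u where u: "jump \<phi> u" using J[OF *] by blast
    show ?thesis
      by (rule jump_value_eqI[OF jump_scale[OF u]]) (auto simp: jump_value[OF u] jv0)
  qed
  have lin: "linear_map class_ring H V \<Phi>"
  proof (rule linear_mapI[OF VS])
    fix x assume "x \<in> carrier H"
    then obtain \<phi> where phi: "\<phi> \<in> as_cocycles W Z" "x = cech_class W Z \<phi>" using carH by blast
    then show "\<Phi> x \<in> carrier V" using Phi VV by simp
    fix k
    show "\<Phi> (k \<odot>\<^bsub>H\<^esub> x) = k \<odot>\<^bsub>V\<^esub> \<Phi> x"
      using smult_cech_cohomology_1[OF ZW phi(1), of k] Phi[OF phi(1)] Phi[OF as_cocycles_scale[OF phi(1)], of k] scale[OF phi(1)]
      by (simp add: H_def phi(2) Vops)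
  next
    fix x y assume "x \<in> carrier H" "y \<in> carrier H"
    obtain \<phi> where phi: "\<phi> \<in> as_cocycles W Z" "x = cech_class W Z \<phi>"
      using \<open>x \<in> carrier H\<close> carH by blast
    obtain \<psi> where psi: "\<psi> \<in> as_cocycles W Z" "y = cech_class W Z \<psi>"
      using \<open>y \<in> carrier H\<close> carH by blast
    show "\<Phi> (x \<oplus>\<^bsub>H\<^esub> y) = \<Phi> x \<oplus>\<^bsub>V\<^esub> \<Phi> y"
      using add_cech_cohomology_1[OF ZW phi(1) psi(1)] Phi[OF phi(1)] Phi[OF psi(1)]
        Phi[OF as_cocycles_add[OF phi(1) psi(1)]] add[OF phi(1) psi(1)]
      by (simp add: H_def phi(2) psi(2) Vops)
  qed
  have bijP: "bij_betw \<Phi> (carrier H) (carrier V)"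
    unfolding bij_betw_def
  proof
    show "inj_on \<Phi> (carrier H)"
    proof (rule inj_onI)
      fix x y assume "x \<in> carrier H" "y \<in> carrier H" and eq: "\<Phi> x = \<Phi> y"
      obtain \<phi> where phi: "\<phi> \<in> as_cocycles W Z" "x = cech_class W Z \<phi>"
        using \<open>x \<in> carrier H\<close> carH by blast
      obtain \<psi> where psi: "\<psi> \<in> as_cocycles W Z" "y = cech_class W Z \<psi>"
        using \<open>y \<in> carrier H\<close> carH by blast
      obtain u v where uv: "jump \<phi> u" "jump \<psi> v" using J[OF phi(1)] J[OF psi(1)] by blast
      have jd: "jump (\<lambda>a b. \<phi> a b + (-1) * \<psi> a b) (\<lambda>x. u x + (-1) * v x)"
        by (rule jump_add[OF uv(1) jump_scale[OF uv(2)]])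
      have "jump_value \<phi> = jump_value \<psi>" using eq Phi phi psi by simp
      then have "u x + (-1) * v x = 0" if "F \<in> E" "x \<in> F" for F x
        using jump_value[OF uv(1) that] jump_value[OF uv(2) that] by simp
      then have "(\<lambda>a b. \<phi> a b + (-1) * \<psi> a b) \<in> as_coboundaries W Z"
        by (rule coboundary_if_jump_zero[OF jd])
      then show "x = y" using cech_class_eq_iff[OF ZW phi(1) psi(1)] phi(2) psi(2) by simp
    qed
    show "\<Phi> ` carrier H = carrier V"
    proof
      show "\<Phi> ` carrier H \<subseteq> carrier V" using carH Phi VV by auto
      show "carrier V \<subseteq> \<Phi> ` carrier H"
      proof
        fix t assume t: "t \<in> carrier V"
        obtain \<phi> u where pu: "\<phi> \<in> as_cocycles W Z" "jump \<phi> u" "\<And>F x. F \<in> E \<Longrightarrow> x \<in> F \<Longrightarrow> u x = t F"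
          using cocycle_with_values[OF fin, of t] by metis
        have "jump_value \<phi> = t" by (rule jump_value_eqI[OF pu(2,3)]) (use t carV in auto)
        then have "\<Phi> (cech_class W Z \<phi>) = t" using Phi[OF pu(1)] by simp
        then show "t \<in> \<Phi> ` carrier H" using carH pu(1) by blast
      qed
    qed
  qed
  have linR: "linear_map class_ring V V R"
    by (rule linear_mapI[OF VS(2) VS(2)]) (auto simp: R_def carV Vops fun_eq_iff)
  have basis: "R (basis_vector F) = basis_vector (inv_T F)" if F: "F \<in> E" for F
  proof
    fix G
    have "G \<in> E \<and> T ` G = F \<longleftrightarrow> G = inv_T F"
      using F inv_T[OF F] T'T ess by metis
    then show "R (basis_vector F) G = basis_vector (inv_T F) G"
      by (auto simp: R_def basis_vector_def)
  qed
  have comm: "\<Phi> (cech_induced 1 W Z T h) = R (\<Phi> h)" if h: "h \<in> carrier H" for h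
  proof -
    obtain \<phi> where phi: "\<phi> \<in> as_cocycles W Z" "h = cech_class W Z \<phi>" using carH h by blast
    obtain u where u: "jump \<phi> u" using J[OF phi(1)] by blast
    have "\<Phi> (cech_induced 1 W Z T h) = \<Phi> (cech_class W Z (\<lambda>a b. \<phi> (T a) (T b)))"
      unfolding phi(2) by (simp only: cech_induced_1[OF ZW ZW cont T_image(3) phi(1)])
    also have "\<dots> = jump_value (\<lambda>a b. \<phi> (T a) (T b))"
      by (rule Phi[OF as_cocycles_pullback[OF cont T_image(3) ZW phi(1)]])
    also have "\<dots> = R (jump_value \<phi>)"
      by (rule jump_value_eqI[OF jump_pullback[OF u]])
         (simp_all add: R_def jump_value[OF u ess(1) imageI])
    finally show ?thesis using Phi phi by simp
  qed
  show ?thesis using fin bij lin bijP linR basis comm by blast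
qed

end

lemma (in conley_pair) essential_quasicomponents_eq:
  "essential_quasicomponents M f N L X = attractor_repeller.E W Xt {Wu_infty}"
proof -
  interpret attractor_repeller W Xt "{Wu_infty}" T T'
    by (rule attractor_repeller_W)
  show ?thesis
    unfolding essential_quasicomponents_def E_def Let_def by blast
qed

theorem theorem1:
  fixes M :: "'a topology" and D X N L :: "'a set" and f :: "'a \<Rightarrow> 'a"
  defines "W \<equiv> Wu M f N L"
      and "Z \<equiv> Xtilde M f N L X \<union> {Wu_infty}"
      and "ft \<equiv> shift_map f N L"
      and "E \<equiv> essential_quasicomponents M f N L X"
  defines "ft_inv \<equiv> (\<lambda>F. {\<xi> \<in> topspace W. ft \<xi> \<in> F})"
      and "K \<equiv> (class_ring :: 'k::field ring)"
  defines "H1 \<equiv> (cech_cohomology 1 W Z :: ('k, (nat \<Rightarrow> 'a option, 'k) cech_class) module)"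
      and "V \<equiv> (free_vector_space E :: ('k, (nat \<Rightarrow> 'a option) set \<Rightarrow> 'k) module)"
  assumes coefficients: "K \<simeq> (class_ring :: rat ring) \<or> K \<simeq> (class_ring :: complex ring)"
      and "locally_compact_space M" "paracompact_space M" "Hausdorff_space M"
      and "openin M D" "continuous_map (subtopology M D) M f"
      and "isolated_invariant_set M D f X"
      and "finite (connected_components_of (subtopology M X))"
      and standing: "\<exists>N' L'. index_pair M D f X N' L' \<and>
             (\<forall>q. vectorspace.fin_dim K (cech_cohomology q (index_space M N' L') {}))"
      and "index_pair M D f X N L"
  shows "finite E \<and> bij_betw ft_inv E E \<and>
         (\<exists>\<Phi> P. linear_map K H1 V \<Phi> \<and> bij_betw \<Phi> (carrier H1) (carrier V) \<and>
                linear_map K V V P \<and> (\<forall>F\<in>E. P (basis_vector F) = basis_vector (ft_inv F)) \<and>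
                (\<forall>h\<in>carrier H1. \<Phi> (cech_induced 1 W Z ft h) = P (\<Phi> h)))"
proof -
  interpret conley_pair M D X N L f
    by (intro conley_pair.intro assms)
  interpret W: attractor_repeller "Wu M f N L" "Xtilde M f N L X" "{Wu_infty}" "shift_map f N L" T'
    by (rule attractor_repeller_W)
  \<comment> \<open>The pair with finite-dimensional cohomology may differ from the one that defines
    \<open>W\<close>; \<open>dep_bound_Z\<close> bridges the two.\<close>
  obtain N' L' where N': "index_pair M D f X N' L'"
      "vectorspace.fin_dim K (cech_cohomology 1 (index_space M N' L') {} :: ('k, _) module)"
    using standing by blast
  obtain d where "dep_bound (as_cocycles (Wu M f N L) (Xtilde M f N L X \<union> {Wu_infty}) :: (_ \<Rightarrow> _ \<Rightarrow> 'k) set)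
      (as_coboundaries (Wu M f N L) (Xtilde M f N L X \<union> {Wu_infty})) d"
    using dep_bound_Z[OF _ N'(1) N'(2)[unfolded K_def]] assms by blast
  from W.first_cohomology[OF this] show ?thesis
    unfolding W_def Z_def ft_def E_def ft_inv_def K_def H1_def V_def essential_quasicomponents_eq .
qed

end
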